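(* In the two-vertex model on $\mathbb{Z}^2$ with parameters $p\in(0,1)$ and positive probability vectors $(b_1,b_2,b_3,b_4)$ and $(r_1,r_2,r_3,r_4)$, suppose $b_1>b_3$ and $r_3>r_1$. Moreover, suppose $$\frac{p(b_1-b_3)}{(1-p)(r_3-r_1)}>M:=\max\left\{\frac{b_i}{r_i}: i=1,2,3,4\right\}.$$ Then: (a) the walk is transient to the right, that is, $\lim_{n\to\infty}X_n\cdot e_1=\infty$ almost surely; (b) the walk is ballistic; in fact, with probability 1 the limit $\lim_{n\to\infty}\frac{X_n\cdot e_1}{n}$ exists and $$\frac{p(b_1-b_3)-(1-p)M(r_3-r_1)}{p+(1-p)M}\leq\lim_{n\to\infty}\frac{X_n\cdot e_1}{n}\leq\frac{b_1-b_3}{1+(1-p)[(b_1-b_3)+(r_3-r_1)]}.$$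
   Context: Two-vertex model on $\mathbb{Z}^2$: let $e_1,e_2,e_3,e_4$ denote respectively the right, up, left and down axis unit vectors of $\mathbb{Z}^2$ (so $e_3=-e_1$, $e_4=-e_2$). Fix $p\in(0,1)$ and two probability vectors $(b_1,b_2,b_3,b_4)$ and $(r_1,r_2,r_3,r_4)$ with all entries positive. Each site of $\mathbb{Z}^2$ is, independently, blue with probability $p$ and red with probability $1-p$. Given the colors, $(X_n)_{n\ge 0}$ is the Markov chain on $\mathbb{Z}^2$ started at $X_0=0$ that steps in direction $e_i$ from a blue site with probability $b_i$ and from a red site with probability $r_i$. "Almost surely" and "with probability 1" refer to the annealed law $\mathbb{P}^0$, i.e. the joint law of the random coloring and the walk. *)

theory Defs
  imports "HOL-Probability.Probability"
begin

definition unit_vec :: "nat \<Rightarrow> int \<times> int" where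
  "unit_vec i = (if i = 1 then (1, 0) else if i = 2 then (0, 1)
                 else if i = 3 then (-1, 0) else (0, -1))"

definition step_pmf :: "(nat \<Rightarrow> real) \<Rightarrow> (int \<times> int) pmf" where
  "step_pmf q = pmf_of_list (map (\<lambda>i. (unit_vec i, q i)) [1, 2, 3, 4])"

text \<open>
  A coloring is a map \<open>int \<times> int \<Rightarrow> bool\<close>, where \<open>True\<close> stands for blue and \<open>False\<close> for red.
\<close>

definition coloring_law :: "real \<Rightarrow> (int \<times> int \<Rightarrow> bool) measure" where
  "coloring_law p = PiM UNIV (\<lambda>_. measure_pmf (bernoulli_pmf p))"

definition transition :: "(nat \<Rightarrow> real) \<Rightarrow> (nat \<Rightarrow> real) \<Rightarrow> (int \<times> int \<Rightarrow> bool) \<Rightarrow>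
    int \<times> int \<Rightarrow> (int \<times> int) pmf" where
  "transition b r \<omega> x = map_pmf (\<lambda>d. x + d) (step_pmf (if \<omega> x then b else r))"

text \<open>
  The conditional law of \<open>X n\<close> given the colors and \<open>X 0, \<dots>, X (n - 1)\<close>, in the form required by
  the Ionescu-Tulcea theorem.
\<close>

definition walk_kernel :: "(nat \<Rightarrow> real) \<Rightarrow> (nat \<Rightarrow> real) \<Rightarrow> (int \<times> int \<Rightarrow> bool) \<Rightarrow>
    nat \<Rightarrow> (nat \<Rightarrow> int \<times> int) \<Rightarrow> (int \<times> int) measure" where
  "walk_kernel b r \<omega> n X =
     measure_pmf (case n of 0 \<Rightarrow> return_pmf 0 | Suc k \<Rightarrow> transition b r \<omega> (X k))"

lemma measurable_discrete_PiM:
  assumes "finite J" "\<And>x. f x \<in> space N"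
  shows "f \<in> measurable (PiM J (\<lambda>_. count_space (UNIV :: 'a :: countable set))) N"
proof -
  have "PiM J (\<lambda>_. count_space (UNIV :: 'a set)) = count_space (PiE J (\<lambda>_. UNIV))"
    using assms(1) by (intro count_space_PiM_finite) auto
  then show ?thesis using assms(2) by auto
qed

global_interpretation walk: Ionescu_Tulcea "walk_kernel b r \<omega>" "\<lambda>_. count_space UNIV"
  for b r \<omega>
proof (rule Ionescu_Tulcea.intro)
  show "walk_kernel b r \<omega> i \<in>
      measurable (PiM {0..<i} (\<lambda>_. count_space UNIV)) (subprob_algebra (count_space UNIV))"
    for b r \<omega> i
    by (rule measurable_discrete_PiM)
       (auto simp: walk_kernel_def space_subprob_algebra measure_pmf.subprob_space_axioms)
  show "prob_space (walk_kernel b r \<omega> i x)" for b r \<omega> i x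
    by (simp add: walk_kernel_def measure_pmf.prob_space_axioms)
qed

definition quenched_law :: "(nat \<Rightarrow> real) \<Rightarrow> (nat \<Rightarrow> real) \<Rightarrow> (int \<times> int \<Rightarrow> bool) \<Rightarrow>
    (nat \<Rightarrow> int \<times> int) measure" where
  "quenched_law b r \<omega> = walk.PF.lim b r \<omega>"

definition annealed_law :: "real \<Rightarrow> (nat \<Rightarrow> real) \<Rightarrow> (nat \<Rightarrow> real) \<Rightarrow>
    ((int \<times> int \<Rightarrow> bool) \<times> (nat \<Rightarrow> int \<times> int)) measure" where
  "annealed_law p b r = coloring_law p \<bind>
     (\<lambda>\<omega>. distr (quenched_law b r \<omega>)
              (coloring_law p \<Otimes>\<^sub>M PiM UNIV (\<lambda>_. count_space UNIV)) (\<lambda>X. (\<omega>, X)))"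

text \<open>
  The remaining lemmas confirm that these measures are the intended ones.
\<close>

lemma pmf_step_pmf:
  assumes "\<And>i. i \<in> {1..4} \<Longrightarrow> 0 < q i" "(\<Sum>i=1..4. q i) = 1" "i \<in> {1..4}"
  shows "pmf (step_pmf q) (unit_vec i) = q i"
proof -
  have "{1..4} = {1, 2, 3, 4::nat}" by auto
  then have eq: "q 1 + q 2 + q 3 + q 4 = 1" and i: "i = 1 \<or> i = 2 \<or> i = 3 \<or> i = 4"
    using assms(2,3) by (simp_all add: add.assoc)
  have pos: "0 < q 1" "0 < q 2" "0 < q 3" "0 < q 4" by (auto intro: assms(1))
  have "pmf_of_list_wf (map (\<lambda>i. (unit_vec i, q i)) [1, 2, 3, 4])"
    using eq pos by (intro pmf_of_list_wfI) auto
  then show ?thesis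
    using i by (auto simp: step_pmf_def pmf_pmf_of_list unit_vec_def)
qed

lemma prob_space_coloring_law: "prob_space (coloring_law p)"
  unfolding coloring_law_def by (intro prob_space_PiM measure_pmf.prob_space_axioms)

lemma sets_coloring_law:
  "sets (coloring_law p) = sets (PiM UNIV (\<lambda>_. count_space UNIV))"
  unfolding coloring_law_def by (intro sets_PiM_cong) auto

lemma space_quenched_law [simp]: "space (quenched_law b r \<omega>) = UNIV"
  by (simp add: quenched_law_def space_PiM)

lemma sets_quenched_law [measurable_cong]:
  "sets (quenched_law b r \<omega>) = sets (PiM UNIV (\<lambda>_. count_space UNIV))"
  by (simp add: quenched_law_def)

lemma emeasure_walk_C:
  "emeasure (walk.C b r \<omega> 0 n (\<lambda>_. undefined)) {restrict x {0..<n}} =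
     (\<Prod>k<n. emeasure (walk_kernel b r \<omega> k x) {x k})"
proof (induction n)
  case 0
  show ?case by (simp add: PiM_empty restrict_def emeasure_return)
next
  case (Suc n)
  let ?C = "walk.C b r \<omega> 0 n (\<lambda>_. undefined)"
  let ?P = "\<lambda>n :: nat. PiM {0..<n} (\<lambda>_. count_space (UNIV :: (int \<times> int) set))"
  have P: "?P n = count_space (PiE {0..<n} (\<lambda>_. UNIV))" for n
    by (intro count_space_PiM_finite) auto
  have C: "sets ?C = sets (?P n)" "space ?C = space (?P n)"
    using walk.sets_C[of "\<lambda>_. undefined" 0 b r \<omega> n] walk.space_C[of "\<lambda>_. undefined" 0 b r \<omega> n]
    by (simp_all add: space_PiM)
  have sg: "{restrict x {0..<m}} \<in> sets (?P m)" for m unfolding P by auto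
  have "emeasure (walk.C b r \<omega> 0 (Suc n) (\<lambda>_. undefined)) {restrict x {0..<Suc n}} =
     (\<integral>\<^sup>+X. emeasure (walk.eP b r \<omega> n X) {restrict x {0..<Suc n}} \<partial>?C)"
    unfolding walk.C.simps add_0
    using walk.measurable_eP[of b r \<omega> n] sg[of "Suc n"]
    by (intro emeasure_bind[where N = "?P (Suc n)"])
       (auto simp: C space_PiM cong: measurable_cong_sets)
  also have "\<dots> = (\<integral>\<^sup>+X. emeasure (walk_kernel b r \<omega> n x) {x n} *
                       indicator {restrict x {0..<n}} X \<partial>?C)"
  proof (intro nn_integral_cong)
    fix X assume "X \<in> space ?C"
    then have X: "X \<in> space (?P n)" by (simp add: C)
    then have ext: "X \<in> extensional {0..<n}" by (simp add: space_PiM PiE_iff)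
    have "walk_kernel b r \<omega> n X = walk_kernel b r \<omega> n x" if "X = restrict x {0..<n}"
      using that by (auto simp: walk_kernel_def split: nat.splits)
    moreover have "(\<lambda>y. X(n := y)) -` {restrict x {0..<Suc n}} =
        (if X = restrict x {0..<n} then {x n} else {})"
    proof (intro set_eqI)
      fix y
      have "X(n := y) = restrict x {0..<Suc n} \<longleftrightarrow> X = restrict x {0..<n} \<and> y = x n"
      proof
        assume *: "X(n := y) = restrict x {0..<Suc n}"
        have "X i = restrict x {0..<n} i" for i
          using fun_cong[OF *, of i] ext
          by (cases "i < n") (auto simp: extensional_def)
        then show "X = restrict x {0..<n} \<and> y = x n"
          using fun_cong[OF *, of n] by auto
      qed (auto simp: restrict_def fun_eq_iff)
      then show "y \<in> (\<lambda>y. X(n := y)) -` {restrict x {0..<Suc n}} \<longleftrightarrow>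
          y \<in> (if X = restrict x {0..<n} then {x n} else {})" by auto
    qed
    ultimately show "emeasure (walk.eP b r \<omega> n X) {restrict x {0..<Suc n}} =
        emeasure (walk_kernel b r \<omega> n x) {x n} * indicator {restrict x {0..<n}} X"
      by (subst walk.emeasure_eP[OF X sg]) (auto split: split_indicator)
  qed
  also have "\<dots> = emeasure (walk_kernel b r \<omega> n x) {x n} * emeasure ?C {restrict x {0..<n}}"
    using sg[of n] by (intro nn_integral_cmult_indicator) (simp add: C)
  finally show ?case using Suc by (simp only: prod.lessThan_Suc mult.commute)
qed

lemma emeasure_quenched_law_prefix:
  "emeasure (quenched_law b r \<omega>) {X. \<forall>k<n. X k = x k} =
     (\<Prod>k<n. emeasure (walk_kernel b r \<omega> k x) {x k})"
proof -
  let ?P = "PiM {0..<n} (\<lambda>_. count_space (UNIV :: (int \<times> int) set))"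
  have P: "?P = count_space (PiE {0..<n} (\<lambda>_. UNIV))"
    by (intro count_space_PiM_finite) auto
  have sg: "{restrict x {0..<n}} \<in> sets ?P" unfolding P by auto
  have "{X. \<forall>k<n. X k = x k} =
      prod_emb UNIV (\<lambda>_. count_space UNIV) {0..<n} {restrict x {0..<n}}"
    by (auto simp: prod_emb_def space_PiM restrict_def fun_eq_iff) meson
  then have "emeasure (quenched_law b r \<omega>) {X. \<forall>k<n. X k = x k} =
      emeasure (walk.CI b r \<omega> {0..<n}) {restrict x {0..<n}}"
    unfolding quenched_law_def using walk.lim[OF _ sg] by simp
  also have "\<dots> = emeasure (walk.C b r \<omega> 0 n (\<lambda>_. undefined)) 
      (prod_emb {0..<n} (\<lambda>_. count_space UNIV) {0..<n} {restrict x {0..<n}})"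
    by (rule walk.emeasure_CI[OF _ sg]) simp
  also have "prod_emb {0..<n} (\<lambda>_. count_space UNIV) {0..<n} {restrict x {0..<n}} =
      {restrict x {0..<n}}"
    by (rule prod_emb_id) auto
  finally show ?thesis by (simp add: emeasure_walk_C)
qed

lemma prob_space_quenched_law: "prob_space (quenched_law b r \<omega>)"
  by (intro prob_spaceI) (use emeasure_quenched_law_prefix[of b r \<omega> 0] in simp)

text \<open>Markov chain started at the origin with transition probabilities \<open>transition b r \<omega>\<close>.\<close>

theorem emeasure_quenched_law:
  "emeasure (quenched_law b r \<omega>) {X. \<forall>k\<le>n. X k = x k} =
     (if x 0 = 0 then ennreal (\<Prod>k<n. pmf (transition b r \<omega> (x k)) (x (Suc k))) else 0)"
proof -
  have "{X. \<forall>k\<le>n. X k = x k} = {X. \<forall>k<Suc n. X k = x k}" by (simp add: less_Suc_eq_le)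
  then have "emeasure (quenched_law b r \<omega>) {X. \<forall>k\<le>n. X k = x k} =
     (\<Prod>k<Suc n. emeasure (walk_kernel b r \<omega> k x) {x k})"
    by (simp only: emeasure_quenched_law_prefix)
  also have "\<dots> = emeasure (return_pmf 0) {x 0} *
      (\<Prod>k<n. ennreal (pmf (transition b r \<omega> (x k)) (x (Suc k))))"
    by (subst prod.lessThan_Suc_shift) (simp add: walk_kernel_def emeasure_pmf_single)
  finally show ?thesis by (auto simp: prod_ennreal emeasure_pmf_single)
qed

lemma measurable_quenched_law [measurable]:
  "quenched_law b r \<in> measurable (coloring_law p) (prob_algebra (PiM UNIV (\<lambda>_. count_space UNIV)))"
proof -
  let ?S = "PiM UNIV (\<lambda>_ :: nat. count_space (UNIV :: (int \<times> int) set))"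
  define G where "G = insert {} {{X. \<forall>k<n. X k = x k} | n (x :: nat \<Rightarrow> int \<times> int). True}"
  have cyl: "{X. \<forall>k<n. X k = x k} \<in> sets ?S" for n and x :: "nat \<Rightarrow> int \<times> int"
  proof -
    have "Measurable.pred ?S (\<lambda>X. \<forall>k<n. X k = x k)" by measurable
    then show ?thesis by (simp add: pred_def space_PiM)
  qed
  have inG: "{X. \<forall>k<n. X k = x k} \<in> G" for n x unfolding G_def by auto
  have sets: "sets ?S = sigma_sets UNIV G"
  proof
    have "sigma_sets (\<Pi>\<^sub>E i\<in>(UNIV :: nat set). UNIV)
        {{f \<in> \<Pi>\<^sub>E i\<in>UNIV. UNIV. f i \<in> A} | i A. i \<in> UNIV \<and> A \<in> sets (count_space (UNIV :: (int \<times> int) set))}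
      \<subseteq> sigma_sets UNIV G"
    proof (simp, intro sigma_sets_mono, safe)
      fix i :: nat and A :: "(int \<times> int) set"
      define L where "L = {l :: (int \<times> int) list. length l = Suc i \<and> l ! i \<in> A}"
      have "{f. f i \<in> A} = (\<Union>l\<in>L. {X. \<forall>k<Suc i. X k = l ! k})"
      proof safe
        fix X :: "nat \<Rightarrow> int \<times> int" assume "X i \<in> A"
        then show "X \<in> (\<Union>l\<in>L. {X. \<forall>k<Suc i. X k = l ! k})"
          by (intro UN_I[of "map X [0..<Suc i]"]) (auto simp: L_def nth_append simp del: upt_Suc)
      qed (auto simp: L_def)
      also have "\<dots> \<in> sigma_sets UNIV G"
        by (intro sigma_sets_UNION) (auto intro!: sigma_sets.Basic inG)
      finally show "{f. f i \<in> A} \<in> sigma_sets UNIV G" .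
    qed
    then show "sets ?S \<subseteq> sigma_sets UNIV G" by (simp add: sets_PiM_single)
    show "sigma_sets UNIV G \<subseteq> sets ?S"
      using sets.sigma_sets_subset[of G ?S] cyl by (auto simp: G_def space_PiM)
  qed
  have Int: "Int_stable G"
  proof (rule Int_stableI)
    have *: "{X. \<forall>k<n. X k = x k} \<inter> {X. \<forall>k<m. X k = y k} \<in> G" if "n \<le> m"
      for n m and x y :: "nat \<Rightarrow> int \<times> int"
    proof (cases "\<forall>k<n. x k = y k")
      case True
      then have "{X. \<forall>k<n. X k = x k} \<inter> {X. \<forall>k<m. X k = y k} = {X. \<forall>k<m. X k = y k}"
        using that by auto
      then show ?thesis by (simp add: inG)
    next
      case False
      then have "{X. \<forall>k<n. X k = x k} \<inter> {X. \<forall>k<m. X k = y k} = {}"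
        using that by fastforce
      then show ?thesis by (simp add: G_def)
    qed
    fix A B assume "A \<in> G" "B \<in> G"
    then consider "A = {} \<or> B = {}" | n x m y where
      "A = {X. \<forall>k<n. X k = x k}" "B = {X. \<forall>k<m. X k = y k}"
      unfolding G_def by blast
    then show "A \<inter> B \<in> G"
    proof cases
      case 2
      then show ?thesis using *[of n m x y] *[of m n y x] by (cases "n \<le> m") (auto simp: Int_commute)
    qed (auto simp: G_def)
  qed
  show ?thesis
  proof (rule measurable_prob_algebra_generated[OF sets Int])
    show "G \<subseteq> Pow UNIV" by simp
    show "prob_space (quenched_law b r \<omega>)" for \<omega> by (rule prob_space_quenched_law)
    show "sets (quenched_law b r \<omega>) = sets ?S" for \<omega> by (rule sets_quenched_law)
    fix A assume "A \<in> G"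
    then consider "A = {}" | n x where "A = {X. \<forall>k<n. X k = x k}" unfolding G_def by blast
    then show "(\<lambda>\<omega>. emeasure (quenched_law b r \<omega>) A) \<in> borel_measurable (coloring_law p)"
    proof cases
      case (2 n x)
      have "(\<lambda>\<omega>. emeasure (walk_kernel b r \<omega> k x) {x k}) \<in> borel_measurable (coloring_law p)" for k
      proof (cases k)
        case 0
        then show ?thesis by (simp add: walk_kernel_def)
      next
        case (Suc j)
        define h where "h c = emeasure (map_pmf (\<lambda>d. x j + d) (step_pmf (if c then b else r))) {x k}" for c
        have "(\<lambda>\<omega>. \<omega> (x j)) \<in> measurable (coloring_law p) (measure_pmf (bernoulli_pmf p))"
          unfolding coloring_law_def by (rule measurable_component_singleton) simp
        then have "(\<lambda>\<omega>. \<omega> (x j)) \<in> measurable (coloring_law p) (count_space UNIV)"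
          by (rule measurable_cong_sets[THEN equalityD1, THEN subsetD, rotated 2]) auto
        then have "(\<lambda>\<omega>. h (\<omega> (x j))) \<in> borel_measurable (coloring_law p)"
          by (rule measurable_compose) simp
        then show ?thesis using Suc by (simp add: h_def walk_kernel_def transition_def)
      qed
      then show ?thesis unfolding 2 emeasure_quenched_law_prefix by measurable
    qed simp
  qed
qed

theorem emeasure_annealed_law:
  assumes [measurable]: "A \<in> sets (coloring_law p)" "B \<in> sets (PiM UNIV (\<lambda>_. count_space UNIV))"
  shows "emeasure (annealed_law p b r) (A \<times> B) =
    (\<integral>\<^sup>+\<omega>. emeasure (quenched_law b r \<omega>) B * indicator A \<omega> \<partial>coloring_law p)"
proof -
  let ?S = "PiM UNIV (\<lambda>_ :: nat. count_space (UNIV :: (int \<times> int) set))"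
  let ?N = "coloring_law p \<Otimes>\<^sub>M ?S"
  interpret prob_space "coloring_law p" by (rule prob_space_coloring_law)
  have "(\<lambda>\<omega>. distr (quenched_law b r \<omega>) ?N (Pair \<omega>)) \<in> measurable (coloring_law p) (subprob_algebra ?N)"
    by (rule measurable_distr2[where M = ?S]) 
       (auto intro: measurable_prob_algebraD[OF measurable_quenched_law])
  then have "emeasure (annealed_law p b r) (A \<times> B) =
     (\<integral>\<^sup>+\<omega>. emeasure (distr (quenched_law b r \<omega>) ?N (Pair \<omega>)) (A \<times> B) \<partial>coloring_law p)"
    unfolding annealed_law_def by (intro emeasure_bind[where N = ?N] not_empty) auto
  also have "\<dots> = (\<integral>\<^sup>+\<omega>. emeasure (quenched_law b r \<omega>) B * indicator A \<omega> \<partial>coloring_law p)"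
  proof (intro nn_integral_cong)
    fix \<omega> assume \<omega>: "\<omega> \<in> space (coloring_law p)"
    then have "Pair \<omega> \<in> measurable (quenched_law b r \<omega>) ?N"
      by (simp cong: measurable_cong_sets add: sets_quenched_law)
    then have "emeasure (distr (quenched_law b r \<omega>) ?N (Pair \<omega>)) (A \<times> B) =
       emeasure (quenched_law b r \<omega>) (Pair \<omega> -` (A \<times> B))"
      by (subst emeasure_distr) auto
    also have "Pair \<omega> -` (A \<times> B) = (if \<omega> \<in> A then B else {})" by auto
    finally show "emeasure (distr (quenched_law b r \<omega>) ?N (Pair \<omega>)) (A \<times> B) =
       emeasure (quenched_law b r \<omega>) B * indicator A \<omega>" by simp
  qed
  finally show ?thesis .
qed

lemma prob_space_annealed_law: "prob_space (annealed_law p b r)"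
proof -
  let ?S = "PiM UNIV (\<lambda>_ :: nat. count_space (UNIV :: (int \<times> int) set))"
  let ?N = "coloring_law p \<Otimes>\<^sub>M ?S"
  have "(\<lambda>\<omega>. distr (quenched_law b r \<omega>) ?N (Pair \<omega>)) \<in> measurable (coloring_law p) (subprob_algebra ?N)"
    by (rule measurable_distr2[where M = ?S]) 
       (auto intro: measurable_prob_algebraD[OF measurable_quenched_law])
  moreover have "prob_space (distr (quenched_law b r \<omega>) ?N (Pair \<omega>))"
    if "\<omega> \<in> space (coloring_law p)" for \<omega>
    using that by (intro prob_space.prob_space_distr prob_space_quenched_law)
      (simp cong: measurable_cong_sets add: sets_quenched_law)
  ultimately show ?thesis
    unfolding annealed_law_def
    by (intro prob_space.prob_space_bind[OF prob_space_coloring_law]) auto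
qed

end

theory Submission
  imports Defs
begin

text \<open>
  The horizontal speed \<open>v = lim X\<^sub>n \<bullet> e\<^sub>1 / n\<close> is obtained from a regeneration structure, and its
  existence, its positivity and its lower bound all rest on one comparison due to Kalikow.

  Kalikow's comparison. Fix a site \<open>y\<close> and the colors of all other sites, and discount time by
  \<open>s < 1\<close>. The expected number of visits to \<open>y\<close> is at most \<open>M\<close> times larger when \<open>y\<close> is red than
  when it is blue (\<open>green_recolor_le\<close>). Averaging over the color of \<open>y\<close> and summing over \<open>y\<close>, the
  discounted time spent at red sites is at most \<open>(1 - p) * M / p\<close> times the discounted time spent
  at blue sites, with any bounded nonnegative weight on sites and also for the walk killed
  outside a set (\<open>occ_red_le\<close>). With constant weight this bounds the discounted mean drift from
  below by \<open>min_speed > 0\<close> (\<open>discounted_drift\<close>). With an exponential weight it makes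
  \<open>exp (- l * fst X\<^sub>n)\<close> a supermartingale on average, for small \<open>l > 0\<close>, so that the walk ever
  reaches level \<open>- m\<close> with probability at most \<open>exp (- l * m)\<close> (\<open>exit_left_half_space\<close>). In
  particular the walk never falls below its starting level with positive probability.

  Regeneration. Call a time a record if the level is strictly larger than ever before, and a
  regeneration time if moreover the walk never returns below that level. At a record time the
  colors ahead have not been used, so the future, on the event of a regeneration, is independent
  of the past (\<open>renewal\<close>). Decomposing over the last regeneration time before \<open>n\<close> gives
  \<open>\<Sum>k\<le>n. a\<^sub>k * F\<^bsub>n-k\<^esub> \<le> 1\<close>, where \<open>a\<^sub>k\<close> is the probability of a record at time \<open>k\<close> and \<open>F\<^sub>j\<close> the
  probability of never falling below the starting level and not regenerating at the times
  \<open>1, \<dots>, j\<close>. The level at time \<open>n\<close> is at most the number of records up to then, so the discounted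
  sums of the \<open>a\<^sub>k\<close> inherit the lower bound on the drift, and \<open>\<Sum>j. F\<^sub>j \<le> 1 / min_speed\<close>
  (\<open>sum_no_regen_le\<close>). Hence, conditionally on never falling below the starting level, the first
  regeneration time is finite and has finite mean.

  Law of large numbers. Restarting the path at its next regeneration time preserves this
  conditional law and is ergodic, so the pointwise ergodic theorem, proved here by Garsia's
  maximal inequality, yields a deterministic speed under the conditional law
  (\<open>AE_regen_law_speed\<close>). Under the full law, by the Markov property, a path without this speed
  almost surely falls below its level after every time, which contradicts the exponential bound
  (\<open>AE_speed\<close>).

  Bounds. By dominated convergence the speed is the limit of the mean level divided by \<open>n\<close>. The
  lower bound is the bound on the discounted drift. For the upper bound, every record is a first
  visit to a site, and such a site is red with probability \<open>1 - p\<close>, so the mean fraction of red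
  steps is at least \<open>(1 - p) * v\<close> in the limit. Transience follows from \<open>v > 0\<close>.
\<close>

section \<open>A pointwise ergodic theorem\<close>

text \<open>
  An ergodic transformation of a probability space: sets that are exactly invariant have probability
  \<open>0\<close> or \<open>1\<close>.
\<close>

locale ergodic_map = prob_space M for M :: "'a measure" +
  fixes T :: "'a \<Rightarrow> 'a"
  assumes measurable_T [measurable]: "T \<in> M \<rightarrow>\<^sub>M M"
    and invariant: "distr M M T = M"
    and ergodic: "\<And>A. A \<in> sets M \<Longrightarrow> (\<And>x. x \<in> space M \<Longrightarrow> T x \<in> A \<longleftrightarrow> x \<in> A) \<Longrightarrow> prob A = 0 \<or> prob A = 1"
begin

definition birkhoff_sum :: "('a \<Rightarrow> real) \<Rightarrow> nat \<Rightarrow> 'a \<Rightarrow> real" where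
  "birkhoff_sum f n x = (\<Sum>k<n. f ((T ^^ k) x))"

lemma measurable_T_power [measurable]: "(T ^^ k) \<in> M \<rightarrow>\<^sub>M M"
  by (induction k) (auto intro: measurable_T measurable_comp)

lemma measurable_birkhoff_sum [measurable]:
  assumes [measurable]: "f \<in> borel_measurable M"
  shows "birkhoff_sum f n \<in> borel_measurable M"
  unfolding birkhoff_sum_def by measurable

lemma birkhoff_sum_Suc: "birkhoff_sum f (Suc n) x = f x + birkhoff_sum f n (T x)"
  unfolding birkhoff_sum_def by (simp only: sum.lessThan_Suc_shift funpow_Suc_right) simp

lemma integrable_T: "integrable M f \<Longrightarrow> integrable M (\<lambda>x. f (T x) :: real)"
  using integrable_distr[OF measurable_T, of f] unfolding invariant by simp

lemma integral_T: "f \<in> borel_measurable M \<Longrightarrow> (\<integral>x. f (T x) \<partial>M) = (\<integral>x. (f x :: real) \<partial>M)"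
  using integral_distr[OF measurable_T, of f] unfolding invariant by simp

text \<open>
  The maximal ergodic inequality, by Garsia's argument. The function \<open>m n\<close> is the maximum of
  \<open>0\<close> and the first \<open>n\<close> Birkhoff sums; it satisfies \<open>g = m (n + 1) - m n \<circ> T\<close> where
  \<open>m (n + 1)\<close> is positive, and the integral of \<open>m (n + 1) - m (n + 1) \<circ> T\<close> vanishes.
\<close>

lemma maximal_ergodic:
  assumes g: "integrable M g" and pos: "AE x in M. \<exists>n. birkhoff_sum g n x > 0"
  shows "(\<integral>x. g x \<partial>M) \<ge> 0"
proof -
  define m where "m = rec_nat (\<lambda>_. 0) (\<lambda>_ h x. max 0 (g x + h (T x)))"
  have m0: "m 0 x = 0" and mS: "m (Suc n) x = max 0 (g x + m n (T x))" for n x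
    by (simp_all add: m_def)
  have [measurable]: "g \<in> borel_measurable M" using g by simp
  have int: "integrable M (m n)" for n
  proof (induction n)
    case (Suc n)
    have "integrable M (\<lambda>x. max 0 (g x + m n (T x)))"
      using g integrable_T[OF Suc] by (intro integrable_max) auto
    then show ?case by (simp add: mS[abs_def])
  qed (simp add: m0[abs_def])
  then have [measurable]: "m n \<in> borel_measurable M" for n by simp
  have inc: "m n x \<le> m (Suc n) x" for n x
  proof (induction n arbitrary: x)
    case (Suc n)
    show ?case unfolding mS[of n x] mS[of "Suc n" x] by (intro max.mono add_left_mono Suc order_refl)
  qed (simp add: m0 mS)
  have mono: "m i x \<le> m j x" if "i \<le> j" for i j x
    by (rule lift_Suc_mono_le[of "\<lambda>n. m n x", OF inc that])
  have S: "birkhoff_sum g n x \<le> m n x" for n x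
  proof (induction n arbitrary: x)
    case (Suc n)
    show ?case using Suc[of "T x"] by (simp add: mS birkhoff_sum_Suc)
  qed (simp add: m0 birkhoff_sum_def)
  define A where "A n = {x \<in> space M. m (Suc n) x > 0}" for n
  have [measurable]: "A n \<in> sets M" for n unfolding A_def by measurable
  have "0 \<le> (\<integral>x. g x * indicator (A n) x \<partial>M)" for n
  proof -
    have "0 = (\<integral>x. m (Suc n) x - m (Suc n) (T x) \<partial>M)"
      using integral_T[of "m (Suc n)"] integrable_T[OF int] int by simp
    also have "\<dots> \<le> (\<integral>x. g x * indicator (A n) x \<partial>M)"
    proof (intro integral_mono)
      show "integrable M (\<lambda>x. g x * indicator (A n) x)"
        using g by (intro integrable_real_mult_indicator) auto
      fix x assume "x \<in> space M"
      have "m n (T x) \<le> m (Suc n) (T x)" "0 \<le> m (Suc n) (T x)" using inc by (auto simp: mS)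
      then show "m (Suc n) x - m (Suc n) (T x) \<le> g x * indicator (A n) x"
        using \<open>x \<in> space M\<close> by (auto simp: A_def indicator_def mS[of n x])
    qed (use int integrable_T in auto)
    finally show ?thesis .
  qed
  moreover have "(\<lambda>n. \<integral>x. g x * indicator (A n) x \<partial>M) \<longlonglongrightarrow> (\<integral>x. g x \<partial>M)"
  proof (rule integral_dominated_convergence[where w = "\<lambda>x. \<bar>g x\<bar>"])
    show "AE x in M. (\<lambda>n. g x * indicator (A n) x) \<longlonglongrightarrow> g x"
      using pos AE_space
    proof (eventually_elim)
      case (elim x)
      then obtain n where n: "birkhoff_sum g n x > 0" by blast
      have "\<forall>\<^sub>F k in sequentially. g x * indicator (A k) x = g x"
        using eventually_ge_at_top[of n]
      proof eventually_elim
        case (elim k)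
        have "0 < m (Suc k) x" using n S[of n x] mono[of n "Suc k" x] \<open>n \<le> k\<close> by simp
        then show ?case using \<open>x \<in> space M\<close> by (simp add: A_def)
      qed
      then show ?case by (rule tendsto_eventually)
    qed
  qed (use g in \<open>auto simp: indicator_def\<close>)
  ultimately show ?thesis by (auto intro: LIMSEQ_le_const)
qed

text \<open>
  Unboundedness of the Birkhoff sums is an invariant event. If it had probability \<open>1\<close>, the maximal
  inequality would force a nonnegative mean.
\<close>

lemma birkhoff_sum_bounded_above:
  assumes g: "integrable M g" and neg: "(\<integral>x. g x \<partial>M) < 0"
  shows "AE x in M. \<exists>C. \<forall>n. birkhoff_sum g n x \<le> C"
proof -
  have [measurable]: "g \<in> borel_measurable M" using g by simp
  define A where "A = {x \<in> space M. \<forall>c::nat. \<exists>n. birkhoff_sum g n x > real c}"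
  have A [measurable]: "A \<in> sets M" unfolding A_def by measurable
  have "T x \<in> A \<longleftrightarrow> x \<in> A" if "x \<in> space M" for x
  proof -
    have Tx: "T x \<in> space M" using measurable_space[OF measurable_T that] .
    have "x \<in> A" if *: "T x \<in> A"
      unfolding A_def
    proof (intro CollectI conjI allI)
      fix c :: nat
      obtain n where "birkhoff_sum g n (T x) > real (nat \<lceil>real c - g x\<rceil>)" using * unfolding A_def by blast
      then have "birkhoff_sum g (Suc n) x > real c" unfolding birkhoff_sum_Suc by linarith
      then show "\<exists>n. birkhoff_sum g n x > real c" by blast
    qed fact
    moreover have "T x \<in> A" if *: "x \<in> A"
      unfolding A_def
    proof (intro CollectI conjI allI)
      fix c :: nat
      obtain n where n: "birkhoff_sum g n x > real (c + nat \<lceil>\<bar>g x\<bar>\<rceil>)" using * unfolding A_def by blast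
      have "n \<noteq> 0" using n by (intro notI) (simp add: birkhoff_sum_def, linarith)
      then obtain k where k: "n = Suc k" by (cases n) auto
      have "birkhoff_sum g k (T x) > real c" using n unfolding k birkhoff_sum_Suc by linarith
      then show "\<exists>n. birkhoff_sum g n (T x) > real c" by blast
    qed fact
    ultimately show ?thesis by blast
  qed
  then have "prob A = 0 \<or> prob A = 1" by (intro ergodic) auto
  moreover have "prob A \<noteq> 1"
  proof
    assume "prob A = 1"
    then have "AE x in M. x \<in> A" using prob_eq_1 by simp
    then have "AE x in M. \<exists>n. birkhoff_sum g n x > 0"
      by (rule eventually_mono) (auto simp: A_def elim!: allE[of _ 0])
    from maximal_ergodic[OF g this] neg show False by simp
  qed
  ultimately have "AE x in M. x \<notin> A" using prob_eq_0[of A] by simp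
  then show ?thesis
    using AE_space
  proof eventually_elim
    case (elim x)
    then obtain c :: nat where "\<not> (\<exists>n. birkhoff_sum g n x > real c)" unfolding A_def by blast
    then show ?case by (intro exI[of _ "real c"]) (auto simp: not_less)
  qed
qed

lemma birkhoff_upper:
  assumes f: "integrable M f" and e: "e > 0"
  shows "AE x in M. \<forall>\<^sub>F n in sequentially. birkhoff_sum f n x / n < (\<integral>x. f x \<partial>M) + e"
proof -
  define c where "c = (\<integral>x. f x \<partial>M) + e / 2"
  have "(\<integral>x. f x - c \<partial>M) < 0" using f e by (simp add: c_def prob_space)
  then have "AE x in M. \<exists>C. \<forall>n. birkhoff_sum (\<lambda>x. f x - c) n x \<le> C"
    using f by (intro birkhoff_sum_bounded_above) auto
  then show ?thesis
  proof eventually_elim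
    case (elim x)
    then obtain C where C: "birkhoff_sum (\<lambda>x. f x - c) n x \<le> C" for n by blast
    have *: "birkhoff_sum f n x \<le> C + n * c" for n
      using C[of n] by (simp add: birkhoff_sum_def sum_subtractf)
    have "(\<lambda>n. C / real n) \<longlonglongrightarrow> 0" by (rule lim_const_over_n)
    then have "\<forall>\<^sub>F n in sequentially. C / real n < e / 2" using e by (intro order_tendstoD) auto
    then show ?case using eventually_gt_at_top[of 0]
    proof eventually_elim
      case (elim n)
      have "birkhoff_sum f n x / n \<le> (C + n * c) / n" using * by (intro divide_right_mono) auto
      also have "\<dots> = C / n + c" using elim by (simp add: field_simps)
      also have "\<dots> < (\<integral>x. f x \<partial>M) + e" using elim(1) unfolding c_def by linarith
      finally show ?case .
    qed
  qed
qed

theorem birkhoff_ergodic: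
  assumes f: "integrable M f"
  shows "AE x in M. (\<lambda>n. birkhoff_sum f n x / n) \<longlonglongrightarrow> (\<integral>x. f x \<partial>M)"
proof -
  let ?e = "\<lambda>j. 1 / real (Suc j)"
  have "AE x in M. \<forall>j. \<forall>\<^sub>F n in sequentially. birkhoff_sum f n x / n < (\<integral>x. f x \<partial>M) + ?e j"
    unfolding AE_all_countable by (intro allI birkhoff_upper) (use f in auto)
  moreover have "AE x in M. \<forall>j. \<forall>\<^sub>F n in sequentially.
      birkhoff_sum (\<lambda>x. - f x) n x / n < (\<integral>x. - f x \<partial>M) + ?e j"
    unfolding AE_all_countable by (intro allI birkhoff_upper) (use f in auto)
  ultimately show ?thesis
  proof eventually_elim
    case (elim x)
    have neg: "birkhoff_sum (\<lambda>x. - f x) n x = - birkhoff_sum f n x" for n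
      by (simp add: birkhoff_sum_def sum_negf)
    show ?case
    proof (rule order_tendstoI)
      fix a assume "(\<integral>x. f x \<partial>M) < a"
      then obtain j where "?e j < a - (\<integral>x. f x \<partial>M)" using reals_Archimedean[of "a - (\<integral>x. f x \<partial>M)"]
        by (auto simp: inverse_eq_divide)
      then show "\<forall>\<^sub>F n in sequentially. birkhoff_sum f n x / n < a"
        by (intro eventually_mono[OF elim(1)[rule_format, of j]]) linarith
    next
      fix a assume "a < (\<integral>x. f x \<partial>M)"
      then obtain j where "?e j < (\<integral>x. f x \<partial>M) - a" using reals_Archimedean[of "(\<integral>x. f x \<partial>M) - a"]
        by (auto simp: inverse_eq_divide)
      then show "\<forall>\<^sub>F n in sequentially. a < birkhoff_sum f n x / n"
        by (intro eventually_mono[OF elim(2)[rule_format, of j]]) (simp add: neg)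
    qed
  qed
qed

end

section \<open>Events determined by a prefix of the path\<close>

abbreviation path_space :: "(nat \<Rightarrow> int \<times> int) measure" where
  "path_space \<equiv> PiM UNIV (\<lambda>_. count_space UNIV)"

text \<open>
  The paths that agree with \<open>x\<close> up to and including time \<open>n\<close>.
\<close>

definition cyl :: "nat \<Rightarrow> (nat \<Rightarrow> int \<times> int) \<Rightarrow> (nat \<Rightarrow> int \<times> int) set" where
  "cyl n x = {X. \<forall>k\<le>n. X k = x k}"

text \<open>
  The event \<open>E\<close> depends only on the path up to and including time \<open>n\<close>.
\<close>

definition prefix_det :: "nat \<Rightarrow> ((nat \<Rightarrow> int \<times> int) \<Rightarrow> bool) \<Rightarrow> bool" where
  "prefix_det n E \<longleftrightarrow> (\<forall>X Y. (\<forall>k\<le>n. X k = Y k) \<longrightarrow> E X = E Y)"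

text \<open>
  The path seen from time \<open>n\<close> on, translated to start at the origin.
\<close>

definition shift :: "nat \<Rightarrow> (nat \<Rightarrow> int \<times> int) \<Rightarrow> nat \<Rightarrow> int \<times> int" where
  "shift n X = (\<lambda>k. X (n + k) - X n)"

lemma prefix_detI: "(\<And>X Y. (\<And>k. k \<le> n \<Longrightarrow> X k = Y k) \<Longrightarrow> E X \<Longrightarrow> E Y) \<Longrightarrow> prefix_det n E"
  unfolding prefix_det_def by metis

lemma prefix_detD: "prefix_det n E \<Longrightarrow> (\<And>k. k \<le> n \<Longrightarrow> X k = Y k) \<Longrightarrow> E X = E Y"
  unfolding prefix_det_def by blast

lemma measurable_path_component [measurable]: "(\<lambda>X. X k) \<in> path_space \<rightarrow>\<^sub>M count_space UNIV"
  by (rule measurable_component_singleton) simp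

lemma measurable_path_component2:
  "(\<lambda>X. h (X i) (X j)) \<in> path_space \<rightarrow>\<^sub>M count_space UNIV"
proof -
  have "(\<lambda>X. h a (X j)) \<in> path_space \<rightarrow>\<^sub>M count_space UNIV" for a
    by (rule measurable_compose[OF measurable_path_component]) simp
  then show ?thesis
    by (rule measurable_compose_countable[of "\<lambda>a X. h a (X j)"]) simp
qed

lemma measurable_shift [measurable]: "shift n \<in> path_space \<rightarrow>\<^sub>M path_space"
proof (rule measurable_PiM_single')
  show "(\<lambda>X. shift n X k) \<in> path_space \<rightarrow>\<^sub>M count_space UNIV" for k
    unfolding shift_def by (rule measurable_path_component2)
qed simp

lemma sets_cyl [measurable]: "cyl n x \<in> sets path_space"
proof -
  have "Measurable.pred path_space (\<lambda>X. \<forall>k\<le>n. X k = x k)" by measurable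
  then show ?thesis by (simp add: pred_def space_PiM cyl_def)
qed

lemma cyl_cases: "n \<le> m \<Longrightarrow> cyl n x \<inter> cyl m y = (if \<forall>k\<le>n. x k = y k then cyl m y else {})"
  by (auto simp: cyl_def)

text \<open>
  An event decided by time \<open>n\<close> is a countable union of cylinders. These are indexed by lists, so
  that the index set is countable.
\<close>

lemma prefix_event_UN_cyl:
  assumes E: "prefix_det n E"
  shows "{X. E X} = (\<Union>a\<in>{a. length a = Suc n \<and> E (nth a)}. cyl n (nth a))"
proof (intro set_eqI iffI)
  fix X assume "X \<in> {X. E X}"
  define a where "a = map X [0..<Suc n]"
  have a: "a ! k = X k" if "k \<le> n" for k
    using that unfolding a_def by (subst nth_map) (auto simp del: upt_Suc)
  have "E (nth a)" using prefix_detD[OF E, of "nth a" X] a \<open>X \<in> _\<close> by auto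
  moreover have "X \<in> cyl n (nth a)" using a by (auto simp: cyl_def)
  moreover have "length a = Suc n" by (simp add: a_def)
  ultimately show "X \<in> (\<Union>a\<in>{a. length a = Suc n \<and> E (nth a)}. cyl n (nth a))" by blast
next
  fix X assume "X \<in> (\<Union>a\<in>{a. length a = Suc n \<and> E (nth a)}. cyl n (nth a))"
  then obtain a where "E (nth a)" "X \<in> cyl n (nth a)" by auto
  then show "X \<in> {X. E X}" using prefix_detD[OF E, of X "nth a"] by (auto simp: cyl_def)
qed

lemma sets_prefix_event: "prefix_det n E \<Longrightarrow> {X. E X} \<in> sets path_space"
  by (subst prefix_event_UN_cyl) (auto intro!: sets.countable_UN'')

lemma emeasure_prefix_event:
  assumes E: "prefix_det n E" and M: "sets M = sets path_space" and A: "A \<in> sets path_space"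
  shows "emeasure M ({X. E X} \<inter> A) =
    (\<integral>\<^sup>+a. emeasure M (cyl n (nth a) \<inter> A) \<partial>count_space {a. length a = Suc n \<and> E (nth a)})"
proof -
  let ?I = "{a. length a = Suc n \<and> E (nth a)}"
  have "{X. E X} \<inter> A = (\<Union>a\<in>?I. cyl n (nth a) \<inter> A)"
    by (subst prefix_event_UN_cyl[OF E]) auto
  also have "emeasure M \<dots> = (\<integral>\<^sup>+a. emeasure M (cyl n (nth a) \<inter> A) \<partial>count_space ?I)"
  proof (rule emeasure_UN_countable)
    show "disjoint_family_on (\<lambda>a. cyl n (nth a) \<inter> A) ?I"
      unfolding disjoint_family_on_def cyl_def by (auto intro!: nth_equalityI)
  qed (use A M sets_cyl in auto)
  finally show ?thesis .
qed

lemma UNIV_in_path_space: "UNIV \<in> sets path_space"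
  using sets.top[of path_space] by (simp add: space_PiM)

text \<open>Every function of finitely many coordinates is measurable, since the state space is countable.\<close>

lemma measurable_prefix_fun:
  assumes "\<And>X Y. (\<And>j. j \<le> k \<Longrightarrow> X j = Y j) \<Longrightarrow> f X = f Y" "\<And>X. f X \<in> space N"
    and "sets M = sets path_space"
  shows "f \<in> M \<rightarrow>\<^sub>M N"
proof (rule measurableI)
  fix A assume "A \<in> sets N"
  have "prefix_det k (\<lambda>X. f X \<in> A)"
    unfolding prefix_det_def using assms(1) by metis
  then have "{X. f X \<in> A} \<in> sets path_space" by (rule sets_prefix_event)
  moreover have "space M = UNIV" using sets_eq_imp_space_eq[OF assms(3)] by (simp add: space_PiM)
  moreover have "f -` A = {X. f X \<in> A}" by auto
  ultimately show "f -` A \<inter> space M \<in> sets M" by (simp add: assms(3))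
qed (rule assms)

lemma nn_integral_prefix_event:
  assumes E: "prefix_det n E" and M: "sets M = sets path_space" and f [measurable]: "f \<in> borel_measurable M"
  shows "(\<integral>\<^sup>+X. f X * indicator {X. E X} X \<partial>M) =
    (\<integral>\<^sup>+a. (\<integral>\<^sup>+X. f X * indicator (cyl n (nth a)) X \<partial>M)
       \<partial>count_space {a. length a = Suc n \<and> E (nth a)})"
proof -
  have sets: "cyl n x \<in> sets M" "{X. E X} \<in> sets M" for x
    using M sets_prefix_event[OF E] sets_cyl by simp_all
  have "emeasure (density M f) ({X. E X} \<inter> UNIV) =
    (\<integral>\<^sup>+a. emeasure (density M f) (cyl n (nth a) \<inter> UNIV) \<partial>count_space {a. length a = Suc n \<and> E (nth a)})"
    by (rule emeasure_prefix_event[OF E _ UNIV_in_path_space]) (simp add: M)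
  then show ?thesis unfolding Int_UNIV_right by (simp only: emeasure_density[OF f] sets)
qed

text \<open>With the empty set, the cylinders form a \<open>\<inter>\<close>-stable generator of the path space.\<close>

lemma sets_path_space_cyl:
  "sets path_space = sigma_sets UNIV (insert {} {cyl n x | n x. True})" (is "_ = sigma_sets UNIV ?G")
proof
  have "{X. X i \<in> A} \<in> sigma_sets UNIV ?G" for i :: nat and A :: "(int \<times> int) set"
  proof -
    have "prefix_det i (\<lambda>X. X i \<in> A)" by (rule prefix_detI) auto
    then show ?thesis
      by (subst prefix_event_UN_cyl) (auto intro!: sigma_sets_UNION intro: sigma_sets.Basic)
  qed
  then have "sigma_sets (\<Pi>\<^sub>E i\<in>(UNIV :: nat set). UNIV)
      {{f \<in> \<Pi>\<^sub>E i\<in>UNIV. UNIV. f i \<in> A} | i A. i \<in> UNIV \<and> A \<in> sets (count_space (UNIV :: (int \<times> int) set))}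
    \<subseteq> sigma_sets UNIV ?G"
    by (simp, intro sigma_sets_mono) auto
  then show "sets path_space \<subseteq> sigma_sets UNIV ?G" by (simp add: sets_PiM_single)
  show "sigma_sets UNIV ?G \<subseteq> sets path_space"
    by (rule sets.sigma_sets_subset[where M = path_space, simplified space_PiM, simplified])
      (use sets_cyl in auto)
qed

lemma Int_stable_cyl: "Int_stable (insert {} {cyl n x | n x. True})"
proof (rule Int_stableI)
  fix A B assume "A \<in> insert {} {cyl n x | n x. True}" "B \<in> insert {} {cyl n x | n x. True}"
  then consider "A = {} \<or> B = {}" | n x m y where "A = cyl n x" "B = cyl m y" by blast
  then show "A \<inter> B \<in> insert {} {cyl n x | n x. True}"
  proof cases
    case 2
    then show ?thesis using cyl_cases[of n m x y] cyl_cases[of m n y x]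
      by (cases "n \<le> m") (auto simp: Int_commute)
  qed auto
qed

lemma path_measure_eqI:
  assumes M: "sets M = sets path_space" "finite_measure M" and N: "sets N = sets path_space"
    and eq: "\<And>n x. emeasure M (cyl n x) = emeasure N (cyl n x)"
  shows "M = N"
proof (rule measure_eqI_generator_eq[OF Int_stable_cyl, of UNIV M N "\<lambda>n. cyl 0 (\<lambda>_. from_nat n)"])
  interpret finite_measure M by fact
  show "(\<Union>n. cyl 0 (\<lambda>_. from_nat n)) = UNIV"
  proof (intro set_eqI iffI UNIV_I)
    fix X :: "nat \<Rightarrow> int \<times> int"
    have "X \<in> cyl 0 (\<lambda>_. from_nat (to_nat (X 0)))" by (simp add: cyl_def)
    then show "X \<in> (\<Union>n. cyl 0 (\<lambda>_. from_nat n))" by blast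
  qed
  show "emeasure M (cyl 0 (\<lambda>_. from_nat n)) \<noteq> \<infinity>" for n by simp
qed (use assms in \<open>auto simp: sets_path_space_cyl\<close>)

section \<open>Independence and stationarity of the coloring\<close>

lemma space_coloring_law [simp]: "space (coloring_law p) = UNIV"
  by (simp add: coloring_law_def space_PiM)

lemma measurable_color [measurable]: "(\<lambda>\<omega>. \<omega> y) \<in> coloring_law p \<rightarrow>\<^sub>M count_space UNIV"
proof -
  have "(\<lambda>\<omega>. \<omega> y) \<in> coloring_law p \<rightarrow>\<^sub>M measure_pmf (bernoulli_pmf p)"
    unfolding coloring_law_def by (rule measurable_component_singleton) simp
  then show ?thesis by (simp cong: measurable_cong_sets)
qed

lemma measurable_coloringI:
  assumes "\<And>y. (\<lambda>x. f x y) \<in> M \<rightarrow>\<^sub>M count_space UNIV"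
  shows "f \<in> M \<rightarrow>\<^sub>M coloring_law p"
  unfolding coloring_law_def
proof (rule measurable_PiM_single')
  fix y show "(\<lambda>x. f x y) \<in> M \<rightarrow>\<^sub>M measure_pmf (bernoulli_pmf p)"
    using assms[of y] by (simp cong: measurable_cong_sets)
qed simp

lemma coloring_law_emb:
  assumes "finite I"
  shows "emeasure (coloring_law p) {\<omega>. \<forall>y\<in>I. \<omega> y \<in> F y} =
    (\<Prod>y\<in>I. emeasure (measure_pmf (bernoulli_pmf p)) (F y))"
proof -
  have "{\<omega>. \<forall>y\<in>I. \<omega> y \<in> F y} =
      prod_emb UNIV (\<lambda>_. measure_pmf (bernoulli_pmf p)) I (Pi\<^sub>E I F)"
    by (auto simp: prod_emb_def space_PiM PiE_iff)
  then show ?thesis unfolding coloring_law_def using assms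
    by (simp add: emeasure_PiM_emb measure_pmf.prob_space_axioms)
qed

lemma coloring_law_eqI:
  assumes M: "sets M = sets (coloring_law p)"
    and eq: "\<And>I F. finite I \<Longrightarrow> emeasure M {\<omega>. \<forall>y\<in>I. \<omega> y \<in> F y} =
      emeasure (coloring_law p) {\<omega>. \<forall>y\<in>I. \<omega> y \<in> F y}"
  shows "M = coloring_law p"
proof -
  interpret product_prob_space "\<lambda>_ :: int \<times> int. measure_pmf (bernoulli_pmf p)" UNIV
    by unfold_locales
  show ?thesis
    unfolding coloring_law_def
  proof (rule PiM_eq)
    fix I :: "(int \<times> int) set" and F :: "int \<times> int \<Rightarrow> bool set" assume I: "finite I"
    have "{\<omega>. \<forall>y\<in>I. \<omega> y \<in> F y} =
        prod_emb UNIV (\<lambda>_. measure_pmf (bernoulli_pmf p)) I (Pi\<^sub>E I F)"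
      by (auto simp: prod_emb_def space_PiM PiE_iff)
    then show "emeasure M (prod_emb UNIV (\<lambda>_. measure_pmf (bernoulli_pmf p)) I (Pi\<^sub>E I F)) =
        (\<Prod>y\<in>I. emeasure (measure_pmf (bernoulli_pmf p)) (F y))"
      using eq[OF I, of F] coloring_law_emb[OF I, of p F] by simp
  qed (use M in \<open>simp add: coloring_law_def\<close>)
qed

lemma measurable_merge_colors [measurable]:
  "(\<lambda>(\<omega>, \<omega>') y. if y \<in> J then \<omega> y else \<omega>' y) \<in> coloring_law p \<Otimes>\<^sub>M coloring_law p \<rightarrow>\<^sub>M coloring_law p"
proof (rule measurable_coloringI)
  fix y show "(\<lambda>x. (case x of (\<omega>, \<omega>') \<Rightarrow> \<lambda>y. if y \<in> J then \<omega> y else \<omega>' y) y)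
      \<in> coloring_law p \<Otimes>\<^sub>M coloring_law p \<rightarrow>\<^sub>M count_space UNIV"
    by (cases "y \<in> J") (simp_all add: case_prod_beta, measurable)
qed

text \<open>
  Two independent colorings, one used on \<open>J\<close> and the other off \<open>J\<close>, make up a coloring with the
  same law.
\<close>

lemma coloring_law_merge:
  "distr (coloring_law p \<Otimes>\<^sub>M coloring_law p) (coloring_law p)
     (\<lambda>(\<omega>, \<omega>') y. if y \<in> J then \<omega> y else \<omega>' y) = coloring_law p" (is "distr ?CC ?C ?f = _")
proof (rule coloring_law_eqI)
  interpret prob_space ?C by (rule prob_space_coloring_law)
  fix I :: "(int \<times> int) set" and F :: "int \<times> int \<Rightarrow> bool set" assume I: "finite I"
  let ?E = "\<lambda>I. {\<omega> :: int \<times> int \<Rightarrow> bool. \<forall>y\<in>I. \<omega> y \<in> F y}"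
  have E [measurable]: "?E I \<in> sets ?C" if "finite I" for I
  proof -
    have "Measurable.pred ?C (\<lambda>\<omega>. \<forall>y\<in>I. \<omega> y \<in> F y)"
      using that by measurable
    then show ?thesis by (simp add: pred_def)
  qed
  have "emeasure (distr ?CC ?C ?f) (?E I) = emeasure ?CC (?f -` ?E I \<inter> space ?CC)"
    using E I by (intro emeasure_distr) auto
  also have "?f -` ?E I \<inter> space ?CC = ?E (I \<inter> J) \<times> ?E (I - J)"
  proof (intro set_eqI)
    fix x :: "(int \<times> int \<Rightarrow> bool) \<times> (int \<times> int \<Rightarrow> bool)"
    have "?f x y \<in> F y \<longleftrightarrow> (if y \<in> J then fst x y \<in> F y else snd x y \<in> F y)" for y
      by (cases x) (cases "y \<in> J", simp_all)
    then show "x \<in> ?f -` ?E I \<inter> space ?CC \<longleftrightarrow> x \<in> ?E (I \<inter> J) \<times> ?E (I - J)"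
      by (cases x) (auto simp: space_pair_measure)
  qed
  also have "emeasure ?CC \<dots> = emeasure ?C (?E (I \<inter> J)) * emeasure ?C (?E (I - J))"
    using I by (intro emeasure_pair_measure_Times E) auto
  also have "\<dots> = emeasure ?C (?E I)"
    using I by (simp add: coloring_law_emb prod.Int_Diff[of I _ J])
  finally show "emeasure (distr ?CC ?C ?f) (?E I) = emeasure ?C (?E I)" .
qed simp

lemma coloring_law_translate:
  "distr (coloring_law p) (coloring_law p) (\<lambda>\<omega> y. \<omega> (u + y)) = coloring_law p"
  using distr_PiM_reindex[of UNIV "\<lambda>_. measure_pmf (bernoulli_pmf p)" "\<lambda>y. u + y" UNIV]
  by (simp add: coloring_law_def measure_pmf.prob_space_axioms inj_on_def restrict_def)

lemma measurable_translate_coloring [measurable]: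
  "(\<lambda>\<omega> y. \<omega> (u + y)) \<in> coloring_law p \<rightarrow>\<^sub>M coloring_law p"
  by (rule measurable_coloringI) measurable

lemma nn_integral_coloring_translate:
  assumes [measurable]: "f \<in> borel_measurable (coloring_law p)"
  shows "(\<integral>\<^sup>+\<omega>. f (\<lambda>y. \<omega> (u + y)) \<partial>coloring_law p) = (\<integral>\<^sup>+\<omega>. f \<omega> \<partial>coloring_law p)"
  using nn_integral_distr[OF measurable_translate_coloring, of f p u]
  by (simp add: coloring_law_translate)

text \<open>Functions of disjoint sets of colors are independent.\<close>

lemma nn_integral_coloring_indep:
  assumes [measurable]: "f \<in> borel_measurable (coloring_law p)" "g \<in> borel_measurable (coloring_law p)"
    and f: "\<And>\<omega> \<omega>'. (\<And>y. y \<in> J \<Longrightarrow> \<omega> y = \<omega>' y) \<Longrightarrow> f \<omega> = f \<omega>'"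
    and g: "\<And>\<omega> \<omega>'. (\<And>y. y \<notin> J \<Longrightarrow> \<omega> y = \<omega>' y) \<Longrightarrow> g \<omega> = g \<omega>'"
  shows "(\<integral>\<^sup>+\<omega>. f \<omega> * g \<omega> \<partial>coloring_law p) =
    (\<integral>\<^sup>+\<omega>. f \<omega> \<partial>coloring_law p) * (\<integral>\<^sup>+\<omega>. (g \<omega> :: ennreal) \<partial>coloring_law p)"
proof -
  interpret prob_space "coloring_law p" by (rule prob_space_coloring_law)
  let ?f = "\<lambda>(\<omega>, \<omega>') y. if y \<in> J then \<omega> y else \<omega>' y"
  have "(\<integral>\<^sup>+\<omega>. f \<omega> * g \<omega> \<partial>coloring_law p) =
      (\<integral>\<^sup>+x. f (?f x) * g (?f x) \<partial>(coloring_law p \<Otimes>\<^sub>M coloring_law p))"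
    using nn_integral_distr[OF measurable_merge_colors, of "\<lambda>\<omega>. f \<omega> * g \<omega>" p J]
    unfolding coloring_law_merge by simp
  also have "\<dots> = (\<integral>\<^sup>+x. f (fst x) * g (snd x) \<partial>(coloring_law p \<Otimes>\<^sub>M coloring_law p))"
  proof (intro nn_integral_cong)
    fix x :: "(int \<times> int \<Rightarrow> bool) \<times> (int \<times> int \<Rightarrow> bool)"
    have "f (?f x) = f (fst x)" by (rule f) (simp add: case_prod_beta)
    moreover have "g (?f x) = g (snd x)" by (rule g) (simp add: case_prod_beta)
    ultimately show "f (?f x) * g (?f x) = f (fst x) * g (snd x)" by simp
  qed
  also have "\<dots> = (\<integral>\<^sup>+\<omega>. \<integral>\<^sup>+\<omega>'. f \<omega> * g \<omega>' \<partial>coloring_law p \<partial>coloring_law p)"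
    by (subst nn_integral_fst[symmetric]) auto
  also have "\<dots> = (\<integral>\<^sup>+\<omega>. f \<omega> \<partial>coloring_law p) * (\<integral>\<^sup>+\<omega>. g \<omega> \<partial>coloring_law p)"
    by (simp add: nn_integral_cmult nn_integral_multc)
  finally show ?thesis .
qed

lemma emeasure_color:
  assumes "0 \<le> p" "p \<le> 1"
  shows "(\<integral>\<^sup>+\<omega>. indicator {c} (\<omega> y) \<partial>coloring_law p) = ennreal (if c then p else 1 - p)"
proof -
  interpret product_prob_space "\<lambda>_ :: int \<times> int. measure_pmf (bernoulli_pmf p)" UNIV
    by unfold_locales
  have [measurable]: "(\<lambda>\<omega>. \<omega> y) \<in> coloring_law p \<rightarrow>\<^sub>M measure_pmf (bernoulli_pmf p)"
    unfolding coloring_law_def by (rule measurable_component_singleton) simp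
  have "distr (coloring_law p) (measure_pmf (bernoulli_pmf p)) (\<lambda>\<omega>. \<omega> y) = measure_pmf (bernoulli_pmf p)"
    unfolding coloring_law_def by (rule PiM_component) simp
  then have "(\<integral>\<^sup>+\<omega>. indicator {c} (\<omega> y) \<partial>coloring_law p) =
      (\<integral>\<^sup>+c'. indicator {c} c' \<partial>measure_pmf (bernoulli_pmf p))"
    using nn_integral_distr[of "\<lambda>\<omega>. \<omega> y" "coloring_law p" "measure_pmf (bernoulli_pmf p)" "indicator {c}"]
    by simp
  also have "\<dots> = emeasure (measure_pmf (bernoulli_pmf p)) {c}" by simp
  also have "\<dots> = ennreal (if c then p else 1 - p)"
    unfolding emeasure_pmf_single using assms by (cases c) simp_all
  finally show ?thesis .
qed

lemma measurable_fun_upd_color: "(\<lambda>\<omega>. fun_upd \<omega> y c) \<in> coloring_law p \<rightarrow>\<^sub>M coloring_law p"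
proof (rule measurable_coloringI)
  fix z show "(\<lambda>\<omega>. fun_upd \<omega> y c z) \<in> coloring_law p \<rightarrow>\<^sub>M count_space UNIV"
    by (cases "z = y") auto
qed

text \<open>Conditioning on the color of a single site amounts to overwriting it.\<close>

lemma nn_integral_color_overwrite:
  assumes p: "0 \<le> p" "p \<le> 1" and [measurable]: "g \<in> borel_measurable (coloring_law p)"
  shows "(\<integral>\<^sup>+\<omega>. indicator {c} (\<omega> y) * g \<omega> \<partial>coloring_law p) =
    ennreal (if c then p else 1 - p) * (\<integral>\<^sup>+\<omega>. g (fun_upd \<omega> y c) \<partial>coloring_law p)"
proof -
  have "(\<integral>\<^sup>+\<omega>. indicator {c} (\<omega> y) * g \<omega> \<partial>coloring_law p) =
      (\<integral>\<^sup>+\<omega>. indicator {c} (\<omega> y) * g (fun_upd \<omega> y c) \<partial>coloring_law p)"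
  proof (rule nn_integral_cong)
    fix \<omega> :: "int \<times> int \<Rightarrow> bool"
    show "indicator {c} (\<omega> y) * g \<omega> = indicator {c} (\<omega> y) * g (fun_upd \<omega> y c)"
    proof (cases "\<omega> y = c")
      case True
      then have "fun_upd \<omega> y c = \<omega>" by (simp add: fun_upd_idem)
      then show ?thesis by (simp only:)
    next
      case False
      then have "indicator {c} (\<omega> y) = (0 :: ennreal)" by (simp only: indicator_def singleton_iff) simp
      then show ?thesis by (simp only: mult_zero_left)
    qed
  qed
  also have "\<dots> = (\<integral>\<^sup>+\<omega>. indicator {c} (\<omega> y) \<partial>coloring_law p) * (\<integral>\<^sup>+\<omega>. g (fun_upd \<omega> y c) \<partial>coloring_law p)"
  proof (rule nn_integral_coloring_indep[where J = "{y}"])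
    show "g (fun_upd \<omega> y c) = g (fun_upd \<omega>' y c)" if "\<And>z. z \<notin> {y} \<Longrightarrow> \<omega> z = \<omega>' z" for \<omega> \<omega>'
      by (rule arg_cong[where f = g], rule ext) (use that in simp)
    show "indicator {c} (\<omega> y) = (indicator {c} (\<omega>' y) :: ennreal)"
      if "\<And>z. z \<in> {y} \<Longrightarrow> \<omega> z = \<omega>' z" for \<omega> \<omega>'
      using that[of y] by (simp only: singletonI)
    show "(\<lambda>\<omega>. indicator {c} (\<omega> y) :: ennreal) \<in> borel_measurable (coloring_law p)"
      by (rule measurable_compose[OF measurable_color]) simp
    show "(\<lambda>\<omega>. g (fun_upd \<omega> y c)) \<in> borel_measurable (coloring_law p)"
      by (rule measurable_compose[OF measurable_fun_upd_color]) fact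
  qed
  finally show ?thesis using p by (simp add: emeasure_color)
qed

section \<open>The walk in a fixed coloring\<close>

lemma unit_vec_inj: "inj_on unit_vec {1..4}"
  by (auto simp: inj_on_def unit_vec_def split: if_splits)

lemma atLeastAtMost_1_4: "{1..4} = {1, 2, 3, 4::nat}" by auto

text \<open>
  The parameters of the model: the density \<open>p\<close> of blue sites and the jump probabilities \<open>b\<close> at blue
  and \<open>r\<close> at red sites.
\<close>

locale two_vertex =
  fixes p :: real and b r :: "nat \<Rightarrow> real"
  assumes p: "0 < p" "p < 1"
    and b: "\<And>i. i \<in> {1..4} \<Longrightarrow> 0 < b i" "(\<Sum>i = 1..4. b i) = 1"
    and r: "\<And>i. i \<in> {1..4} \<Longrightarrow> 0 < r i" "(\<Sum>i = 1..4. r i) = 1"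
begin

text \<open>
  Jump probabilities at a site of color \<open>c\<close>, where \<open>True\<close> is blue.
\<close>

definition q :: "bool \<Rightarrow> nat \<Rightarrow> real" where
  "q c i = (if c then b i else r i)"

text \<open>
  The same probabilities as a function of the displacement \<open>d\<close>.
\<close>

definition step_prob :: "bool \<Rightarrow> int \<times> int \<Rightarrow> real" where
  "step_prob c d = pmf (step_pmf (q c)) d"

lemma q_pos: "i \<in> {1..4} \<Longrightarrow> 0 < q c i"
  using b r by (simp add: q_def)

lemma q_sum: "(\<Sum>i = 1..4. q c i) = 1"
  using b(2) r(2) by (cases c) (simp_all add: q_def)

lemma q_eq: "(if c then b else r) = q c"
  by (auto simp: q_def)

lemma set_step_pmf: "set_pmf (step_pmf (q c)) \<subseteq> unit_vec ` {1..4}"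
proof -
  have "pmf_of_list_wf (map (\<lambda>i. (unit_vec i, q c i)) [1, 2, 3, 4])"
    using q_sum[of c, unfolded atLeastAtMost_1_4] q_pos[of _ c]
    by (intro pmf_of_list_wfI) (auto simp: atLeastAtMost_1_4 add.assoc intro!: less_imp_le)
  from set_pmf_of_list[OF this] show ?thesis by (auto simp: step_pmf_def atLeastAtMost_1_4)
qed

lemma nn_integral_transition:
  assumes f: "\<And>y. 0 \<le> f y"
  shows "(\<integral>\<^sup>+y. ennreal (f y) \<partial>transition b r \<omega> z) =
    ennreal (\<Sum>i = 1..4. q (\<omega> z) i * f (z + unit_vec i))"
proof -
  have "(\<integral>\<^sup>+y. ennreal (f y) \<partial>transition b r \<omega> z) =
      (\<integral>\<^sup>+d. ennreal (f (z + d)) \<partial>step_pmf (q (\<omega> z)))"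
    by (simp add: transition_def q_eq)
  also have "\<dots> = (\<Sum>d\<in>unit_vec ` {1..4}. ennreal (f (z + d)) * pmf (step_pmf (q (\<omega> z))) d)"
    using set_step_pmf[of "\<omega> z"] by (intro nn_integral_measure_pmf_support) auto
  also have "\<dots> = (\<Sum>i = 1..4. ennreal (f (z + unit_vec i)) * pmf (step_pmf (q (\<omega> z))) (unit_vec i))"
    by (rule sum.reindex_cong[OF unit_vec_inj]) auto
  also have "\<dots> = (\<Sum>i = 1..4. ennreal (q (\<omega> z) i * f (z + unit_vec i)))"
    by (intro sum.cong refl, subst pmf_step_pmf)
      (use q_pos q_sum f in \<open>auto simp: ennreal_mult less_imp_le mult.commute\<close>)
  also have "\<dots> = ennreal (\<Sum>i = 1..4. q (\<omega> z) i * f (z + unit_vec i))"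
    using q_pos f by (intro sum_ennreal mult_nonneg_nonneg) (auto intro: less_imp_le)
  finally show ?thesis .
qed

lemma pmf_transition: "pmf (transition b r \<omega> x) y = step_prob (\<omega> x) (y - x)"
proof -
  have "pmf (transition b r \<omega> x) (x + (y - x)) = step_prob (\<omega> x) (y - x)"
    unfolding transition_def step_prob_def q_eq by (rule pmf_map_inj') (auto simp: inj_on_def)
  then show ?thesis by simp
qed

abbreviation "C \<equiv> coloring_law p"
abbreviation "QL \<equiv> quenched_law b r"

lemma emeasure_QL_cyl:
  "emeasure (QL \<omega>) (cyl n x) =
    (if x 0 = 0 then ennreal (\<Prod>k<n. step_prob (\<omega> (x k)) (x (Suc k) - x k)) else 0)"
  unfolding cyl_def emeasure_quenched_law pmf_transition ..

lemma step_prob_nonneg: "0 \<le> step_prob c d"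
  by (simp add: step_prob_def)

lemma cyl_Int_shift_cyl:
  "cyl n a \<inter> shift n -` cyl m y =
    (if y 0 = 0 then cyl (n + m) (\<lambda>k. if k \<le> n then a k else a n + y (k - n)) else {})"
proof (cases "y 0 = 0")
  case True
  have "X \<in> cyl n a \<inter> shift n -` cyl m y \<longleftrightarrow> X \<in> cyl (n + m) (\<lambda>k. if k \<le> n then a k else a n + y (k - n))" for X
  proof
    assume X: "X \<in> cyl n a \<inter> shift n -` cyl m y"
    have "X k = a n + y (k - n)" if "n < k" "k \<le> n + m" for k
    proof -
      have "shift n X (k - n) = y (k - n)" using X that by (simp add: cyl_def)
      then show ?thesis using X that by (auto simp: cyl_def shift_def algebra_simps)
    qed
    then show "X \<in> cyl (n + m) (\<lambda>k. if k \<le> n then a k else a n + y (k - n))"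
      using X by (auto simp: cyl_def)
  next
    assume X: "X \<in> cyl (n + m) (\<lambda>k. if k \<le> n then a k else a n + y (k - n))"
    have "X (n + k) - X n = y k" if "k \<le> m" for k
      using X that True by (cases "k = 0") (auto simp: cyl_def)
    then show "X \<in> cyl n a \<inter> shift n -` cyl m y" using X by (auto simp: cyl_def shift_def)
  qed
  then show ?thesis using True by auto
qed (auto simp: cyl_def shift_def)

text \<open>The Markov property at time \<open>n\<close>, with the walk restarted at the origin of a translated coloring.\<close>

lemma quenched_markov_measure:
  "distr (density (QL \<omega>) (indicator (cyl n a))) path_space (shift n) =
    density (QL (\<lambda>y. \<omega> (a n + y))) (\<lambda>_. emeasure (QL \<omega>) (cyl n a))" (is "?M = ?N")
proof (rule path_measure_eqI)
  interpret QL: prob_space "QL w" for w by (rule prob_space_quenched_law)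
  have cyl: "cyl n x \<in> sets (QL \<omega>)" for n x \<omega> by (simp add: sets_quenched_law sets_cyl)
  have sh: "shift n \<in> density (QL \<omega>) (indicator (cyl n a)) \<rightarrow>\<^sub>M path_space"
    by (simp cong: measurable_cong_sets add: sets_quenched_law measurable_shift)
  have M: "emeasure ?M B = emeasure (QL \<omega>) (cyl n a \<inter> shift n -` B)" if "B \<in> sets path_space" for B
  proof -
    have shB: "shift n -` B \<in> sets (QL \<omega>)"
      using measurable_sets[OF measurable_shift that, of n] by (simp add: sets_quenched_law space_PiM)
    have "emeasure ?M B = emeasure (density (QL \<omega>) (indicator (cyl n a))) (shift n -` B)"
      unfolding emeasure_distr[OF sh that] by simp
    also have "\<dots> = (\<integral>\<^sup>+X. indicator (cyl n a) X * indicator (shift n -` B) X \<partial>QL \<omega>)"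
      by (rule emeasure_density) (use cyl shB in auto)
    also have "\<dots> = (\<integral>\<^sup>+X. indicator (cyl n a \<inter> shift n -` B) X \<partial>QL \<omega>)"
      by (simp only: indicator_inter_arith)
    also have "\<dots> = emeasure (QL \<omega>) (cyl n a \<inter> shift n -` B)"
      by (rule nn_integral_indicator) (use cyl shB in auto)
    finally show ?thesis .
  qed
  show "finite_measure ?M"
    by (rule finite_measureI) (use M[OF UNIV_in_path_space] QL.emeasure_finite in \<open>simp add: space_PiM\<close>)
  fix m x
  have N: "emeasure ?N (cyl m x) = emeasure (QL \<omega>) (cyl n a) * emeasure (QL (\<lambda>y. \<omega> (a n + y))) (cyl m x)"
    by (simp add: emeasure_density cyl nn_integral_cmult_indicator)
  show "emeasure ?M (cyl m x) = emeasure ?N (cyl m x)"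
  proof (cases "x 0 = 0 \<and> a 0 = 0")
    case True
    let ?z = "\<lambda>k. if k \<le> n then a k else a n + x (k - n)"
    have "(\<Prod>k<n + m. step_prob (\<omega> (?z k)) (?z (Suc k) - ?z k)) =
      (\<Prod>k<n. step_prob (\<omega> (?z k)) (?z (Suc k) - ?z k)) *
      (\<Prod>k<m. step_prob (\<omega> (?z (n + k))) (?z (Suc (n + k)) - ?z (n + k)))"
      unfolding lessThan_atLeast0
      by (subst prod.atLeastLessThan_concat[of 0 n "n + m", symmetric], simp, simp,
          simp add: prod.atLeastLessThan_shift_0[of _ n] add.commute)
    also have "(\<Prod>k<n. step_prob (\<omega> (?z k)) (?z (Suc k) - ?z k)) =
        (\<Prod>k<n. step_prob (\<omega> (a k)) (a (Suc k) - a k))"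
      by (intro prod.cong) auto
    also have "(\<Prod>k<m. step_prob (\<omega> (?z (n + k))) (?z (Suc (n + k)) - ?z (n + k))) =
        (\<Prod>k<m. step_prob (\<omega> (a n + x k)) (x (Suc k) - x k))"
      using True by (intro prod.cong) (auto simp: Suc_diff_le)
    finally show ?thesis
      using True unfolding N M[OF sets_cyl] cyl_Int_shift_cyl
      by (simp add: emeasure_QL_cyl ennreal_mult' prod_nonneg step_prob_nonneg)
  next
    case False
    then show ?thesis
      unfolding N M[OF sets_cyl] cyl_Int_shift_cyl by (auto simp: emeasure_QL_cyl)
  qed
qed (auto simp: sets_quenched_law)

lemma quenched_markov:
  assumes f [measurable]: "f \<in> borel_measurable path_space"
  shows "(\<integral>\<^sup>+X. f (shift n X) * indicator (cyl n a) X \<partial>QL \<omega>) =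
    emeasure (QL \<omega>) (cyl n a) * (\<integral>\<^sup>+X. f X \<partial>QL (\<lambda>y. \<omega> (a n + y)))"
proof -
  have [measurable_cong]: "sets (QL \<omega>) = sets path_space" for \<omega> by (rule sets_quenched_law)
  have "(\<integral>\<^sup>+X. f (shift n X) * indicator (cyl n a) X \<partial>QL \<omega>) =
      (\<integral>\<^sup>+X. f (shift n X) \<partial>density (QL \<omega>) (indicator (cyl n a)))"
    by (subst nn_integral_density) (auto simp: mult.commute sets_cyl)
  also have "\<dots> = (\<integral>\<^sup>+X. f X \<partial>distr (density (QL \<omega>) (indicator (cyl n a))) path_space (shift n))"
    by (subst nn_integral_distr) auto
  also have "\<dots> = emeasure (QL \<omega>) (cyl n a) * (\<integral>\<^sup>+X. f X \<partial>QL (\<lambda>y. \<omega> (a n + y)))"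
    unfolding quenched_markov_measure by (subst nn_integral_density) (auto simp: nn_integral_cmult)
  finally show ?thesis .
qed

lemma distr_first_step: "distr (QL \<omega>) (count_space UNIV) (\<lambda>X. X 1) = measure_pmf (transition b r \<omega> 0)"
proof (rule measure_eqI_countable[of _ UNIV])
  have [measurable_cong]: "sets (QL \<omega>) = sets path_space" for \<omega> by (rule sets_quenched_law)
  interpret QL: prob_space "QL \<omega>" by (rule prob_space_quenched_law)
  have c0: "emeasure (QL \<omega>) (cyl 0 (\<lambda>_. 0)) = 1" by (simp add: emeasure_QL_cyl)
  fix y :: "int \<times> int"
  have "emeasure (distr (QL \<omega>) (count_space UNIV) (\<lambda>X. X 1)) {y} = emeasure (QL \<omega>) {X. X 1 = y}"
    by (subst emeasure_distr) (auto intro!: arg_cong[where f = "emeasure (QL \<omega>)"])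
  also have "\<dots> = emeasure (QL \<omega>) (cyl 1 (\<lambda>k. if k = 0 then 0 else y))"
  proof (rule emeasure_eq_AE)
    have "AE X in QL \<omega>. X \<in> cyl 0 (\<lambda>_. 0)"
      using c0 by (intro QL.AE_prob_1) (simp add: QL.emeasure_eq_measure)
    then show "AE X in QL \<omega>. X \<in> {X. X 1 = y} \<longleftrightarrow> X \<in> cyl 1 (\<lambda>k. if k = 0 then 0 else y)"
      by eventually_elim (auto simp: cyl_def le_Suc_eq)
  qed (use sets_prefix_event[of 1 "\<lambda>X. X 1 = y"] in \<open>auto simp: sets_cyl sets_quenched_law prefix_det_def\<close>)
  also have "\<dots> = emeasure (transition b r \<omega> 0) {y}"
    by (simp add: emeasure_QL_cyl emeasure_pmf_single pmf_transition)
  finally show "emeasure (distr (QL \<omega>) (count_space UNIV) (\<lambda>X. X 1)) {y} = emeasure (transition b r \<omega> 0) {y}" .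
qed auto

lemma transition_translate:
  "transition b r \<omega> (u + x) = map_pmf (\<lambda>y. u + y) (transition b r (\<lambda>y. \<omega> (u + y)) x)"
  by (simp add: transition_def map_pmf_comp add.assoc)

lemma nn_integral_step:
  "(\<integral>\<^sup>+X. f (a n) (a n + X 1) \<partial>QL (\<lambda>y. \<omega> (a n + y))) =
    (\<integral>\<^sup>+y. f (a n) y \<partial>transition b r \<omega> (a n))"
proof -
  have m: "(\<lambda>X. X 1) \<in> QL \<omega> \<rightarrow>\<^sub>M count_space UNIV" for \<omega>
    by (simp cong: measurable_cong_sets add: sets_quenched_law)
  have "(\<integral>\<^sup>+X. f (a n) (a n + X 1) \<partial>QL (\<lambda>y. \<omega> (a n + y))) =
    (\<integral>\<^sup>+y. f (a n) (a n + y) \<partial>distr (QL (\<lambda>y. \<omega> (a n + y))) (count_space UNIV) (\<lambda>X. X 1))"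
    by (rule nn_integral_distr[OF m, symmetric]) simp
  also have "\<dots> = (\<integral>\<^sup>+y. f (a n) y \<partial>transition b r \<omega> (a n))"
    unfolding distr_first_step using transition_translate[of \<omega> "a n" 0] by simp
  finally show ?thesis .
qed

text \<open>
  One step of the chain, on an event decided by the path up to time \<open>n\<close>.
\<close>

lemma quenched_step:
  assumes E: "prefix_det n E"
  shows "(\<integral>\<^sup>+X. f (X n) (X (Suc n)) * indicator {X. E X} X \<partial>QL \<omega>) =
    (\<integral>\<^sup>+X. (\<integral>\<^sup>+y. f (X n) y \<partial>transition b r \<omega> (X n)) * indicator {X. E X} X \<partial>QL \<omega>)"
proof -
  have m: "(\<lambda>X. h (X i) (X j) :: ennreal) \<in> borel_measurable path_space" for h i j
    using measurable_path_component2[of h i j] by (rule measurable_compose) simp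
  have m': "(\<lambda>X. h (X i) (X j) :: ennreal) \<in> borel_measurable (QL \<omega>)" for h i j
    using m[of h i j] by (simp cong: measurable_cong_sets add: sets_quenched_law)
  have "(\<integral>\<^sup>+X. f (X n) (X (Suc n)) * indicator (cyl n a) X \<partial>QL \<omega>) =
      (\<integral>\<^sup>+X. (\<integral>\<^sup>+y. f (X n) y \<partial>transition b r \<omega> (X n)) * indicator (cyl n a) X \<partial>QL \<omega>)" for a
  proof -
    have "(\<integral>\<^sup>+X. f (X n) (X (Suc n)) * indicator (cyl n a) X \<partial>QL \<omega>) =
        (\<integral>\<^sup>+X. f (a n) (a n + shift n X 1) * indicator (cyl n a) X \<partial>QL \<omega>)"
      by (intro nn_integral_cong) (auto simp: cyl_def shift_def indicator_def)
    also have "\<dots> = emeasure (QL \<omega>) (cyl n a) * (\<integral>\<^sup>+y. f (a n) y \<partial>transition b r \<omega> (a n))"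
      using quenched_markov[where f = "\<lambda>X. f (a n) (a n + X 1)" and n = n and a = a and \<omega> = \<omega>] m[of "\<lambda>x y. f (a n) (a n + x)" 1 1]
      unfolding nn_integral_step by simp
    also have "\<dots> = (\<integral>\<^sup>+X. (\<integral>\<^sup>+y. f (a n) y \<partial>transition b r \<omega> (a n)) * indicator (cyl n a) X \<partial>QL \<omega>)"
      by (subst nn_integral_cmult_indicator) (auto simp: sets_quenched_law sets_cyl mult.commute)
    also have "\<dots> = (\<integral>\<^sup>+X. (\<integral>\<^sup>+y. f (X n) y \<partial>transition b r \<omega> (X n)) * indicator (cyl n a) X \<partial>QL \<omega>)"
      by (intro nn_integral_cong) (auto simp: cyl_def indicator_def)
    finally show ?thesis .
  qed
  then show ?thesis
    using m'[of f n "Suc n"] m'[of "\<lambda>x _. \<integral>\<^sup>+y. f x y \<partial>transition b r \<omega> x" n n]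
    by (simp add: nn_integral_prefix_event[OF E] sets_quenched_law)
qed

lemma AE_quenched_path:
  "AE X in QL \<omega>. X 0 = 0 \<and> (\<forall>n. \<exists>i\<in>{1..4}. X (Suc n) = X n + unit_vec i)"
proof -
  interpret QL: prob_space "QL \<omega>" by (rule prob_space_quenched_law)
  have "emeasure (QL \<omega>) (cyl 0 (\<lambda>_. 0)) = 1" by (simp add: emeasure_QL_cyl)
  then have "AE X in QL \<omega>. X \<in> cyl 0 (\<lambda>_. 0)"
    by (intro QL.AE_prob_1) (simp add: QL.emeasure_eq_measure)
  moreover have "AE X in QL \<omega>. \<exists>i\<in>{1..4}. X (Suc n) = X n + unit_vec i" for n
  proof -
    let ?f = "\<lambda>x y. indicator {z. \<not> (\<exists>i\<in>{1..4}. z = x + unit_vec i)} y :: real"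
    have m: "(\<lambda>X. ennreal (?f (X n) (X (Suc n)))) \<in> borel_measurable (QL \<omega>)"
      using measurable_path_component2[of "\<lambda>x y. ennreal (?f x y)" n "Suc n"]
      by (simp cong: measurable_cong_sets add: sets_quenched_law measurable_compose)
    have "(\<integral>\<^sup>+X. ennreal (?f (X n) (X (Suc n))) \<partial>QL \<omega>) =
        (\<integral>\<^sup>+X. (\<integral>\<^sup>+y. ennreal (?f (X n) y) \<partial>transition b r \<omega> (X n)) \<partial>QL \<omega>)"
      using quenched_step[where n = n and E = "\<lambda>_. True" and f = "\<lambda>x y. ennreal (?f x y)" and \<omega> = \<omega>]
      by (simp add: prefix_det_def)
    also have "\<dots> = 0"
    proof -
      have "(\<Sum>i = 1..4. q (\<omega> z) i * ?f z (z + unit_vec i)) = 0" for z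
        by (rule sum.neutral) (auto simp: indicator_def)
      then show ?thesis by (subst nn_integral_transition) (simp_all del: sum.neutral_const)
    qed
    finally have "AE X in QL \<omega>. ennreal (?f (X n) (X (Suc n))) = 0"
      by (subst (asm) nn_integral_0_iff_AE[OF m])
    then show ?thesis by eventually_elim (auto simp: indicator_def split: if_splits)
  qed
  then have "AE X in QL \<omega>. \<forall>n. \<exists>i\<in>{1..4}. X (Suc n) = X n + unit_vec i"
    by (simp only: AE_all_countable) blast
  ultimately show ?thesis by eventually_elim (auto simp: cyl_def)
qed

text \<open>
  The transition operator of the walk killed on leaving \<open>U\<close>.
\<close>

definition kill_op :: "(int \<times> int) set \<Rightarrow> (int \<times> int \<Rightarrow> bool) \<Rightarrow> (int \<times> int \<Rightarrow> real) \<Rightarrow> int \<times> int \<Rightarrow> real" where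
  "kill_op U \<omega> f z = (if z \<in> U then \<Sum>i = 1..4. q (\<omega> z) i * f (z + unit_vec i) else 0)"

lemma kill_op_nonneg: "(\<And>z. 0 \<le> f z) \<Longrightarrow> 0 \<le> kill_op U \<omega> f z"
proof -
  assume "\<And>z. 0 \<le> f z"
  then have "0 \<le> (\<Sum>i = 1..4. q (\<omega> z) i * f (z + unit_vec i))"
    by (intro sum_nonneg mult_nonneg_nonneg less_imp_le[OF q_pos])
  then show ?thesis by (simp add: kill_op_def)
qed

lemma kill_op_le:
  assumes "\<And>z. f z \<le> c" "0 \<le> c"
  shows "kill_op U \<omega> f z \<le> c"
proof -
  have "(\<Sum>i = 1..4. q (\<omega> z) i * f (z + unit_vec i)) \<le> (\<Sum>i = 1..4. q (\<omega> z) i * c)"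
    using assms by (intro sum_mono mult_left_mono less_imp_le[OF q_pos]) auto
  also have "\<dots> = c" using q_sum[of "\<omega> z"] unfolding sum_distrib_right[symmetric] by simp
  finally show ?thesis using assms by (simp add: kill_op_def)
qed

lemma kill_op_power_nonneg:
  assumes "\<And>z. 0 \<le> f z"
  shows "0 \<le> (kill_op U \<omega> ^^ n) f z"
proof (induction n arbitrary: z)
  case (Suc n)
  then show ?case by (simp add: kill_op_nonneg)
qed (simp add: assms)

lemma kill_op_power_le:
  assumes "\<And>z. f z \<le> c" "0 \<le> c"
  shows "(kill_op U \<omega> ^^ n) f z \<le> c"
proof (induction n arbitrary: z)
  case (Suc n)
  then show ?case using assms(2) by (simp add: kill_op_le)
qed (simp add: assms)

text \<open>
  The powers of \<open>kill_op\<close> describe the walk that has not left \<open>U\<close> before time \<open>n\<close>; its position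
  at time \<open>n\<close> itself may be outside \<open>U\<close>.
\<close>

lemma nn_integral_killed:
  assumes "\<And>z. 0 \<le> f z"
  shows "(\<integral>\<^sup>+X. ennreal (f (X n)) * indicator {X. \<forall>j<n. X j \<in> U} X \<partial>QL \<omega>) =
    ennreal ((kill_op U \<omega> ^^ n) f 0)"
  using assms
proof (induction n arbitrary: f)
  case 0
  interpret QL: prob_space "QL \<omega>" by (rule prob_space_quenched_law)
  have "(\<integral>\<^sup>+X. ennreal (f (X 0)) \<partial>QL \<omega>) = (\<integral>\<^sup>+X. ennreal (f 0) \<partial>QL \<omega>)"
    by (intro nn_integral_cong_AE eventually_mono[OF AE_quenched_path]) auto
  then show ?case using QL.emeasure_space_1 by simp
next
  case (Suc n)
  have "prefix_det n (\<lambda>X. \<forall>j<Suc n. X j \<in> U)" by (rule prefix_detI) auto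
  from quenched_step[OF this, where f = "\<lambda>x y. ennreal (f y)" and \<omega> = \<omega>]
  have "(\<integral>\<^sup>+X. ennreal (f (X (Suc n))) * indicator {X. \<forall>j<Suc n. X j \<in> U} X \<partial>QL \<omega>) =
    (\<integral>\<^sup>+X. ennreal (kill_op U \<omega> f (X n)) * indicator {X. \<forall>j<n. X j \<in> U} X \<partial>QL \<omega>)"
    using Suc.prems by (auto simp: nn_integral_transition kill_op_def indicator_def less_Suc_eq intro!: nn_integral_cong)
  also have "\<dots> = ennreal ((kill_op U \<omega> ^^ n) (kill_op U \<omega> f) 0)"
    using Suc.prems by (intro Suc.IH kill_op_nonneg)
  finally show ?case by (simp add: funpow_swap1)
qed

lemma kill_op_Suc:
  "(kill_op U \<omega> ^^ Suc n) f z =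
    (if z \<in> U then \<Sum>i = 1..4. q (\<omega> z) i * (kill_op U \<omega> ^^ n) f (z + unit_vec i) else 0)"
  by (simp add: kill_op_def[of U \<omega> "(kill_op U \<omega> ^^ n) f"])

lemma measurable_kill_op_power [measurable]:
  "(\<lambda>\<omega>. (kill_op U \<omega> ^^ n) f z) \<in> borel_measurable C"
proof (induction n arbitrary: z)
  case (Suc n)
  have "(\<lambda>\<omega>. q (\<omega> z) i) \<in> borel_measurable C" for i
    by (rule measurable_compose[OF measurable_color]) simp
  then have "(\<lambda>\<omega>. \<Sum>i = 1..4. q (\<omega> z) i * (kill_op U \<omega> ^^ n) f (z + unit_vec i)) \<in> borel_measurable C"
    using Suc by (intro borel_measurable_sum borel_measurable_times)
  then show ?case
    unfolding kill_op_Suc by (cases "z \<in> U") (simp_all only: if_True if_False borel_measurable_const)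
qed (simp only: funpow.simps id_apply borel_measurable_const)

end

section \<open>The annealed law of the path\<close>

context two_vertex
begin

text \<open>
  The law of the path alone, averaged over the colorings.
\<close>

definition path_law :: "(nat \<Rightarrow> int \<times> int) measure" where
  "path_law = C \<bind> QL"

lemma QL_kernel: "QL \<in> C \<rightarrow>\<^sub>M subprob_algebra path_space"
  by (rule measurable_prob_algebraD[OF measurable_quenched_law])

lemma C_not_empty: "space C \<noteq> {}"
  by simp

lemma sets_path_law [measurable_cong]: "sets path_law = sets path_space"
  unfolding path_law_def by (rule sets_bind[OF _ C_not_empty]) (rule sets_quenched_law)

lemma space_path_law [simp]: "space path_law = UNIV"
  using sets_eq_imp_space_eq[OF sets_path_law] by (simp add: space_PiM)

lemma emeasure_path_law:
  "A \<in> sets path_space \<Longrightarrow> emeasure path_law A = (\<integral>\<^sup>+\<omega>. emeasure (QL \<omega>) A \<partial>C)"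
  unfolding path_law_def by (rule emeasure_bind[OF C_not_empty QL_kernel])

lemma nn_integral_path_law:
  "f \<in> borel_measurable path_space \<Longrightarrow> (\<integral>\<^sup>+X. f X \<partial>path_law) = (\<integral>\<^sup>+\<omega>. \<integral>\<^sup>+X. f X \<partial>QL \<omega> \<partial>C)"
  unfolding path_law_def by (rule nn_integral_bind[OF _ QL_kernel])

lemma measurable_QL_emeasure:
  "A \<in> sets path_space \<Longrightarrow> (\<lambda>\<omega>. emeasure (QL \<omega>) A) \<in> borel_measurable C"
  by (rule measurable_compose[OF QL_kernel measurable_emeasure_subprob_algebra])

lemma prob_space_path_law: "prob_space path_law"
proof
  interpret prob_space C by (rule prob_space_coloring_law)
  have "emeasure (QL \<omega>) UNIV = 1" for \<omega>
    using prob_space.emeasure_space_1[OF prob_space_quenched_law[of b r \<omega>]] by simp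
  then show "emeasure path_law (space path_law) = 1"
    using emeasure_space_1 by (simp add: emeasure_path_law[OF UNIV_in_path_space])
qed

lemma AE_annealed_law:
  assumes "AE X in path_law. P X"
  shows "AE (\<omega>, X) in annealed_law p b r. P X"
proof -
  obtain N where N: "{X. \<not> P X} \<subseteq> N" "emeasure path_law N = 0" "N \<in> sets path_space"
    using AE_E[OF assms] by (auto simp: sets_path_law)
  have "UNIV \<in> sets C" using sets.top[of C] by simp
  then have "emeasure (annealed_law p b r) (UNIV \<times> N) = (\<integral>\<^sup>+\<omega>. emeasure (QL \<omega>) N * indicator UNIV \<omega> \<partial>C)"
    by (rule emeasure_annealed_law[OF _ N(3)])
  also have "\<dots> = 0" using N by (simp add: emeasure_path_law)
  finally have "emeasure (annealed_law p b r) (UNIV \<times> N) = 0" .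
  moreover have "UNIV \<times> N \<in> sets (annealed_law p b r)"
  proof -
    have "sets (annealed_law p b r) = sets (C \<Otimes>\<^sub>M path_space)"
      unfolding annealed_law_def by (rule sets_bind[OF _ C_not_empty]) simp
    then show ?thesis using N(3) \<open>UNIV \<in> sets C\<close> by auto
  qed
  ultimately have "AE x in annealed_law p b r. x \<notin> UNIV \<times> N"
    by (intro AE_not_in null_setsI)
  then show ?thesis by eventually_elim (use N(1) in auto)
qed

lemma AE_path_lawI:
  assumes "\<And>\<omega>. AE X in QL \<omega>. P X" "{X. P X} \<in> sets path_space"
  shows "AE X in path_law. P X"
proof -
  have "Measurable.pred path_space P" using assms(2) by (simp add: pred_def space_PiM)
  then show ?thesis
    unfolding path_law_def AE_bind[OF QL_kernel \<open>Measurable.pred path_space P\<close>]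
    by (intro AE_I2 assms(1))
qed

lemma AE_nearest_neighbour:
  "AE X in path_law. X 0 = 0 \<and> (\<forall>n. \<exists>i\<in>{1..4}. X (Suc n) = X n + unit_vec i)"
proof (rule AE_path_lawI[OF AE_quenched_path])
  have "{X. \<exists>i\<in>{1..4}. X (Suc n) = X n + unit_vec i} \<in> sets path_space" for n
    by (rule sets_prefix_event[of "Suc n"], rule prefix_detI) (metis order_refl le_SucI order_trans)
  moreover have "{X. X 0 = 0} \<in> sets path_space"
    by (rule sets_prefix_event[of 0], rule prefix_detI) (metis order_refl)
  moreover have "{X. X 0 = 0 \<and> (\<forall>n. \<exists>i\<in>{1..4}. X (Suc n) = X n + unit_vec i)} =
      {X. X 0 = 0} \<inter> (\<Inter>n. {X. \<exists>i\<in>{1..4}. X (Suc n) = X n + unit_vec i})" by auto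
  ultimately show "{X. X 0 = 0 \<and> (\<forall>n. \<exists>i\<in>{1..4}. X (Suc n) = X n + unit_vec i)} \<in> sets path_space"
    by (simp only:) (intro sets.Int sets.countable_INT'', auto simp: UNIV_in_path_space)
qed

section \<open>Kalikow's comparison\<close>

text \<open>
  The Green function of the walk with survival probability \<open>s\<close> per step, killed on leaving \<open>U\<close>:
  the expected number of visits to \<open>y\<close> from \<open>z\<close>.
\<close>

definition green :: "(int \<times> int) set \<Rightarrow> real \<Rightarrow> int \<times> int \<Rightarrow> (int \<times> int \<Rightarrow> bool) \<Rightarrow> int \<times> int \<Rightarrow> real" where
  "green U s y \<omega> z = (\<Sum>k. s ^ k * (kill_op U \<omega> ^^ k) (indicator {y}) z)"

context
  fixes U :: "(int \<times> int) set" and s :: real and y :: "int \<times> int" assumes s: "0 < s" "s < 1"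
begin

lemma green_term_nonneg: "0 \<le> s ^ k * (kill_op U \<omega> ^^ k) (indicator {y}) z"
  using s by (intro mult_nonneg_nonneg kill_op_power_nonneg) auto

lemma green_term_le: "s ^ k * (kill_op U \<omega> ^^ k) (indicator {y}) z \<le> s ^ k"
proof -
  have "(kill_op U \<omega> ^^ k) (indicator {y}) z \<le> 1" by (rule kill_op_power_le) auto
  then show ?thesis using s by (simp add: mult_left_le)
qed

lemma green_summable: "summable (\<lambda>k. s ^ k * (kill_op U \<omega> ^^ k) (indicator {y}) z)"
  by (rule summable_comparison_test'[of "\<lambda>k. s ^ k" 0])
     (use s green_term_le green_term_nonneg in auto)

lemma green_nonneg: "0 \<le> green U s y \<omega> z"
  unfolding green_def by (rule suminf_nonneg[OF green_summable green_term_nonneg])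

lemma green_le: "green U s y \<omega> z \<le> 1 / (1 - s)"
proof -
  have "green U s y \<omega> z \<le> (\<Sum>k. s ^ k)"
    unfolding green_def using s by (intro suminf_le green_term_le green_summable) simp
  then show ?thesis using s by (simp add: suminf_geometric)
qed

lemma green_rec: "green U s y \<omega> z = indicator {y} z + s * kill_op U \<omega> (green U s y \<omega>) z"
proof -
  let ?t = "\<lambda>z k. s ^ k * (kill_op U \<omega> ^^ k) (indicator {y}) z"
  have "green U s y \<omega> z = ?t z 0 + (\<Sum>k. ?t z (Suc k))"
    unfolding green_def using suminf_split_head[OF green_summable] by simp
  also have "(\<Sum>k. ?t z (Suc k)) = s * kill_op U \<omega> (green U s y \<omega>) z"
  proof (cases "z \<in> U")
    case True
    have eq: "?t z (Suc k) = s * (\<Sum>i = 1..4. q (\<omega> z) i * ?t (z + unit_vec i) k)" for k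
      unfolding kill_op_Suc using True by (simp add: sum_distrib_left mult_ac)
    have "(\<lambda>k. s * (\<Sum>i = 1..4. q (\<omega> z) i * ?t (z + unit_vec i) k)) sums
        (s * (\<Sum>i = 1..4. q (\<omega> z) i * green U s y \<omega> (z + unit_vec i)))"
      unfolding green_def by (intro sums_mult sums_sum summable_sums green_summable)
    then show ?thesis using True unfolding eq by (simp only: sums_unique[symmetric] kill_op_def if_True)
  next
    case False
    then show ?thesis unfolding kill_op_Suc by (simp add: kill_op_def)
  qed
  finally show ?thesis by simp
qed

text \<open>
  A minimum principle: a function that is bounded below, and at every site nonnegative or
  \<open>s\<close>-superharmonic, is nonnegative.
\<close>

lemma minimum_principle:
  fixes g :: "int \<times> int \<Rightarrow> real"
  assumes bdd: "\<And>z. - c \<le> g z" and c: "0 \<le> c"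
    and super: "\<And>z. 0 \<le> g z \<or> s * (\<Sum>i = 1..4. q (\<omega> z) i * g (z + unit_vec i)) \<le> g z"
  shows "0 \<le> g z"
proof -
  have *: "- (c * s ^ n) \<le> g z" for n z
  proof (induction n arbitrary: z)
    case (Suc n)
    show ?case
    proof (cases "0 \<le> g z")
      case True
      moreover have "0 \<le> c * s ^ Suc n" using c s by simp
      ultimately show ?thesis by linarith
    next
      case False
      have "s * (\<Sum>i = 1..4. q (\<omega> z) i * - (c * s ^ n)) \<le> s * (\<Sum>i = 1..4. q (\<omega> z) i * g (z + unit_vec i))"
        using Suc s by (intro mult_left_mono sum_mono less_imp_le[OF q_pos]) auto
      also have "(\<Sum>i = 1..4. q (\<omega> z) i * - (c * s ^ n)) = - (c * s ^ n)"
        using q_sum[of "\<omega> z"] unfolding sum_distrib_right[symmetric] by simp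
      finally show ?thesis using super[of z] False by (simp add: mult_ac)
    qed
  qed (use bdd in simp)
  have "(\<lambda>n. - (c * s ^ n)) \<longlonglongrightarrow> - (c * 0)"
    using s by (intro tendsto_intros LIMSEQ_realpow_zero) auto
  then have "- (c * 0) \<le> g z" by (rule LIMSEQ_le_const2) (use * in auto)
  then show ?thesis by simp
qed

lemma green_le_diagonal:
  assumes "y \<in> U"
  shows "green U s y \<omega> z \<le> green U s y \<omega> y"
proof -
  let ?f = "green U s y \<omega>"
  have "0 \<le> ?f y - ?f z" for z
  proof (rule minimum_principle[of "1 / (1 - s)" _ \<omega>])
    fix z
    show "- (1 / (1 - s)) \<le> ?f y - ?f z" using green_le[of \<omega> z] green_nonneg[of \<omega> y] by simp
    show "0 \<le> ?f y - ?f z \<or> s * (\<Sum>i = 1..4. q (\<omega> z) i * (?f y - ?f (z + unit_vec i))) \<le> ?f y - ?f z"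
    proof (cases "z \<noteq> y \<and> z \<in> U")
      case True
      have "(\<Sum>i = 1..4. q (\<omega> z) i * (?f y - ?f (z + unit_vec i))) =
          (\<Sum>i = 1..4. q (\<omega> z) i) * ?f y - (\<Sum>i = 1..4. q (\<omega> z) i * ?f (z + unit_vec i))"
        by (simp only: right_diff_distrib sum_subtractf sum_distrib_right)
      moreover have "?f z = s * (\<Sum>i = 1..4. q (\<omega> z) i * ?f (z + unit_vec i))"
        using green_rec[of \<omega> z] True by (simp add: kill_op_def)
      moreover have "s * ?f y \<le> ?f y" using s green_nonneg[of \<omega> y] by (simp add: mult_left_le_one_le)
      ultimately show ?thesis unfolding q_sum by (simp add: right_diff_distrib)
    next
      case False
      then show ?thesis using green_rec[of \<omega> z] green_nonneg[of \<omega> y]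
        by (cases "z = y") (auto simp: kill_op_def)
    qed
  qed (use s in simp)
  then show ?thesis by simp
qed

text \<open>
  Kalikow's observation: recoloring \<open>y\<close> from blue to red multiplies the expected number of visits
  to \<open>y\<close> by at most \<open>M\<close>. With \<open>G\<^sub>B\<close> and \<open>G\<^sub>R\<close> the two Green functions, \<open>M * G\<^sub>B - G\<^sub>R\<close> is
  superharmonic for the walk with a red \<open>y\<close>; at \<open>y\<close> this uses \<open>b i \<le> M * r i\<close> and that \<open>G\<^sub>B\<close> is
  maximal there.
\<close>

lemma green_recolor_le:
  assumes y: "y \<in> U" and M: "\<And>i. i \<in> {1..4} \<Longrightarrow> b i \<le> M * r i" "0 \<le> M"
  shows "green U s y (fun_upd \<omega> y False) z \<le> M * green U s y (fun_upd \<omega> y True) z"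
proof -
  let ?R = "fun_upd \<omega> y False" and ?B = "fun_upd \<omega> y True"
  let ?fR = "green U s y ?R" and ?fB = "green U s y ?B"
  have "0 \<le> M * ?fB z - ?fR z" for z
  proof (rule minimum_principle[of "1 / (1 - s)" _ ?R])
    fix z
    have "0 \<le> M * ?fB z" using M green_nonneg by simp
    then show "- (1 / (1 - s)) \<le> M * ?fB z - ?fR z" using green_le[of ?R z] by linarith
    show "0 \<le> M * ?fB z - ?fR z \<or>
        s * (\<Sum>i = 1..4. q (?R z) i * (M * ?fB (z + unit_vec i) - ?fR (z + unit_vec i))) \<le> M * ?fB z - ?fR z"
    proof -
      have split: "s * (\<Sum>i = 1..4. q c i * (M * ?fB (z + unit_vec i) - ?fR (z + unit_vec i))) =
          M * (s * (\<Sum>i = 1..4. q c i * ?fB (z + unit_vec i))) - s * (\<Sum>i = 1..4. q c i * ?fR (z + unit_vec i))" for c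
        by (simp add: right_diff_distrib sum_subtractf sum_distrib_left mult_ac)
      consider "z = y" | "z \<noteq> y" "z \<in> U" | "z \<noteq> y" "z \<notin> U" by blast
      then show ?thesis
      proof cases
        case 1
        let ?e = "\<lambda>i. ?fB y - s * ?fB (y + unit_vec i)"
        have R: "?fR y = 1 + s * (\<Sum>i = 1..4. r i * ?fR (y + unit_vec i))"
          using green_rec[of ?R y] y by (simp add: kill_op_def q_def)
        have B: "?fB y = 1 + s * (\<Sum>i = 1..4. b i * ?fB (y + unit_vec i))"
          using green_rec[of ?B y] y by (simp add: kill_op_def q_def)
        have sum_e: "(\<Sum>i = 1..4. c i * ?e i) = ?fB y - s * (\<Sum>i = 1..4. c i * ?fB (y + unit_vec i))"
          if "(\<Sum>i = 1..4. c i) = 1" for c :: "nat \<Rightarrow> real"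
        proof -
          have "(\<Sum>i = 1..4. c i * ?e i) = (\<Sum>i = 1..4. c i) * ?fB y - s * (\<Sum>i = 1..4. c i * ?fB (y + unit_vec i))"
            unfolding sum_distrib_right sum_distrib_left sum_subtractf[symmetric]
            by (intro sum.cong refl) (simp add: algebra_simps)
          then show ?thesis using that by simp
        qed
        \<comment> \<open>The increments \<open>?e i\<close> are nonnegative, so \<open>b i\<close> may be replaced by \<open>M * r i\<close>.\<close>
        have "1 = (\<Sum>i = 1..4. b i * ?e i)" unfolding sum_e[OF b(2)] using B by simp
        also have "\<dots> \<le> (\<Sum>i = 1..4. M * r i * ?e i)"
        proof (intro sum_mono mult_right_mono M)
          fix i
          have "s * ?fB (y + unit_vec i) \<le> ?fB (y + unit_vec i)"
            using s green_nonneg by (simp add: mult_left_le_one_le)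
          also have "\<dots> \<le> ?fB y" by (rule green_le_diagonal[OF y])
          finally show "0 \<le> ?e i" by simp
        qed auto
        also have "\<dots> = M * (\<Sum>i = 1..4. r i * ?e i)"
          by (simp add: sum_distrib_left mult_ac)
        finally have "1 \<le> M * (?fB y - s * (\<Sum>i = 1..4. r i * ?fB (y + unit_vec i)))"
          unfolding sum_e[OF r(2)] .
        then have "s * (\<Sum>i = 1..4. r i * (M * ?fB (y + unit_vec i) - ?fR (y + unit_vec i))) \<le> M * ?fB y - ?fR y"
          using R split[of False] unfolding 1 by (simp add: q_def right_diff_distrib)
        then show ?thesis unfolding 1 by (simp add: q_def)
      next
        case 2
        have "?fR z = s * (\<Sum>i = 1..4. q (\<omega> z) i * ?fR (z + unit_vec i))"
          "?fB z = s * (\<Sum>i = 1..4. q (\<omega> z) i * ?fB (z + unit_vec i))"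
          using green_rec[of ?R z] green_rec[of ?B z] 2 by (simp_all add: kill_op_def)
        then show ?thesis using 2 split[of "\<omega> z"] by simp
      next
        case 3
        then show ?thesis using green_rec[of ?R z] green_rec[of ?B z] by (simp add: kill_op_def)
      qed
    qed
  qed (use s in simp)
  then show ?thesis by simp
qed

lemma measurable_green: "(\<lambda>\<omega>. ennreal (green U s y \<omega> z)) \<in> borel_measurable C"
  unfolding green_def
  by (intro measurable_compose[OF _ measurable_ennreal] borel_measurable_suminf borel_measurable_times
      borel_measurable_const measurable_kill_op_power)

lemma green_color_le:
  assumes y: "y \<in> U" and M: "\<And>i. i \<in> {1..4} \<Longrightarrow> b i \<le> M * r i" "0 \<le> M"
  shows "(\<integral>\<^sup>+\<omega>. indicator {False} (\<omega> y) * ennreal (green U s y \<omega> 0) \<partial>C) \<le>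
    ennreal ((1 - p) * M / p) * (\<integral>\<^sup>+\<omega>. indicator {True} (\<omega> y) * ennreal (green U s y \<omega> 0) \<partial>C)"
proof -
  note overwrite = nn_integral_color_overwrite[OF _ _ measurable_green]
  have "(\<integral>\<^sup>+\<omega>. indicator {False} (\<omega> y) * ennreal (green U s y \<omega> 0) \<partial>C) =
      ennreal (1 - p) * (\<integral>\<^sup>+\<omega>. ennreal (green U s y (fun_upd \<omega> y False) 0) \<partial>C)"
    using overwrite[of False y] p by simp
  also have "\<dots> \<le> ennreal (1 - p) * (\<integral>\<^sup>+\<omega>. ennreal M * ennreal (green U s y (fun_upd \<omega> y True) 0) \<partial>C)"
    using green_recolor_le[OF y M] M green_nonneg
    by (intro mult_left_mono nn_integral_mono) (simp_all add: ennreal_mult[symmetric])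
  also have "(\<integral>\<^sup>+\<omega>. ennreal M * ennreal (green U s y (fun_upd \<omega> y True) 0) \<partial>C) =
      ennreal M * (\<integral>\<^sup>+\<omega>. ennreal (green U s y (fun_upd \<omega> y True) 0) \<partial>C)"
    by (rule nn_integral_cmult, rule measurable_compose[OF measurable_fun_upd_color measurable_green])
  also have "ennreal (1 - p) * \<dots> = ennreal ((1 - p) * M / p) *
      (ennreal p * (\<integral>\<^sup>+\<omega>. ennreal (green U s y (fun_upd \<omega> y True) 0) \<partial>C))"
    using p M by (simp add: mult.assoc[symmetric] ennreal_mult[symmetric])
  also have "ennreal p * (\<integral>\<^sup>+\<omega>. ennreal (green U s y (fun_upd \<omega> y True) 0) \<partial>C) =
      (\<integral>\<^sup>+\<omega>. indicator {True} (\<omega> y) * ennreal (green U s y \<omega> 0) \<partial>C)"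
    using overwrite[of True y] p by simp
  finally show ?thesis .
qed

end

end

section \<open>Colors seen by the walk\<close>

lemma borel_measurable_nn_integral_countable:
  assumes U: "countable U" and g: "\<And>y. (\<lambda>x. g x y) \<in> borel_measurable M"
  shows "(\<lambda>x. \<integral>\<^sup>+y. g x y \<partial>count_space U) \<in> borel_measurable M"
proof -
  interpret sigma_finite_measure "count_space U"
    by (rule sigma_finite_measure_count_space_countable[OF U])
  have "(\<lambda>x. g (snd x) (fst x)) \<in> borel_measurable (count_space U \<Otimes>\<^sub>M M)"
    by (rule measurable_pair_measure_countable1[OF U]) (simp only: fst_conv snd_conv g)
  from measurable_pair_swap[OF this] have "case_prod g \<in> borel_measurable (M \<Otimes>\<^sub>M count_space U)"
    by (simp only: fst_conv snd_conv)
  then show ?thesis by (rule borel_measurable_nn_integral)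
qed

context two_vertex
begin

text \<open>
  Expected weight \<open>h\<close> of the position at time \<open>k\<close>, on the event that its color is \<open>c\<close> and that the
  walk has stayed in \<open>U\<close>.
\<close>

definition occ :: "(int \<times> int) set \<Rightarrow> (int \<times> int \<Rightarrow> real) \<Rightarrow> bool \<Rightarrow> nat \<Rightarrow> ennreal" where
  "occ U h c k = (\<integral>\<^sup>+\<omega>. \<integral>\<^sup>+X. ennreal (h (X k)) * indicator {c} (\<omega> (X k)) *
     indicator {X. \<forall>j\<le>k. X j \<in> U} X \<partial>QL \<omega> \<partial>C)"

lemma measurable_color_indicator: "(\<lambda>\<omega>. indicator {c} (\<omega> y) :: ennreal) \<in> borel_measurable C"
  by (rule measurable_compose[OF measurable_color]) simp

text \<open>
  Decomposition over the value \<open>y\<close> of \<open>X k\<close>, where the set in which the earlier positions have to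
  lie may depend on \<open>y\<close>: it is \<open>U\<close> for the killed walk and \<open>- {y}\<close> for a first visit to \<open>y\<close>.
\<close>

lemma nn_integral_last_position:
  fixes g :: "int \<times> int \<Rightarrow> ennreal"
  shows "(\<integral>\<^sup>+X. g (X k) * indicator {X. \<forall>j<k. X j \<in> V (X k)} X \<partial>QL \<omega>) =
    (\<integral>\<^sup>+y. g y * ennreal ((kill_op (V y) \<omega> ^^ k) (indicator {y}) 0) \<partial>count_space UNIV)"
proof -
  let ?v = "\<lambda>X y. ennreal (indicator {y} (X k)) * indicator {X. \<forall>j<k. X j \<in> V y} X"
  have m: "(\<lambda>X. ?v X y) \<in> borel_measurable (QL \<omega>)" for y
  proof (rule measurable_prefix_fun[of k, OF _ _ sets_quenched_law])
    fix X Y :: "nat \<Rightarrow> int \<times> int" assume "\<And>j. j \<le> k \<Longrightarrow> X j = Y j"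
    then have "X k = Y k" "(\<forall>j<k. X j \<in> V y) = (\<forall>j<k. Y j \<in> V y)" by auto
    then show "?v X y = ?v Y y" by (simp only: indicator_def mem_Collect_eq)
  qed simp
  have "g (X k) * indicator {X. \<forall>j<k. X j \<in> V (X k)} X = (\<integral>\<^sup>+y. g y * ?v X y \<partial>count_space UNIV)" for X
  proof -
    have "(\<integral>\<^sup>+y. g y * ?v X y \<partial>count_space UNIV) =
        (\<integral>\<^sup>+y. (g y * indicator {X. \<forall>j<k. X j \<in> V y} X) * indicator {X k} y \<partial>count_space UNIV)"
      by (intro nn_integral_cong) (simp add: indicator_def)
    also have "\<dots> = g (X k) * indicator {X. \<forall>j<k. X j \<in> V (X k)} X"
      by (subst nn_integral_indicator_singleton) (auto simp: indicator_def)
    finally show ?thesis ..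
  qed
  then have "(\<integral>\<^sup>+X. g (X k) * indicator {X. \<forall>j<k. X j \<in> V (X k)} X \<partial>QL \<omega>) =
      (\<integral>\<^sup>+X. (\<integral>\<^sup>+y. g y * ?v X y \<partial>count_space UNIV) \<partial>QL \<omega>)" by presburger
  also have "\<dots> = (\<integral>\<^sup>+y. (\<integral>\<^sup>+X. g y * ?v X y \<partial>QL \<omega>) \<partial>count_space UNIV)"
    by (rule nn_integral_count_space_nn_integral[OF countableI_type])
       (intro borel_measurable_times_ennreal m borel_measurable_const)
  also have "\<dots> = (\<integral>\<^sup>+y. g y * (\<integral>\<^sup>+X. ?v X y \<partial>QL \<omega>) \<partial>count_space UNIV)"
    by (intro nn_integral_cong nn_integral_cmult m)
  also have "\<dots> = (\<integral>\<^sup>+y. g y * ennreal ((kill_op (V y) \<omega> ^^ k) (indicator {y}) 0) \<partial>count_space UNIV)"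
    by (simp only: nn_integral_killed[of "indicator _", OF indicator_pos_le])
  finally show ?thesis .
qed

lemma occ_integrand:
  "(\<integral>\<^sup>+X. ennreal (h (X k)) * indicator {c} (\<omega> (X k)) * indicator {X. \<forall>j\<le>k. X j \<in> U} X \<partial>QL \<omega>) =
    (\<integral>\<^sup>+y. ennreal (h y) * indicator {c} (\<omega> y) * ennreal ((kill_op U \<omega> ^^ k) (indicator {y}) 0) \<partial>count_space U)"
proof -
  let ?w = "\<lambda>y. ennreal (h y) * indicator {c} (\<omega> y) :: ennreal"
  have "?w (X k) * indicator {X. \<forall>j\<le>k. X j \<in> U} X =
      (?w (X k) * indicator U (X k)) * indicator {X. \<forall>j<k. X j \<in> U} X" for X
  proof -
    have "(\<forall>j\<le>k. X j \<in> U) \<longleftrightarrow> X k \<in> U \<and> (\<forall>j<k. X j \<in> U)" by (auto simp: le_less)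
    then show ?thesis by (simp add: indicator_def)
  qed
  then have "(\<integral>\<^sup>+X. ?w (X k) * indicator {X. \<forall>j\<le>k. X j \<in> U} X \<partial>QL \<omega>) =
      (\<integral>\<^sup>+X. (?w (X k) * indicator U (X k)) * indicator {X. \<forall>j<k. X j \<in> U} X \<partial>QL \<omega>)" by presburger
  also have "\<dots> = (\<integral>\<^sup>+y. (?w y * indicator U y) * ennreal ((kill_op U \<omega> ^^ k) (indicator {y}) 0) \<partial>count_space UNIV)"
    by (rule nn_integral_last_position[where g = "\<lambda>y. ?w y * indicator U y" and V = "\<lambda>_. U"])
  also have "\<dots> = (\<integral>\<^sup>+y. (?w y * ennreal ((kill_op U \<omega> ^^ k) (indicator {y}) 0)) * indicator U y \<partial>count_space UNIV)"
    by (simp only: mult_ac)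
  also have "\<dots> = (\<integral>\<^sup>+y. ?w y * ennreal ((kill_op U \<omega> ^^ k) (indicator {y}) 0) \<partial>count_space U)"
    by (rule nn_integral_count_space_indicator[symmetric]) simp
  finally show ?thesis .
qed

lemma measurable_kill_op_ennreal:
  "(\<lambda>\<omega>. ennreal ((kill_op U \<omega> ^^ k) f z)) \<in> borel_measurable C"
  by (rule measurable_compose[OF measurable_kill_op_power measurable_ennreal])

lemma occ_eq:
  "occ U h c k = (\<integral>\<^sup>+y. ennreal (h y) *
     (\<integral>\<^sup>+\<omega>. indicator {c} (\<omega> y) * ennreal ((kill_op U \<omega> ^^ k) (indicator {y}) 0) \<partial>C) \<partial>count_space U)"
proof -
  let ?g = "\<lambda>\<omega> y. indicator {c} (\<omega> y) * ennreal ((kill_op U \<omega> ^^ k) (indicator {y}) 0)"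
  have m: "(\<lambda>\<omega>. ?g \<omega> y) \<in> borel_measurable C" for y
    by (intro borel_measurable_times_ennreal measurable_color_indicator measurable_kill_op_ennreal)
  have "occ U h c k = (\<integral>\<^sup>+\<omega>. (\<integral>\<^sup>+y. ennreal (h y) * ?g \<omega> y \<partial>count_space U) \<partial>C)"
    unfolding occ_def occ_integrand by (simp only: mult.assoc)
  also have "\<dots> = (\<integral>\<^sup>+y. (\<integral>\<^sup>+\<omega>. ennreal (h y) * ?g \<omega> y \<partial>C) \<partial>count_space U)"
    by (rule nn_integral_count_space_nn_integral[OF countableI_type])
       (intro borel_measurable_times_ennreal m borel_measurable_const)
  also have "\<dots> = (\<integral>\<^sup>+y. ennreal (h y) * (\<integral>\<^sup>+\<omega>. ?g \<omega> y \<partial>C) \<partial>count_space U)"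
    by (intro nn_integral_cong nn_integral_cmult m)
  finally show ?thesis .
qed

text \<open>
  Summed over time with discount \<open>s\<close>, the expected weights are expressed by the Green function.
\<close>

lemma suminf_occ:
  assumes s: "0 < s" "s < 1"
  shows "(\<Sum>k. ennreal (s ^ k) * occ U h c k) =
    (\<integral>\<^sup>+y. ennreal (h y) * (\<integral>\<^sup>+\<omega>. indicator {c} (\<omega> y) * ennreal (green U s y \<omega> 0) \<partial>C) \<partial>count_space U)"
proof -
  let ?K = "\<lambda>\<omega> y k. ennreal ((kill_op U \<omega> ^^ k) (indicator {y}) 0)"
  let ?I = "\<lambda>y k. \<integral>\<^sup>+\<omega>. indicator {c} (\<omega> y) * ?K \<omega> y k \<partial>C"
  have m: "(\<lambda>\<omega>. indicator {c} (\<omega> y) * ?K \<omega> y k) \<in> borel_measurable C" for y k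
    by (intro borel_measurable_times_ennreal measurable_color_indicator measurable_kill_op_ennreal)
  have green: "(\<Sum>k. ennreal (s ^ k) * (indicator {c} (\<omega> y) * ?K \<omega> y k)) =
      indicator {c} (\<omega> y) * ennreal (green U s y \<omega> 0)" for y \<omega>
  proof -
    have "(\<Sum>k. ennreal (s ^ k) * (indicator {c} (\<omega> y) * ?K \<omega> y k)) =
      (\<Sum>k. indicator {c} (\<omega> y) * (ennreal (s ^ k * (kill_op U \<omega> ^^ k) (indicator {y}) 0)))"
      by (intro suminf_cong) (use s in \<open>simp add: ennreal_mult' mult.left_commute\<close>)
    also have "\<dots> = indicator {c} (\<omega> y) * (\<Sum>k. ennreal (s ^ k * (kill_op U \<omega> ^^ k) (indicator {y}) 0))"
      by (rule ennreal_suminf_cmult)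
    also have "(\<Sum>k. ennreal (s ^ k * (kill_op U \<omega> ^^ k) (indicator {y}) 0)) = ennreal (green U s y \<omega> 0)"
      unfolding green_def by (intro suminf_ennreal2 green_summable green_term_nonneg s)
    finally show ?thesis .
  qed
  have "(\<Sum>k. ennreal (s ^ k) * occ U h c k) =
      (\<Sum>k. \<integral>\<^sup>+y. ennreal (s ^ k) * (ennreal (h y) * ?I y k) \<partial>count_space U)"
    unfolding occ_eq by (intro suminf_cong nn_integral_cmult[symmetric]) simp
  also have "\<dots> = (\<integral>\<^sup>+y. (\<Sum>k. ennreal (s ^ k) * (ennreal (h y) * ?I y k)) \<partial>count_space U)"
    by (intro nn_integral_suminf[symmetric]) simp
  also have "\<dots> = (\<integral>\<^sup>+y. ennreal (h y) * (\<integral>\<^sup>+\<omega>. indicator {c} (\<omega> y) * ennreal (green U s y \<omega> 0) \<partial>C) \<partial>count_space U)"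
  proof (rule nn_integral_cong)
    fix y
    have "(\<Sum>k. ennreal (s ^ k) * (ennreal (h y) * ?I y k)) =
        (\<Sum>k. ennreal (h y) * (\<integral>\<^sup>+\<omega>. ennreal (s ^ k) * (indicator {c} (\<omega> y) * ?K \<omega> y k) \<partial>C))"
      by (intro suminf_cong) (simp only: nn_integral_cmult[OF m] mult.left_commute)
    also have "\<dots> = ennreal (h y) * (\<Sum>k. \<integral>\<^sup>+\<omega>. ennreal (s ^ k) * (indicator {c} (\<omega> y) * ?K \<omega> y k) \<partial>C)"
      by (rule ennreal_suminf_cmult)
    also have "(\<Sum>k. \<integral>\<^sup>+\<omega>. ennreal (s ^ k) * (indicator {c} (\<omega> y) * ?K \<omega> y k) \<partial>C) =
        (\<integral>\<^sup>+\<omega>. (\<Sum>k. ennreal (s ^ k) * (indicator {c} (\<omega> y) * ?K \<omega> y k)) \<partial>C)"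
      by (intro nn_integral_suminf[symmetric] borel_measurable_times_ennreal m borel_measurable_const)
    finally show "(\<Sum>k. ennreal (s ^ k) * (ennreal (h y) * ?I y k)) =
        ennreal (h y) * (\<integral>\<^sup>+\<omega>. indicator {c} (\<omega> y) * ennreal (green U s y \<omega> 0) \<partial>C)"
      unfolding green .
  qed
  finally show ?thesis .
qed

text \<open>
  If the mean of \<open>f z\<close> after a step from a site \<open>z\<close> of color \<open>c\<close> is \<open>\<rho> c * h z\<close>, then its
  annealed mean is determined by the colors seen by the walk.
\<close>

lemma annealed_step:
  assumes f: "\<And>z y. 0 \<le> f z y" and h: "\<And>z. 0 \<le> h z" and \<rho>: "\<And>c. 0 \<le> \<rho> c"
    and step: "\<And>c z. (\<Sum>i = 1..4. q c i * f z (z + unit_vec i)) = \<rho> c * h z"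
  shows "(\<integral>\<^sup>+X. ennreal (f (X k) (X (Suc k))) * indicator {X. \<forall>j\<le>k. X j \<in> U} X \<partial>path_law) =
    ennreal (\<rho> True) * occ U h True k + ennreal (\<rho> False) * occ U h False k"
proof -
  let ?S = "{X :: nat \<Rightarrow> int \<times> int. \<forall>j\<le>k. X j \<in> U}"
  have E: "prefix_det k (\<lambda>X. \<forall>j\<le>k. X j \<in> U)" by (rule prefix_detI) auto
  let ?g = "\<lambda>c \<omega> X. ennreal (h (X k)) * indicator {c} (\<omega> (X k)) * indicator ?S X :: ennreal"
  have mg: "?g c \<omega> \<in> borel_measurable (QL \<omega>)" for c \<omega>
  proof (rule measurable_prefix_fun[of k, OF _ _ sets_quenched_law])
    fix X Y :: "nat \<Rightarrow> int \<times> int" assume "\<And>j. j \<le> k \<Longrightarrow> X j = Y j"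
    then have "X k = Y k" "(\<forall>j\<le>k. X j \<in> U) = (\<forall>j\<le>k. Y j \<in> U)" by auto
    then show "?g c \<omega> X = ?g c \<omega> Y" by (simp add: indicator_def)
  qed simp
  have mo: "(\<lambda>\<omega>. \<integral>\<^sup>+X. ?g c \<omega> X \<partial>QL \<omega>) \<in> borel_measurable C" for c
    unfolding occ_integrand
    by (intro borel_measurable_nn_integral_countable countableI_type borel_measurable_times_ennreal
        borel_measurable_const measurable_color_indicator measurable_kill_op_ennreal)
  have "(\<integral>\<^sup>+X. ennreal (f (X k) (X (Suc k))) * indicator ?S X \<partial>path_law) =
      (\<integral>\<^sup>+\<omega>. \<integral>\<^sup>+X. ennreal (f (X k) (X (Suc k))) * indicator ?S X \<partial>QL \<omega> \<partial>C)"
  proof (rule nn_integral_path_law, rule measurable_prefix_fun[of "Suc k"])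
    fix X Y :: "nat \<Rightarrow> int \<times> int" assume *: "\<And>j. j \<le> Suc k \<Longrightarrow> X j = Y j"
    then have "X (Suc k) = Y (Suc k)" "X k = Y k" "(\<forall>j\<le>k. X j \<in> U) = (\<forall>j\<le>k. Y j \<in> U)" by auto
    then show "ennreal (f (X k) (X (Suc k))) * indicator ?S X = ennreal (f (Y k) (Y (Suc k))) * indicator ?S Y"
      by (simp add: indicator_def)
  qed simp_all
  also have "\<dots> = (\<integral>\<^sup>+\<omega>. ennreal (\<rho> True) * (\<integral>\<^sup>+X. ?g True \<omega> X \<partial>QL \<omega>) +
      ennreal (\<rho> False) * (\<integral>\<^sup>+X. ?g False \<omega> X \<partial>QL \<omega>) \<partial>C)"
  proof (rule nn_integral_cong)
    fix \<omega>
    have "(\<integral>\<^sup>+X. ennreal (f (X k) (X (Suc k))) * indicator ?S X \<partial>QL \<omega>) =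
        (\<integral>\<^sup>+X. ennreal (\<rho> (\<omega> (X k)) * h (X k)) * indicator ?S X \<partial>QL \<omega>)"
      using quenched_step[OF E, where f = "\<lambda>x y. ennreal (f x y)" and \<omega> = \<omega>]
      by (simp only: nn_integral_transition[OF f] step)
    also have "\<dots> = (\<integral>\<^sup>+X. ennreal (\<rho> True) * ?g True \<omega> X + ennreal (\<rho> False) * ?g False \<omega> X \<partial>QL \<omega>)"
    proof (rule nn_integral_cong)
      fix X :: "nat \<Rightarrow> int \<times> int"
      show "ennreal (\<rho> (\<omega> (X k)) * h (X k)) * indicator ?S X =
          ennreal (\<rho> True) * ?g True \<omega> X + ennreal (\<rho> False) * ?g False \<omega> X"
        by (cases "\<omega> (X k)") (simp_all add: ennreal_mult \<rho> h mult.assoc)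
    qed
    also have "\<dots> = ennreal (\<rho> True) * (\<integral>\<^sup>+X. ?g True \<omega> X \<partial>QL \<omega>) +
        ennreal (\<rho> False) * (\<integral>\<^sup>+X. ?g False \<omega> X \<partial>QL \<omega>)"
      by (subst nn_integral_add, (intro borel_measurable_times_ennreal borel_measurable_const mg)+,
          subst (1 2) nn_integral_cmult, (intro mg)+, rule refl)
    finally show "(\<integral>\<^sup>+X. ennreal (f (X k) (X (Suc k))) * indicator ?S X \<partial>QL \<omega>) = \<dots>" .
  qed
  also have "\<dots> = ennreal (\<rho> True) * occ U h True k + ennreal (\<rho> False) * occ U h False k"
    unfolding occ_def
    by (subst nn_integral_add, (intro borel_measurable_times_ennreal borel_measurable_const mo)+,
        subst (1 2) nn_integral_cmult, (intro mo)+, rule refl)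
  finally show ?thesis .
qed

lemma occ_add:
  assumes "\<And>z. 0 \<le> h z"
  shows "occ U h True k + occ U h False k =
    (\<integral>\<^sup>+X. ennreal (h (X k)) * indicator {X. \<forall>j\<le>k. X j \<in> U} X \<partial>path_law)"
  using annealed_step[where f = "\<lambda>z _. h z" and h = h and \<rho> = "\<lambda>_. 1" and k = k and U = U] assms q_sum
  by (simp add: sum_distrib_right[symmetric])

lemma occ_le:
  assumes h: "\<And>z. 0 \<le> h z" "\<And>z. z \<in> U \<Longrightarrow> h z \<le> a" and a: "0 \<le> a"
  shows "occ U h c k \<le> ennreal a"
proof -
  interpret prob_space path_law by (rule prob_space_path_law)
  have "occ U h c k \<le> occ U h True k + occ U h False k" by (cases c) simp_all
  also have "\<dots> = (\<integral>\<^sup>+X. ennreal (h (X k)) * indicator {X. \<forall>j\<le>k. X j \<in> U} X \<partial>path_law)"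
    by (rule occ_add[OF h(1)])
  also have "\<dots> \<le> (\<integral>\<^sup>+X. ennreal a \<partial>path_law)"
  proof (rule nn_integral_mono)
    fix X show "ennreal (h (X k)) * indicator {X. \<forall>j\<le>k. X j \<in> U} X \<le> ennreal a"
      using h(2)[of "X k"] a by (auto simp: indicator_def ennreal_leI)
  qed
  also have "\<dots> = ennreal a" using emeasure_space_1 by simp
  finally show ?thesis .
qed

lemma suminf_occ_real:
  assumes s: "0 < s" "s < 1" and h: "\<And>z. 0 \<le> h z" "\<And>z. z \<in> U \<Longrightarrow> h z \<le> a" and a: "0 \<le> a"
  shows "summable (\<lambda>k. s ^ k * enn2real (occ U h c k))"
    and "(\<Sum>k. ennreal (s ^ k) * occ U h c k) = ennreal (\<Sum>k. s ^ k * enn2real (occ U h c k))"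
proof -
  have occ: "occ U h c k \<le> ennreal a" for k by (rule occ_le[OF h(1) _ a]) (rule h(2))
  then have le: "enn2real (occ U h c k) \<le> a" for k
    using a by (intro enn2real_leI)
  show sm: "summable (\<lambda>k. s ^ k * enn2real (occ U h c k))"
  proof (rule summable_comparison_test'[of "\<lambda>k. a * s ^ k" 0])
    show "norm (s ^ k * enn2real (occ U h c k)) \<le> a * s ^ k" for k
      using s le[of k] by (simp add: abs_mult mult.commute mult_right_mono)
  qed (use s in simp)
  have "ennreal (s ^ k) * occ U h c k = ennreal (s ^ k * enn2real (occ U h c k))" for k
  proof -
    have "occ U h c k < \<top>" by (rule le_less_trans[OF occ ennreal_less_top])
    then show ?thesis using s by (simp add: ennreal_mult' ennreal_enn2real)
  qed
  then show "(\<Sum>k. ennreal (s ^ k) * occ U h c k) = ennreal (\<Sum>k. s ^ k * enn2real (occ U h c k))"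
    by (simp only:) (intro suminf_ennreal2 sm, use s in simp)
qed

text \<open>
  Kalikow's comparison after averaging: with discount, the weight collected at red sites is at most
  \<open>(1 - p) * M / p\<close> times the weight collected at blue sites.
\<close>

lemma occ_red_le:
  assumes s: "0 < s" "s < 1" and h: "\<And>z. 0 \<le> h z" "\<And>z. z \<in> U \<Longrightarrow> h z \<le> a" and a: "0 \<le> a"
    and M: "\<And>i. i \<in> {1..4} \<Longrightarrow> b i \<le> M * r i" "0 \<le> M"
  shows "(\<Sum>k. s ^ k * enn2real (occ U h False k)) \<le>
    (1 - p) * M / p * (\<Sum>k. s ^ k * enn2real (occ U h True k))"
proof -
  let ?\<kappa> = "(1 - p) * M / p"
  have \<kappa>: "0 \<le> ?\<kappa>" using p M by simp
  have nn: "0 \<le> (\<Sum>k. s ^ k * enn2real (occ U h c k))" for c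
    using s by (intro suminf_nonneg suminf_occ_real(1)[OF s h a] mult_nonneg_nonneg enn2real_nonneg zero_le_power) auto
  have eq: "(\<Sum>k. ennreal (s ^ k) * occ U h c k) = ennreal (\<Sum>k. s ^ k * enn2real (occ U h c k))" for c
    by (rule suminf_occ_real(2)[OF s h(1) _ a]) (rule h(2))
  have "(\<Sum>k. ennreal (s ^ k) * occ U h False k) \<le>
    (\<integral>\<^sup>+y. ennreal ?\<kappa> * (ennreal (h y) * (\<integral>\<^sup>+\<omega>. indicator {True} (\<omega> y) * ennreal (green U s y \<omega> 0) \<partial>C)) \<partial>count_space U)"
    unfolding suminf_occ[OF s]
  proof (rule nn_integral_mono)
    fix y assume "y \<in> space (count_space U)"
    then have "y \<in> U" by simp
    then have "(\<integral>\<^sup>+\<omega>. indicator {False} (\<omega> y) * ennreal (green U s y \<omega> 0) \<partial>C) \<le>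
      ennreal ?\<kappa> * (\<integral>\<^sup>+\<omega>. indicator {True} (\<omega> y) * ennreal (green U s y \<omega> 0) \<partial>C)"
      by (rule green_color_le[OF s]) (use M in auto)
    from mult_left_mono[OF this zero_le, of "ennreal (h y)"]
    show "ennreal (h y) * (\<integral>\<^sup>+\<omega>. indicator {False} (\<omega> y) * ennreal (green U s y \<omega> 0) \<partial>C) \<le>
      ennreal ?\<kappa> * (ennreal (h y) * (\<integral>\<^sup>+\<omega>. indicator {True} (\<omega> y) * ennreal (green U s y \<omega> 0) \<partial>C))"
      by (simp only: mult.left_commute)
  qed
  also have "\<dots> = ennreal ?\<kappa> * (\<Sum>k. ennreal (s ^ k) * occ U h True k)"
    unfolding suminf_occ[OF s] by (rule nn_integral_cmult) simp
  finally have "ennreal (\<Sum>k. s ^ k * enn2real (occ U h False k)) \<le>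
      ennreal (?\<kappa> * (\<Sum>k. s ^ k * enn2real (occ U h True k)))"
    unfolding eq ennreal_mult[OF \<kappa> nn] .
  then show ?thesis
    by (rule ennreal_le_iff[THEN iffD1, rotated]) (intro mult_nonneg_nonneg \<kappa> nn)
qed

end

section \<open>Drift and exit estimates\<close>

context two_vertex
begin

lemma kill_op_fun_upd: "y \<notin> U \<Longrightarrow> kill_op U (fun_upd \<omega> y c) = kill_op U \<omega>"
  by (intro ext) (auto simp: kill_op_def)

text \<open>
  A site visited for the first time is red with probability \<open>1 - p\<close>, since the walk has not yet
  used its color.
\<close>

lemma first_visit_red:
  "ennreal (1 - p) * emeasure path_law {X. \<forall>j<k. X j \<noteq> X k} \<le> occ UNIV (\<lambda>_. 1) False k"
proof -
  let ?F = "{X :: nat \<Rightarrow> int \<times> int. \<forall>j<k. X j \<noteq> X k}"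
  let ?K = "\<lambda>\<omega> y. ennreal ((kill_op (- {y}) \<omega> ^^ k) (indicator {y}) 0)"
  have V: "?F = {X. \<forall>j<k. X j \<in> - {X k}}" by auto
  have F: "?F \<in> sets path_space"
  proof (rule sets_prefix_event[of k], rule prefix_detI)
    fix X Y :: "nat \<Rightarrow> int \<times> int" assume *: "\<And>j. j \<le> k \<Longrightarrow> X j = Y j" "\<forall>j<k. X j \<noteq> X k"
    show "\<forall>j<k. Y j \<noteq> Y k" using * by (metis less_imp_le order_refl)
  qed
  have red: "(\<integral>\<^sup>+\<omega>. indicator {False} (\<omega> y) * ?K \<omega> y \<partial>C) = ennreal (1 - p) * (\<integral>\<^sup>+\<omega>. ?K \<omega> y \<partial>C)" for y
    using nn_integral_color_overwrite[OF _ _ measurable_kill_op_ennreal[of k "- {y}" "indicator {y}" 0],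
        where c = False and y = y] p
    by (simp add: kill_op_fun_upd)
  have "ennreal (1 - p) * emeasure path_law ?F = ennreal (1 - p) * (\<integral>\<^sup>+\<omega>. \<integral>\<^sup>+X. 1 * indicator ?F X \<partial>QL \<omega> \<partial>C)"
    using F by (simp add: emeasure_path_law sets_quenched_law)
  also have "(\<integral>\<^sup>+\<omega>. \<integral>\<^sup>+X. 1 * indicator ?F X \<partial>QL \<omega> \<partial>C) = (\<integral>\<^sup>+\<omega>. \<integral>\<^sup>+y. ?K \<omega> y \<partial>count_space UNIV \<partial>C)"
    unfolding V nn_integral_last_position[where g = "\<lambda>_. 1" and V = "\<lambda>y. - {y}"] by simp
  also have "\<dots> = (\<integral>\<^sup>+y. \<integral>\<^sup>+\<omega>. ?K \<omega> y \<partial>C \<partial>count_space UNIV)"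
    by (rule nn_integral_count_space_nn_integral[OF countableI_type measurable_kill_op_ennreal])
  also have "ennreal (1 - p) * \<dots> = (\<integral>\<^sup>+y. ennreal (1 - p) * (\<integral>\<^sup>+\<omega>. ?K \<omega> y \<partial>C) \<partial>count_space UNIV)"
    by (rule nn_integral_cmult[symmetric]) simp
  also have "\<dots> = (\<integral>\<^sup>+y. \<integral>\<^sup>+\<omega>. indicator {False} (\<omega> y) * ?K \<omega> y \<partial>C \<partial>count_space UNIV)"
    by (simp only: red)
  also have "\<dots> = (\<integral>\<^sup>+\<omega>. \<integral>\<^sup>+y. indicator {False} (\<omega> y) * ?K \<omega> y \<partial>count_space UNIV \<partial>C)"
    by (rule nn_integral_count_space_nn_integral[OF countableI_type, symmetric])
      (intro borel_measurable_times_ennreal measurable_color_indicator measurable_kill_op_ennreal)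
  also have "\<dots> = (\<integral>\<^sup>+\<omega>. \<integral>\<^sup>+X. indicator {False} (\<omega> (X k)) * indicator ?F X \<partial>QL \<omega> \<partial>C)"
    by (rule nn_integral_cong, unfold V,
        rule nn_integral_last_position[where g = "\<lambda>y. indicator {False} (\<omega> y)" and V = "\<lambda>y. - {y}" for \<omega>, symmetric])
  also have "\<dots> \<le> occ UNIV (\<lambda>_. 1) False k"
    unfolding occ_def
    by (intro nn_integral_mono) (auto simp: indicator_def)
  finally show ?thesis .
qed

text \<open>
  The annealed probability that the walk is at a red site at time \<open>k\<close>.
\<close>

definition red_prob :: "nat \<Rightarrow> real" where
  "red_prob k = enn2real (occ UNIV (\<lambda>_. 1) False k)"

lemma occ_UNIV:
  "occ UNIV (\<lambda>_. 1) False k = ennreal (red_prob k)"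
  "occ UNIV (\<lambda>_. 1) True k = ennreal (1 - red_prob k)"
  "0 \<le> red_prob k" "red_prob k \<le> 1"
proof -
  interpret prob_space path_law by (rule prob_space_path_law)
  have le: "occ UNIV (\<lambda>_. 1) c k \<le> 1" for c
    using occ_le[where h = "\<lambda>_. 1" and U = UNIV and a = 1 and c = c and k = k] by simp
  then have fin: "occ UNIV (\<lambda>_. 1) c k < \<top>" for c
    by (rule le_less_trans) simp
  show F: "occ UNIV (\<lambda>_. 1) False k = ennreal (red_prob k)"
    using fin[of False] by (simp add: red_prob_def ennreal_enn2real)
  show nn: "0 \<le> red_prob k" by (simp add: red_prob_def enn2real_nonneg)
  show le1: "red_prob k \<le> 1"
    using le[of False] unfolding F by simp
  have "occ UNIV (\<lambda>_. 1) True k + ennreal (red_prob k) = 1"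
    using occ_add[where h = "\<lambda>_. 1" and U = UNIV and k = k] emeasure_space_1 unfolding F by simp
  then have "ennreal (enn2real (occ UNIV (\<lambda>_. 1) True k)) + ennreal (red_prob k) = ennreal 1"
    using fin[of True] by (simp add: ennreal_enn2real)
  then have "enn2real (occ UNIV (\<lambda>_. 1) True k) + red_prob k = 1"
    using nn by (simp add: ennreal_plus[symmetric] enn2real_nonneg del: ennreal_plus ennreal_1)
  then show "occ UNIV (\<lambda>_. 1) True k = ennreal (1 - red_prob k)"
    using fin[of True] by (metis add_diff_cancel_right' ennreal_enn2real)
qed

lemma prob_step:
  assumes i: "i \<in> {1..4}"
  shows "measure path_law {X. X (Suc k) = X k + unit_vec i} = b i * (1 - red_prob k) + r i * red_prob k"
proof -
  interpret prob_space path_law by (rule prob_space_path_law)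
  let ?f = "\<lambda>z y. indicator {z + unit_vec i} y :: real"
  have sum: "(\<Sum>j = 1..4. q c j * ?f z (z + unit_vec j)) = q c i * 1" for c z
  proof -
    have "(\<Sum>j = 1..4. q c j * ?f z (z + unit_vec j)) = (\<Sum>j = 1..4. if j = i then q c j else 0)"
      using i unit_vec_inj by (intro sum.cong refl) (auto simp: indicator_def inj_on_def)
    then show ?thesis using i by simp
  qed
  have A: "{X. X (Suc k) = X k + unit_vec i} \<in> sets path_space"
    by (rule sets_prefix_event[of "Suc k"], rule prefix_detI) (metis order_refl le_SucI)
  have "(\<integral>\<^sup>+X. ennreal (?f (X k) (X (Suc k))) * indicator {X. \<forall>j\<le>k. X j \<in> UNIV} X \<partial>path_law) =
      (\<integral>\<^sup>+X. indicator {X. X (Suc k) = X k + unit_vec i} X \<partial>path_law)"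
    by (intro nn_integral_cong) (simp add: indicator_def)
  also have "\<dots> = emeasure path_law {X. X (Suc k) = X k + unit_vec i}"
    using A by (intro nn_integral_indicator) (simp add: sets_path_law)
  finally have "emeasure path_law {X. X (Suc k) = X k + unit_vec i} =
      ennreal (q True i) * ennreal (1 - red_prob k) + ennreal (q False i) * ennreal (red_prob k)"
    using annealed_step[where f = ?f and h = "\<lambda>_. 1" and \<rho> = "\<lambda>c. q c i" and k = k and U = UNIV]
      sum less_imp_le[OF q_pos[OF i]] by (simp add: occ_UNIV)
  also have "\<dots> = ennreal (b i * (1 - red_prob k) + r i * red_prob k)"
    using occ_UNIV(3,4)[of k] b(1)[OF i] r(1)[OF i] less_imp_le
    by (simp add: q_def ennreal_mult ennreal_plus)
  finally have eq: "emeasure path_law {X. X (Suc k) = X k + unit_vec i} = \<dots>" .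
  show ?thesis
    unfolding measure_def eq using occ_UNIV(3,4)[of k] b(1)[OF i] r(1)[OF i]
    by (intro enn2real_ennreal add_nonneg_nonneg mult_nonneg_nonneg) auto
qed

lemma measurable_level: "(\<lambda>X. real_of_int (fst (X n))) \<in> borel_measurable path_law"
proof (rule measurable_prefix_fun[of n, OF _ _ sets_path_law])
  fix X Y :: "nat \<Rightarrow> int \<times> int" assume *: "\<And>j. j \<le> n \<Longrightarrow> X j = Y j"
  show "real_of_int (fst (X n)) = real_of_int (fst (Y n))" using *[of n] by simp
qed simp

lemma level_diff_le:
  fixes X :: "nat \<Rightarrow> int \<times> int"
  assumes "\<forall>n. \<exists>i\<in>{1..4}. X (Suc n) = X n + unit_vec i"
  shows "\<bar>fst (X (n + m)) - fst (X n)\<bar> \<le> int m"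
proof (induction m)
  case (Suc m)
  obtain i where "X (Suc (n + m)) = X (n + m) + unit_vec i" using assms by blast
  then have "\<bar>fst (X (Suc (n + m))) - fst (X (n + m))\<bar> \<le> 1"
    by (auto simp: unit_vec_def)
  then show ?case using Suc by simp
qed simp

lemma integrable_level: "integrable path_law (\<lambda>X. real_of_int (fst (X n)))"
proof -
  interpret prob_space path_law by (rule prob_space_path_law)
  have "AE X in path_law. norm (real_of_int (fst (X n))) \<le> real n"
    using AE_nearest_neighbour
  proof eventually_elim
    case (elim X)
    then have "\<bar>fst (X (0 + n)) - fst (X 0)\<bar> \<le> int n" by (intro level_diff_le) blast
    then show ?case using elim by simp
  qed
  then show ?thesis by (rule integrable_const_bound[OF _ measurable_level])
qed

text \<open>
  The annealed mean of the first coordinate at time \<open>n\<close>.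
\<close>

definition mean_level :: "nat \<Rightarrow> real" where
  "mean_level n = (\<integral>X. real_of_int (fst (X n)) \<partial>path_law)"

lemma mean_level_0: "mean_level 0 = 0"
proof -
  have "mean_level 0 = (\<integral>X. 0 \<partial>path_law)"
    unfolding mean_level_def
    by (intro integral_cong_AE measurable_level borel_measurable_const
        eventually_mono[OF AE_nearest_neighbour]) simp
  then show ?thesis by simp
qed

lemma mean_level_Suc:
  "mean_level (Suc k) - mean_level k = (b 1 - b 3) - ((b 1 - b 3) + (r 3 - r 1)) * red_prob k"
proof -
  interpret prob_space path_law by (rule prob_space_path_law)
  let ?A = "\<lambda>i. {X. X (Suc k) = X k + unit_vec i}"
  have A: "?A i \<in> sets path_law" for i
    unfolding sets_path_law
    by (rule sets_prefix_event[of "Suc k"], rule prefix_detI) (metis order_refl le_SucI)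
  have "mean_level (Suc k) - mean_level k =
      (\<integral>X. real_of_int (fst (X (Suc k))) - real_of_int (fst (X k)) \<partial>path_law)"
    unfolding mean_level_def by (intro Bochner_Integration.integral_diff[symmetric] integrable_level)
  also have "\<dots> = (\<integral>X. indicator (?A 1) X - indicator (?A 3) X \<partial>path_law)"
  proof (rule integral_cong_AE)
    show "AE X in path_law. real_of_int (fst (X (Suc k))) - real_of_int (fst (X k)) =
        indicator (?A 1) X - indicator (?A 3) X"
      using AE_nearest_neighbour
    proof eventually_elim
      case (elim X)
      then obtain i where i: "i \<in> {1..4}" "X (Suc k) = X k + unit_vec i" by blast
      then have "i = 1 \<or> i = 2 \<or> i = 3 \<or> i = 4" by auto
      then show ?case using i(2) by (auto simp: unit_vec_def indicator_def)
    qed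
  qed (use A in \<open>auto intro!: borel_measurable_diff measurable_level\<close>)
  also have "\<dots> = measure path_law (?A 1) - measure path_law (?A 3)"
    using A by (subst Bochner_Integration.integral_diff) (auto intro!: integrable_real_indicator simp: emeasure_eq_measure)
  also have "\<dots> = (b 1 - b 3) - ((b 1 - b 3) + (r 3 - r 1)) * red_prob k"
    by (simp add: prob_step algebra_simps)
  finally show ?thesis .
qed

end

text \<open>
  An exit estimate from discounted sums. Here \<open>B k\<close> and \<open>R k\<close> are the expected weights of a
  killed walk at blue and red sites at time \<open>k\<close>, a step multiplies the weight on average by at
  most \<open>x\<close> and \<open>y\<close> respectively, and \<open>E k\<close> is the probability of being killed in step \<open>k\<close>, at
  weight at least \<open>a\<close>. The comparison of the discounted sums of \<open>R\<close> and \<open>B\<close> makes the total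
  weight nonincreasing on average, so that the weight killed is at most the initial weight; the
  discount is removed in the limit \<open>s \<rightarrow> 1\<close>.
\<close>

lemma discounted_supermartingale:
  fixes B R E :: "nat \<Rightarrow> real"
  assumes nn: "\<And>k. 0 \<le> B k" "\<And>k. 0 \<le> R k" "\<And>k. 0 \<le> E k"
    and bdd: "\<And>k. B k \<le> c" "\<And>k. R k \<le> c" "\<And>k. E k \<le> 1"
    and init: "B 0 + R 0 \<le> 1"
    and step: "\<And>k. B (Suc k) + R (Suc k) + a * E k \<le> x * B k + y * R k"
    and kal: "\<And>s. 0 < s \<Longrightarrow> s < 1 \<Longrightarrow> (\<Sum>k. s ^ k * R k) \<le> \<kappa> * (\<Sum>k. s ^ k * B k)"
    and xy: "1 \<le> y" "(y - 1) * \<kappa> \<le> 1 - x" and a: "0 \<le> a"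
  shows "a * (\<Sum>k<N. E k) \<le> 1"
proof -
  have *: "a * (\<Sum>k<N. s ^ k * E k) \<le> 1" if s: "0 < s" "s < 1" for s
  proof -
    have sm: "summable (\<lambda>k. s ^ k * f k)" if "\<And>k. 0 \<le> f k" "\<And>k. f k \<le> d" for f :: "nat \<Rightarrow> real" and d
      by (rule summable_comparison_test'[of "\<lambda>k. d * s ^ k" 0])
         (use s that in \<open>auto simp: abs_mult mult.commute intro!: mult_right_mono\<close>)
    note sB = sm[OF nn(1) bdd(1)] and sR = sm[OF nn(2) bdd(2)] and sE = sm[OF nn(3) bdd(3)]
    let ?B = "\<Sum>k. s ^ k * B k" and ?R = "\<Sum>k. s ^ k * R k" and ?E = "\<Sum>k. s ^ k * E k"
    define W where "W = (\<Sum>k. s ^ k * (B (Suc k) + R (Suc k)))"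
    have sW: "summable (\<lambda>k. s ^ k * (B (Suc k) + R (Suc k)))"
      by (rule sm[of _ "c + c"]) (intro add_nonneg_nonneg nn, intro add_mono bdd)
    have W0: "0 \<le> W" unfolding W_def using nn s by (intro suminf_nonneg[OF sW]) simp
    have "?B + ?R = (\<Sum>k. s ^ k * (B k + R k))"
      using suminf_add[OF sB sR] by (simp add: distrib_left)
    also have "\<dots> = (B 0 + R 0) + s * W"
    proof -
      have "summable (\<lambda>k. s ^ k * (B k + R k))"
        using summable_add[OF sB sR] by (simp add: distrib_left)
      from suminf_split_head[OF this] have "(\<Sum>k. s ^ k * (B k + R k)) =
          (B 0 + R 0) + (\<Sum>k. s ^ Suc k * (B (Suc k) + R (Suc k)))" by simp
      also have "(\<Sum>k. s ^ Suc k * (B (Suc k) + R (Suc k))) = s * W"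
        unfolding W_def using suminf_mult[OF sW, of s] by (simp add: mult.assoc)
      finally show ?thesis .
    qed
    also have "\<dots> \<le> 1 + W"
      using init W0 s mult_left_le_one_le[of W s] by linarith
    finally have BR: "?B + ?R \<le> 1 + W" .
    have "W + a * ?E \<le> x * ?B + y * ?R"
    proof -
      have "W + a * ?E = (\<Sum>k. s ^ k * (B (Suc k) + R (Suc k)) + a * (s ^ k * E k))"
        unfolding W_def using suminf_add[OF sW summable_mult[OF sE, of a]] suminf_mult[OF sE, of a] by simp
      also have "\<dots> \<le> (\<Sum>k. x * (s ^ k * B k) + y * (s ^ k * R k))"
      proof (rule suminf_le)
        fix k
        have "s ^ k * (B (Suc k) + R (Suc k) + a * E k) \<le> s ^ k * (x * B k + y * R k)"
          using s by (intro mult_left_mono step) simp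
        then show "s ^ k * (B (Suc k) + R (Suc k)) + a * (s ^ k * E k) \<le> x * (s ^ k * B k) + y * (s ^ k * R k)"
          by (simp add: algebra_simps)
      qed (intro summable_add sW summable_mult sE sB sR)+
      also have "\<dots> = x * ?B + y * ?R"
        using suminf_add[OF summable_mult[OF sB, of x] summable_mult[OF sR, of y]]
          suminf_mult[OF sB, of x] suminf_mult[OF sR, of y] by simp
      finally show ?thesis .
    qed
    moreover have "(y - 1) * ?R \<le> (1 - x) * ?B"
    proof -
      have "(y - 1) * ?R \<le> (y - 1) * (\<kappa> * ?B)" using xy by (intro mult_left_mono kal s) simp
      also have "\<dots> = ((y - 1) * \<kappa>) * ?B" by simp
      also have "\<dots> \<le> (1 - x) * ?B"
        using xy nn s by (intro mult_right_mono suminf_nonneg sB) simp_all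
      finally show ?thesis .
    qed
    ultimately have "a * ?E \<le> 1" using BR by (simp add: algebra_simps)
    moreover have "a * (\<Sum>k<N. s ^ k * E k) \<le> a * ?E"
      using a nn s by (intro mult_left_mono sum_le_suminf sE) auto
    ultimately show ?thesis by linarith
  qed
  have "((\<lambda>s. a * (\<Sum>k<N. s ^ k * E k)) \<longlongrightarrow> a * (\<Sum>k<N. 1 ^ k * E k)) (at_left 1)"
    by (intro tendsto_intros)
  moreover have "\<forall>\<^sub>F s in at_left (1::real). a * (\<Sum>k<N. s ^ k * E k) \<le> 1"
    using eventually_at_left_real[of 0 "1::real"] by (auto elim!: eventually_mono intro!: *)
  ultimately have "a * (\<Sum>k<N. 1 ^ k * E k) \<le> 1"
    by (rule tendsto_upperbound) simp
  then show ?thesis by simp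
qed

text \<open>
  The drift assumption, with any bound \<open>M\<close> on the ratios of the jump probabilities.
\<close>

locale kalikow_drift = two_vertex +
  fixes M :: real
  assumes ratio_le: "\<And>i. i \<in> {1..4} \<Longrightarrow> b i \<le> M * r i"
    and drift: "b 3 < b 1" "r 1 < r 3"
    and strong: "(1 - p) * M * (r 3 - r 1) < p * (b 1 - b 3)"
begin

lemma M_pos: "0 < M"
proof -
  have "0 < M * r 1" using ratio_le[of 1] b(1)[of 1] by simp
  then show ?thesis using r(1)[of 1] by (simp add: zero_less_mult_iff)
qed

text \<open>
  The lower bound for the speed.
\<close>

definition min_speed :: real where
  "min_speed = (p * (b 1 - b 3) - (1 - p) * M * (r 3 - r 1)) / (p + (1 - p) * M)"

lemma min_speed_pos: "0 < min_speed"
  unfolding min_speed_def using strong p M_pos by (intro divide_pos_pos add_pos_pos mult_pos_pos) auto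

lemma discounted_red:
  assumes s: "0 < s" "s < 1"
  shows "summable (\<lambda>k. s ^ k * red_prob k)"
    "(\<Sum>k. s ^ k * red_prob k) \<le> ((1 - p) * M / (p + (1 - p) * M)) / (1 - s)"
proof -
  have h: "enn2real (occ UNIV (\<lambda>_. 1) True k) = 1 - red_prob k" for k
    using occ_UNIV(2,4)[of k] by simp
  have h': "enn2real (occ UNIV (\<lambda>_. 1) False k) = red_prob k" for k
    by (simp add: red_prob_def)
  show sm: "summable (\<lambda>k. s ^ k * red_prob k)"
    using suminf_occ_real(1)[OF s, where h = "\<lambda>_. 1" and U = UNIV and a = 1 and c = False] by (simp add: h')
  let ?R = "\<Sum>k. s ^ k * red_prob k"
  have "?R \<le> (1 - p) * M / p * (\<Sum>k. s ^ k * (1 - red_prob k))"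
    using occ_red_le[OF s, where h = "\<lambda>_. 1" and U = UNIV and a = 1 and M = M] ratio_le M_pos by (simp add: h h')
  also have "(\<Sum>k. s ^ k * (1 - red_prob k)) = 1 / (1 - s) - ?R"
    using suminf_diff[OF summable_geometric sm] s by (simp add: right_diff_distrib suminf_geometric)
  finally have "p * ?R \<le> (1 - p) * M * (1 / (1 - s) - ?R)"
    using p by (simp add: field_simps)
  then have "(p + (1 - p) * M) * ?R \<le> (1 - p) * M / (1 - s)"
    by (simp add: algebra_simps)
  moreover have "0 < p + (1 - p) * M" using p M_pos by (intro add_pos_pos mult_pos_pos) auto
  ultimately show "?R \<le> ((1 - p) * M / (p + (1 - p) * M)) / (1 - s)"
    by (subst divide_divide_eq_left, subst mult.commute, subst divide_divide_eq_left[symmetric])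
       (simp only: pos_le_divide_eq mult.commute)
qed

lemma discounted_drift:
  assumes s: "0 < s" "s < 1"
  shows "summable (\<lambda>k. s ^ k * (mean_level (Suc k) - mean_level k))"
    "min_speed / (1 - s) \<le> (\<Sum>k. s ^ k * (mean_level (Suc k) - mean_level k))"
proof -
  let ?d = "b 1 - b 3" and ?e = "r 3 - r 1"
  have eq: "s ^ k * (mean_level (Suc k) - mean_level k) = ?d * s ^ k - (?d + ?e) * (s ^ k * red_prob k)" for k
    unfolding mean_level_Suc by (simp add: algebra_simps)
  have sm: "summable (\<lambda>k. ?d * s ^ k)" "summable (\<lambda>k. (?d + ?e) * (s ^ k * red_prob k))"
    using s discounted_red(1)[OF s] by (intro summable_mult summable_geometric; simp)+
  show "summable (\<lambda>k. s ^ k * (mean_level (Suc k) - mean_level k))"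
    unfolding eq by (rule summable_diff[OF sm])
  have pos: "0 < p + (1 - p) * M" using p M_pos by (intro add_pos_pos mult_pos_pos) auto
  have "min_speed / (1 - s) = ?d / (1 - s) - (?d + ?e) * (((1 - p) * M / (p + (1 - p) * M)) / (1 - s))"
  proof -
    have "min_speed = ?d - (?d + ?e) * ((1 - p) * M / (p + (1 - p) * M))"
      unfolding min_speed_def using pos by (simp add: field_simps)
    then show ?thesis by (simp add: diff_divide_distrib)
  qed
  also have "\<dots> \<le> ?d / (1 - s) - (?d + ?e) * (\<Sum>k. s ^ k * red_prob k)"
    using drift by (intro diff_left_mono mult_left_mono discounted_red(2)[OF s]) auto
  also have "\<dots> = (\<Sum>k. ?d * s ^ k - (?d + ?e) * (s ^ k * red_prob k))"
    using suminf_diff[OF sm] suminf_mult[OF summable_geometric, of s ?d]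
      suminf_mult[OF discounted_red(1)[OF s], of "?d + ?e"] s by (simp add: suminf_geometric)
  finally show "min_speed / (1 - s) \<le> (\<Sum>k. s ^ k * (mean_level (Suc k) - mean_level k))"
    unfolding eq .
qed

text \<open>A step from a site of color \<open>c\<close> multiplies \<open>exp (- l * fst z)\<close> by this factor on average.\<close>

definition exp_step :: "real \<Rightarrow> bool \<Rightarrow> real" where
  "exp_step l c = q c 1 * exp (- l) + q c 2 + q c 3 * exp l + q c 4"

text \<open>
  The expression vanishes at \<open>l = 0\<close> and has a negative derivative there, by the drift assumption.
\<close>

lemma ex_exp_rate:
  "\<exists>l>0. p * (exp_step l True - 1) + (1 - p) * M * (exp_step l False - 1) < 0"
proof -
  let ?g = "\<lambda>l. p * (exp_step l True - 1) + (1 - p) * M * (exp_step l False - 1)"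
  have s4: "q c 1 + q c 2 + q c 3 + q c 4 = 1" for c
    using q_sum[of c, unfolded atLeastAtMost_1_4] by simp
  have g0: "?g 0 = 0" using s4 by (simp add: exp_step_def)
  have "(?g has_real_derivative (p * (q True 3 - q True 1) + (1 - p) * M * (q False 3 - q False 1))) (at 0)"
    unfolding exp_step_def by (auto intro!: derivative_eq_intros simp: algebra_simps)
  moreover have "p * (q True 3 - q True 1) + (1 - p) * M * (q False 3 - q False 1) < 0"
    using strong by (simp add: q_def algebra_simps)
  ultimately obtain d where "d > 0" "\<And>h. 0 < h \<Longrightarrow> h < d \<Longrightarrow> ?g h < ?g 0"
    using has_real_derivative_neg_dec_right[of ?g _ 0 UNIV] by auto
  then show ?thesis using g0 by (intro exI[of _ "d / 2"]) auto
qed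

lemma exp_step_red:
  assumes "0 \<le> l" shows "1 \<le> exp_step l False"
proof -
  have s4: "r 1 + r 2 + r 3 + r 4 = 1" using r(2)[unfolded atLeastAtMost_1_4] by simp
  have e: "0 \<le> 1 - exp (- l)" using assms by simp
  have "1 - exp (- l) \<le> exp l - 1"
    using exp_ge_add_one_self[of l] exp_ge_add_one_self[of "- l"] by linarith
  then have "r 3 * (1 - exp (- l)) \<le> r 3 * (exp l - 1)" using r(1)[of 3] by (intro mult_left_mono) auto
  moreover have "r 1 * (1 - exp (- l)) \<le> r 3 * (1 - exp (- l))" using drift e by (intro mult_right_mono) auto
  ultimately have "0 \<le> r 1 * (exp (- l) - 1) + r 3 * (exp l - 1)" by (simp add: algebra_simps)
  then show ?thesis using s4 by (simp add: exp_step_def q_def algebra_simps)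
qed

lemma exit_left_half_space:
  assumes l: "0 < l" and neg: "p * (exp_step l True - 1) + (1 - p) * M * (exp_step l False - 1) < 0"
    and m: "0 < m"
  shows "emeasure path_law {X. \<exists>k. fst (X k) \<le> - m} \<le> ennreal (exp (- l * real_of_int m))"
proof -
  interpret prob_space path_law by (rule prob_space_path_law)
  define U :: "(int \<times> int) set" where "U = {z. fst z > - m}"
  define h :: "int \<times> int \<Rightarrow> real" where "h z = exp (- l * real_of_int (fst z))" for z
  define a where "a = exp (l * real_of_int m)"
  define B where "B k = enn2real (occ U h True k)" for k
  define R where "R k = enn2real (occ U h False k)" for k
  define A where "A k = {X. (\<forall>j\<le>k. X j \<in> U) \<and> X (Suc k) \<notin> U}" for k
  have h0: "0 \<le> h z" for z by (simp add: h_def)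
  have hU: "h z \<le> a" if "z \<in> U" for z
  proof -
    have "- real_of_int (fst z) \<le> real_of_int m" using that unfolding U_def by simp
    then have "l * - real_of_int (fst z) \<le> l * real_of_int m" using l by (intro mult_left_mono) auto
    then show ?thesis unfolding h_def a_def by simp
  qed
  have hnU: "a \<le> h z" if "z \<notin> U" for z
  proof -
    have "real_of_int m \<le> - real_of_int (fst z)" using that unfolding U_def by simp
    then have "l * real_of_int m \<le> l * - real_of_int (fst z)" using l by (intro mult_left_mono) auto
    then show ?thesis unfolding h_def a_def by simp
  qed
  have a0: "0 \<le> a" by (simp add: a_def)
  have occ: "occ U h c k \<le> ennreal a" for c k by (rule occ_le[OF h0 _ a0]) (rule hU)
  have occ_fin: "occ U h c k < \<top>" for c k by (rule le_less_trans[OF occ ennreal_less_top])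
  have occ_B: "occ U h True k = ennreal (B k)" and occ_R: "occ U h False k = ennreal (R k)" for k
    using occ_fin by (simp_all add: B_def R_def ennreal_enn2real)
  have nn: "0 \<le> B k" "0 \<le> R k" for k by (simp_all add: B_def R_def enn2real_nonneg)
  have BR_le: "B k \<le> a" "R k \<le> a" for k
    unfolding B_def R_def using occ a0 by (auto intro!: enn2real_leI)
  have A: "A k \<in> sets path_law" for k
    unfolding A_def sets_path_law
    by (rule sets_prefix_event[of "Suc k"], rule prefix_detI) (metis order_refl le_SucI)
  have sub: "ennreal (h (X (Suc k))) * indicator {X. \<forall>j\<le>Suc k. X j \<in> U} X + ennreal a * indicator (A k) X
      \<le> ennreal (h (X (Suc k))) * indicator {X. \<forall>j\<le>k. X j \<in> U} X" for X k
    using hnU[of "X (Suc k)"] by (auto simp: A_def indicator_def le_Suc_eq intro: ennreal_leI)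
  have mS: "(\<lambda>X. ennreal (h (X k)) * indicator {X. \<forall>j\<le>k. X j \<in> U} X) \<in> borel_measurable path_law" for k
  proof (rule measurable_prefix_fun[of k, OF _ _ sets_path_law])
    fix X Y :: "nat \<Rightarrow> int \<times> int" assume "\<And>j. j \<le> k \<Longrightarrow> X j = Y j"
    then have "X k = Y k" "(\<forall>j\<le>k. X j \<in> U) = (\<forall>j\<le>k. Y j \<in> U)" by auto
    then show "ennreal (h (X k)) * indicator {X. \<forall>j\<le>k. X j \<in> U} X =
        ennreal (h (Y k)) * indicator {X. \<forall>j\<le>k. X j \<in> U} Y" by (simp add: indicator_def)
  qed simp
  have step_sum: "(\<Sum>i = 1..4. q c i * h (z + unit_vec i)) = exp_step l c * h z" for c z
  proof -
    have "h (z + unit_vec 1) = h z * exp (- l)" "h (z + unit_vec 2) = h z"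
      "h (z + unit_vec 3) = h z * exp l" "h (z + unit_vec 4) = h z"
      by (simp_all add: h_def unit_vec_def exp_add[symmetric] algebra_simps)
    then show ?thesis unfolding atLeastAtMost_1_4 exp_step_def by (simp add: algebra_simps)
  qed
  have exp_step_nn: "0 \<le> exp_step l c" for c
    unfolding exp_step_def using q_pos[of _ c]
    by (intro add_nonneg_nonneg mult_nonneg_nonneg) (auto intro: less_imp_le)
  have step: "B (Suc k) + R (Suc k) + a * prob (A k) \<le> exp_step l True * B k + exp_step l False * R k" for k
  proof -
    have "ennreal (B (Suc k) + R (Suc k) + a * prob (A k)) =
        (occ U h True (Suc k) + occ U h False (Suc k)) + ennreal a * emeasure path_law (A k)"
      using nn a0 by (simp add: occ_B occ_R emeasure_eq_measure ennreal_mult)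
    also have "\<dots> = (\<integral>\<^sup>+X. ennreal (h (X (Suc k))) * indicator {X. \<forall>j\<le>Suc k. X j \<in> U} X +
        ennreal a * indicator (A k) X \<partial>path_law)"
      using A by (subst nn_integral_add[OF mS]) (simp_all add: occ_add[OF h0] nn_integral_cmult_indicator)
    also have "\<dots> \<le> (\<integral>\<^sup>+X. ennreal (h (X (Suc k))) * indicator {X. \<forall>j\<le>k. X j \<in> U} X \<partial>path_law)"
      by (intro nn_integral_mono sub)
    also have "\<dots> = ennreal (exp_step l True) * occ U h True k + ennreal (exp_step l False) * occ U h False k"
      by (rule annealed_step[where f = "\<lambda>_ y. h y"]) (simp_all only: h0 exp_step_nn step_sum)
    also have "\<dots> = ennreal (exp_step l True * B k + exp_step l False * R k)"
      using nn exp_step_nn by (simp add: occ_B occ_R ennreal_mult)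
    finally show ?thesis
      by (rule ennreal_le_iff[THEN iffD1, rotated]) (intro add_nonneg_nonneg mult_nonneg_nonneg nn exp_step_nn)
  qed
  have init: "B 0 + R 0 \<le> 1"
  proof -
    have "ennreal (B 0 + R 0) = (\<integral>\<^sup>+X. ennreal (h (X 0)) * indicator {X. \<forall>j\<le>0. X j \<in> U} X \<partial>path_law)"
      using occ_add[where h = h and U = U and k = 0, OF h0] nn by (simp add: occ_B occ_R)
    also have "\<dots> \<le> (\<integral>\<^sup>+X. 1 \<partial>path_law)"
      by (intro nn_integral_mono_AE eventually_mono[OF AE_nearest_neighbour]) (auto simp: h_def indicator_def)
    also have "\<dots> = ennreal 1" using emeasure_space_1 by simp
    finally show ?thesis by (subst (asm) ennreal_le_iff) auto
  qed
  have bound: "a * (\<Sum>k<N. prob (A k)) \<le> 1" for N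
  proof (rule discounted_supermartingale[OF nn measure_nonneg BR_le prob_le_1 init step])
    show "(\<Sum>k. s ^ k * R k) \<le> (1 - p) * M / p * (\<Sum>k. s ^ k * B k)" if "0 < s" "s < 1" for s
      unfolding B_def R_def using occ_red_le[OF that h0 hU a0 ratio_le] M_pos by simp
    show "1 \<le> exp_step l False" using l by (intro exp_step_red) simp
    show "(exp_step l False - 1) * ((1 - p) * M / p) \<le> 1 - exp_step l True"
      using neg p by (simp add: field_simps)
  qed (rule a0)
  have "emeasure path_law {X. \<exists>k. fst (X k) \<le> - m} \<le> emeasure path_law (\<Union>k. A k)"
  proof (rule emeasure_mono_AE)
    show "AE X in path_law. X \<in> {X. \<exists>k. fst (X k) \<le> - m} \<longrightarrow> X \<in> (\<Union>k. A k)"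
      using AE_nearest_neighbour
    proof eventually_elim
      case (elim X)
      show ?case
      proof
        assume "X \<in> {X. \<exists>k. fst (X k) \<le> - m}"
        then obtain i where "fst (X i) \<le> - m" by blast
        then have "X i \<notin> U" by (simp add: U_def)
        then have ex: "\<exists>k. X k \<notin> U" by blast
        define k where "k = (LEAST k. X k \<notin> U)"
        have k: "X k \<notin> U" using ex unfolding k_def by (rule LeastI_ex)
        have *: "X j \<in> U" if "j < k" for j using not_less_Least[of j "\<lambda>k. X k \<notin> U"] that unfolding k_def by blast
        have "X 0 \<in> U" using elim m by (simp add: U_def)
        then have "k \<noteq> 0" using k by metis
        then obtain j where "k = Suc j" by (cases k) auto
        then have "X \<in> A j" using k * unfolding A_def by auto
        then show "X \<in> (\<Union>k. A k)" by blast
      qed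
    qed
  qed (use A in auto)
  also have "\<dots> = (\<Sum>k. emeasure path_law (A k))"
  proof (rule suminf_emeasure[symmetric])
    have "A i \<inter> A j = {}" if "i < j" for i j
    proof -
      have "Suc i \<le> j" using that by simp
      then show ?thesis unfolding A_def by blast
    qed
    then show "disjoint_family A" unfolding disjoint_family_on_def by (metis Int_commute linorder_neqE_nat)
  qed (use A in auto)
  also have "\<dots> \<le> ennreal (1 / a)"
    unfolding suminf_eq_SUP
  proof (rule SUP_least)
    fix N
    have "(\<Sum>k<N. emeasure path_law (A k)) = ennreal (\<Sum>k<N. prob (A k))"
      by (simp add: emeasure_eq_measure sum_ennreal)
    also have "\<dots> \<le> ennreal (1 / a)"
    proof (rule ennreal_leI)
      have "0 < a" by (simp add: a_def)
      then show "(\<Sum>k<N. prob (A k)) \<le> 1 / a" using bound[of N] by (simp add: pos_le_divide_eq mult.commute)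
    qed
    finally show "(\<Sum>k<N. emeasure path_law (A k)) \<le> ennreal (1 / a)" .
  qed
  also have "1 / a = exp (- l * real_of_int m)" by (simp add: a_def exp_minus field_simps)
  finally show ?thesis .
qed

end

section \<open>Regeneration\<close>

text \<open>
  The paths that never fall below their initial level.
\<close>

definition stay_right :: "(nat \<Rightarrow> int \<times> int) set" where
  "stay_right = {X. \<forall>n. fst (X 0) \<le> fst (X n)}"

text \<open>
  The level at time \<open>n\<close> strictly exceeds all earlier ones; time \<open>0\<close> is a record.
\<close>

definition is_record :: "nat \<Rightarrow> (nat \<Rightarrow> int \<times> int) \<Rightarrow> bool" where
  "is_record n X \<longleftrightarrow> (\<forall>j<n. fst (X j) < fst (X n))"

text \<open>
  A regeneration time is a record time after which the path never falls below the level reached.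
\<close>

definition regen :: "nat \<Rightarrow> (nat \<Rightarrow> int \<times> int) \<Rightarrow> bool" where
  "regen n X \<longleftrightarrow> is_record n X \<and> (\<forall>m\<ge>n. fst (X n) \<le> fst (X m))"

lemma shift_shift: "shift m (shift n X) = shift (n + m) X"
  by (simp add: shift_def add.assoc)

lemma shift_0: "X 0 = 0 \<Longrightarrow> shift 0 X = X"
  by (simp add: shift_def)

lemma shift_stay_right: "shift n X \<in> stay_right \<longleftrightarrow> (\<forall>m\<ge>n. fst (X n) \<le> fst (X m))"
  unfolding stay_right_def shift_def by (auto simp: le_iff_add)

lemma regen_iff: "regen n X \<longleftrightarrow> is_record n X \<and> shift n X \<in> stay_right"
  by (simp add: regen_def shift_stay_right)

lemma regen_0: "regen 0 X \<longleftrightarrow> X \<in> stay_right"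
  by (simp add: regen_def is_record_def stay_right_def)

lemma regen_shift:
  assumes "regen n X" shows "regen m (shift n X) \<longleftrightarrow> regen (n + m) X"
proof -
  have "is_record m (shift n X) \<longleftrightarrow> is_record (n + m) X"
  proof (cases "m = 0")
    case False
    show ?thesis
    proof
      assume r: "is_record m (shift n X)"
      have "fst (X j) < fst (X (n + m))" if "j < n + m" for j
      proof (cases "j < n")
        case True
        then have "fst (X j) < fst (X n)" using assms by (simp add: regen_def is_record_def)
        also have "\<dots> \<le> fst (X (n + m))" using assms by (simp add: regen_def)
        finally show ?thesis .
      next
        case False
        then obtain i where "j = n + i" by (auto simp: not_less le_iff_add)
        then show ?thesis using r that by (simp add: is_record_def shift_def)
      qed
      then show "is_record (n + m) X" by (simp add: is_record_def)
    qed (simp add: is_record_def shift_def)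
  qed (use assms in \<open>simp add: regen_def is_record_def\<close>)
  then show ?thesis by (simp add: regen_iff shift_shift)
qed

lemma prefix_det_is_record: "prefix_det n (is_record n)"
  unfolding prefix_det_def is_record_def by (metis less_imp_le order_refl)

lemma sets_stay_right: "stay_right \<in> sets path_space"
proof -
  have "{X. fst (X 0) \<le> fst (X n)} \<in> sets path_space" for n
    by (rule sets_prefix_event[of n], rule prefix_detI) (metis order_refl le0)
  then have "(\<Inter>n. {X. fst (X 0) \<le> fst (X n)}) \<in> sets path_space"
    by (intro sets.countable_INT'') (auto simp: UNIV_in_path_space)
  also have "(\<Inter>n. {X. fst (X 0) \<le> fst (X n)}) = stay_right" by (auto simp: stay_right_def)
  finally show ?thesis .
qed

lemma sets_shift_vimage: "A \<in> sets path_space \<Longrightarrow> shift n -` A \<in> sets path_space"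
  using measurable_sets[OF measurable_shift, of A n] by (simp add: space_PiM)

lemma sets_regen: "{X. regen n X} \<in> sets path_space"
proof -
  have "{X. regen n X} = {X. is_record n X} \<inter> shift n -` stay_right" by (auto simp: regen_iff)
  then show ?thesis
    using sets.Int[OF sets_prefix_event[OF prefix_det_is_record] sets_shift_vimage[OF sets_stay_right]] by simp
qed

context two_vertex
begin

text \<open>The law of a walk that stays in the right half-space depends only on the colors there.\<close>

lemma quenched_stay_right_cong:
  assumes eq: "\<And>z. 0 \<le> fst z \<Longrightarrow> \<omega> z = \<omega>' z" and B: "B \<in> sets path_space"
  shows "emeasure (QL \<omega>) (stay_right \<inter> B) = emeasure (QL \<omega>') (stay_right \<inter> B)"
proof -
  interpret QL: prob_space "QL w" for w by (rule prob_space_quenched_law)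
  define S where "S m y k = {X. (\<forall>j\<le>m + k. fst (X 0) \<le> fst (X j)) \<and> (\<forall>j\<le>m. X j = y j)}"
    for m k :: nat and y :: "nat \<Rightarrow> int \<times> int"
  have det: "prefix_det (m + k) (\<lambda>X. (\<forall>j\<le>m + k. fst (X 0) \<le> fst (X j)) \<and> (\<forall>j\<le>m. X j = y j))"
    for m k and y :: "nat \<Rightarrow> int \<times> int"
    by (rule prefix_detI) (metis le0 trans_le_add1)
  have sets_S: "S m y k \<in> sets path_space" for m y k
    unfolding S_def by (rule sets_prefix_event[OF det])
  have S_eq: "emeasure (QL \<omega>) (S m y k) = emeasure (QL \<omega>') (S m y k)" for m y k
  proof -
    have "emeasure (QL \<omega>) (cyl (m + k) (nth a) \<inter> UNIV) = emeasure (QL \<omega>') (cyl (m + k) (nth a) \<inter> UNIV)"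
      if "\<forall>j\<le>m + k. fst (a ! 0) \<le> fst (a ! j)" for a
    proof (cases "a ! 0 = 0")
      case True
      then have "\<omega> (a ! j) = \<omega>' (a ! j)" if "j \<le> m + k" for j
        using that \<open>\<forall>j\<le>m + k. fst (a ! 0) \<le> fst (a ! j)\<close> by (intro eq) simp
      then show ?thesis by (simp add: emeasure_QL_cyl)
    qed (simp add: emeasure_QL_cyl)
    then have "emeasure (QL \<omega>) (S m y k \<inter> UNIV) = emeasure (QL \<omega>') (S m y k \<inter> UNIV)"
      unfolding S_def emeasure_prefix_event[OF det sets_quenched_law UNIV_in_path_space]
      by (intro nn_integral_cong) auto
    then show ?thesis by simp
  qed
  have S_INT: "(\<Inter>k. S m y k) = stay_right \<inter> cyl m y" for m y
  proof -
    have *: "(\<forall>k. \<forall>j\<le>m + k. fst (X 0) \<le> fst (X j)) \<longleftrightarrow> (\<forall>j. fst (X 0) \<le> fst (X j))" for X :: "nat \<Rightarrow> int \<times> int"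
      by (metis le_add2)
    have "X \<in> (\<Inter>k. S m y k) \<longleftrightarrow> X \<in> stay_right \<inter> cyl m y" for X
    proof -
      have "X \<in> (\<Inter>k. S m y k) \<longleftrightarrow> (\<forall>k. \<forall>j\<le>m + k. fst (X 0) \<le> fst (X j)) \<and> (\<forall>j\<le>m. X j = y j)"
        by (simp only: S_def INT_iff mem_Collect_eq ball_UNIV simp_thms all_conj_distrib)
      then show ?thesis unfolding * by (simp only: stay_right_def cyl_def mem_Collect_eq Int_iff)
    qed
    then show ?thesis by (rule set_eqI)
  qed
  have dec: "decseq (S m y)" for m y
    unfolding decseq_def
  proof (intro allI impI subsetI)
    fix k l X assume kl: "k \<le> l" and X: "X \<in> S m y l"
    have "fst (X 0) \<le> fst (X j)" if "j \<le> m + k" for j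
    proof -
      have "j \<le> m + l" using that kl by simp
      then show ?thesis using X unfolding S_def by blast
    qed
    then show "X \<in> S m y k" using X by (simp add: S_def)
  qed
  have lim: "(\<lambda>k. emeasure (QL w) (S m y k)) \<longlonglongrightarrow> emeasure (QL w) (stay_right \<inter> cyl m y)" for w m y
    using Lim_emeasure_decseq[of "S m y" "QL w"] sets_S dec
    by (simp add: S_INT sets_quenched_law image_subset_iff QL.emeasure_finite)
  have "density (QL \<omega>) (indicator stay_right) = density (QL \<omega>') (indicator stay_right)"
  proof (rule path_measure_eqI)
    have *: "emeasure (density (QL w) (indicator stay_right)) A = emeasure (QL w) (stay_right \<inter> A)"
      if "A \<in> sets path_space" for w A
      using that sets_stay_right
      by (subst emeasure_density) (simp_all add: sets_quenched_law indicator_inter_arith[symmetric])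
    show "finite_measure (density (QL \<omega>) (indicator stay_right))"
      by (rule finite_measureI) (use *[OF UNIV_in_path_space] QL.emeasure_finite in simp)
    show "emeasure (density (QL \<omega>) (indicator stay_right)) (cyl m y) =
        emeasure (density (QL \<omega>') (indicator stay_right)) (cyl m y)" for m y
      unfolding *[OF sets_cyl] using LIMSEQ_unique[OF lim[of \<omega> m y] lim[of \<omega>' m y, folded S_eq]] .
  qed (simp_all add: sets_quenched_law)
  then have "emeasure (density (QL \<omega>) (indicator stay_right)) B = emeasure (density (QL \<omega>') (indicator stay_right)) B"
    by simp
  then show ?thesis
    using B sets_stay_right
    by (simp add: emeasure_density sets_quenched_law indicator_inter_arith[symmetric])
qed

text \<open>
  The Markov property after averaging over the colors; the two factors are correlated through the
  coloring.
\<close>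

lemma annealed_markov_cyl:
  assumes A: "A \<in> sets path_space"
  shows "emeasure path_law (cyl n a \<inter> shift n -` A) =
    (\<integral>\<^sup>+\<omega>. emeasure (QL \<omega>) (cyl n a) * emeasure (QL (\<lambda>y. \<omega> (a n + y))) A \<partial>C)"
proof -
  have "emeasure (QL \<omega>) (cyl n a \<inter> shift n -` A) =
      emeasure (QL \<omega>) (cyl n a) * emeasure (QL (\<lambda>y. \<omega> (a n + y))) A" for \<omega>
  proof -
    have "emeasure (QL \<omega>) (cyl n a \<inter> shift n -` A) = (\<integral>\<^sup>+X. indicator (cyl n a \<inter> shift n -` A) X \<partial>QL \<omega>)"
      by (rule nn_integral_indicator[symmetric])
        (simp add: sets_quenched_law sets_cyl sets_shift_vimage[OF A] sets.Int)
    also have "\<dots> = (\<integral>\<^sup>+X. indicator A (shift n X) * indicator (cyl n a) X \<partial>QL \<omega>)"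
      by (intro nn_integral_cong) (auto split: split_indicator)
    also have "\<dots> = emeasure (QL \<omega>) (cyl n a) * (\<integral>\<^sup>+X. indicator A X \<partial>QL (\<lambda>y. \<omega> (a n + y)))"
      by (rule quenched_markov) (rule borel_measurable_indicator[OF A])
    also have "(\<integral>\<^sup>+X. indicator A X \<partial>QL (\<lambda>y. \<omega> (a n + y))) = emeasure (QL (\<lambda>y. \<omega> (a n + y))) A"
      by (rule nn_integral_indicator) (simp add: sets_quenched_law A)
    finally show ?thesis .
  qed
  then show ?thesis
    by (simp add: emeasure_path_law sets.Int sets_cyl sets_shift_vimage[OF A])
qed

lemma translated_QL:
  assumes A: "A \<in> sets path_space"
  shows "(\<integral>\<^sup>+\<omega>. emeasure (QL (\<lambda>y. \<omega> (u + y))) A \<partial>C) = emeasure path_law A"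
  using nn_integral_coloring_translate[OF measurable_QL_emeasure[OF A], of u]
  by (simp only: emeasure_path_law[OF A])

text \<open>
  The annealed walk is not Markovian, but null events remain null when the walk is restarted at a
  fixed time.
\<close>

lemma null_shift:
  assumes A: "A \<in> sets path_space" and null: "emeasure path_law A = 0"
  shows "emeasure path_law (shift n -` A) = 0"
proof -
  have "emeasure path_law (cyl n a \<inter> shift n -` A) \<le> 0" for a
  proof -
    have "emeasure path_law (cyl n a \<inter> shift n -` A) \<le> (\<integral>\<^sup>+\<omega>. emeasure (QL (\<lambda>y. \<omega> (a n + y))) A \<partial>C)"
      unfolding annealed_markov_cyl[OF A]
    proof (rule nn_integral_mono)
      fix \<omega>
      have "emeasure (QL \<omega>) (cyl n a) \<le> 1"
        by (rule prob_space.emeasure_le_1[OF prob_space_quenched_law])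
      then show "emeasure (QL \<omega>) (cyl n a) * emeasure (QL (\<lambda>y. \<omega> (a n + y))) A \<le> emeasure (QL (\<lambda>y. \<omega> (a n + y))) A"
        using mult_right_mono[of "emeasure (QL \<omega>) (cyl n a)" 1] by simp
    qed
    then show ?thesis by (simp add: translated_QL[OF A] null)
  qed
  then have "emeasure path_law ({X. True} \<inter> shift n -` A) = 0"
    by (subst emeasure_prefix_event[where n = n, OF _ sets_path_law sets_shift_vimage[OF A]])
      (simp_all add: prefix_det_def)
  then show ?thesis by simp
qed

text \<open>
  The renewal identity: at a record time the colors ahead are fresh, so that the future, on
  the event that the walk never returns below its present level, is independent of the past.
\<close>

lemma renewal:
  assumes E: "prefix_det n E" and rec: "\<And>X. E X \<Longrightarrow> is_record n X" and B: "B \<in> sets path_space"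
  shows "emeasure path_law ({X. E X} \<inter> shift n -` (stay_right \<inter> B)) =
    emeasure path_law {X. E X} * emeasure path_law (stay_right \<inter> B)"
proof -
  have SB: "stay_right \<inter> B \<in> sets path_space" using sets_stay_right B by (rule sets.Int)
  have cyl: "emeasure path_law (cyl n a \<inter> shift n -` (stay_right \<inter> B)) =
      emeasure path_law (cyl n a) * emeasure path_law (stay_right \<inter> B)" if a: "is_record n a" for a
  proof -
    let ?f = "\<lambda>\<omega>. emeasure (QL \<omega>) (cyl n a)"
    let ?g = "\<lambda>\<omega>. emeasure (QL (\<lambda>y. \<omega> (a n + y))) (stay_right \<inter> B)"
    have "(\<integral>\<^sup>+\<omega>. ?f \<omega> * ?g \<omega> \<partial>C) = (\<integral>\<^sup>+\<omega>. ?f \<omega> \<partial>C) * (\<integral>\<^sup>+\<omega>. ?g \<omega> \<partial>C)"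
    proof (rule nn_integral_coloring_indep[where J = "{z. fst z < fst (a n)}"])
      show "?f \<in> borel_measurable C" by (rule measurable_QL_emeasure[OF sets_cyl])
      show "?g \<in> borel_measurable C"
        by (rule measurable_compose[OF measurable_translate_coloring measurable_QL_emeasure[OF SB]])
      fix \<omega> \<omega>' :: "int \<times> int \<Rightarrow> bool"
      {
        assume *: "\<And>y. y \<in> {z. fst z < fst (a n)} \<Longrightarrow> \<omega> y = \<omega>' y"
        have "\<omega> (a k) = \<omega>' (a k)" if "k < n" for k
          using a that by (intro *) (simp add: is_record_def)
        then show "?f \<omega> = ?f \<omega>'" by (simp add: emeasure_QL_cyl)
      next
        assume *: "\<And>y. y \<notin> {z. fst z < fst (a n)} \<Longrightarrow> \<omega> y = \<omega>' y"
        show "?g \<omega> = ?g \<omega>'"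
          by (rule quenched_stay_right_cong[OF _ B]) (intro *, simp)
      }
    qed
    then show ?thesis
      unfolding annealed_markov_cyl[OF SB] translated_QL[OF SB] emeasure_path_law[OF sets_cyl] .
  qed
  have "emeasure path_law ({X. E X} \<inter> shift n -` (stay_right \<inter> B)) =
      (\<integral>\<^sup>+a. emeasure path_law (cyl n (nth a)) * emeasure path_law (stay_right \<inter> B)
        \<partial>count_space {a. length a = Suc n \<and> E (nth a)})"
    unfolding emeasure_prefix_event[OF E sets_path_law sets_shift_vimage[OF SB]]
    by (intro nn_integral_cong cyl rec) simp
  also have "\<dots> = (\<integral>\<^sup>+a. emeasure path_law (cyl n (nth a)) \<partial>count_space {a. length a = Suc n \<and> E (nth a)}) *
      emeasure path_law (stay_right \<inter> B)"
    by (rule nn_integral_multc) simp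
  also have "(\<integral>\<^sup>+a. emeasure path_law (cyl n (nth a)) \<partial>count_space {a. length a = Suc n \<and> E (nth a)}) =
      emeasure path_law {X. E X}"
    using emeasure_prefix_event[OF E sets_path_law UNIV_in_path_space] by simp
  finally show ?thesis .
qed

text \<open>
  The annealed probability of a record at time \<open>k\<close>.
\<close>

definition record_prob :: "nat \<Rightarrow> real" where
  "record_prob k = measure path_law {X. is_record k X}"

text \<open>
  Probability that the walk stays to the right of its starting point and does not regenerate at any
  of the times \<open>1, \<dots>, j\<close>.
\<close>

definition no_regen_prob :: "nat \<Rightarrow> real" where
  "no_regen_prob j = measure path_law (stay_right \<inter> {X. \<forall>i\<in>{1..j}. \<not> regen i X})"

lemma sets_no_regen: "{X. \<forall>i\<in>{1..j}. \<not> regen i X} \<in> sets path_space"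
proof -
  have "{X. \<forall>i\<in>{1..j}. \<not> regen i X} = UNIV - (\<Union>i\<in>{1..j}. {X. regen i X})" by auto
  then show ?thesis
    using sets.Diff[OF UNIV_in_path_space sets.finite_UN[of "{1..j}" "\<lambda>i. {X. regen i X}"]] sets_regen by simp
qed

text \<open>
  The summands are the probabilities that \<open>k\<close> is the last regeneration time up to time \<open>n\<close>.
\<close>

lemma last_regen_le_1: "(\<Sum>k\<le>n. record_prob k * no_regen_prob (n - k)) \<le> 1"
proof -
  interpret prob_space path_law by (rule prob_space_path_law)
  define A where "A k = {X. is_record k X} \<inter> shift k -` (stay_right \<inter> {X. \<forall>i\<in>{1..n - k}. \<not> regen i X})" for k
  have A: "A k \<in> sets path_law" for k
    unfolding A_def sets_path_law
    by (intro sets.Int sets_prefix_event[OF prefix_det_is_record] sets_shift_vimage sets_stay_right sets_no_regen)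
  have pA: "prob (A k) = record_prob k * no_regen_prob (n - k)" for k
    unfolding A_def measure_def record_prob_def no_regen_prob_def
    by (subst renewal[OF prefix_det_is_record _ sets_no_regen]) (simp_all add: enn2real_mult)
  have disj: "A k \<inter> A l = {}" if "k < l" "l \<le> n" for k l
  proof -
    have "False" if "X \<in> A k" "X \<in> A l" for X
    proof -
      have "regen k X" "regen l X" using that by (auto simp: A_def regen_iff)
      then have "regen (l - k) (shift k X)" using regen_shift[of k X "l - k"] \<open>k < l\<close> by simp
      moreover have "l - k \<in> {1..n - k}" using \<open>k < l\<close> \<open>l \<le> n\<close> by auto
      ultimately show False using that(1) by (auto simp: A_def)
    qed
    then show ?thesis by blast
  qed
  have "disjoint_family_on A {..n}"
    unfolding disjoint_family_on_def
    by (metis atMost_iff disj inf_commute linorder_neqE_nat)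
  then have "(\<Sum>k\<le>n. prob (A k)) = prob (\<Union>k\<le>n. A k)"
    using A by (intro finite_measure_finite_Union[symmetric]) auto
  also have "\<dots> \<le> 1" by (rule prob_le_1)
  finally show ?thesis by (simp add: pA)
qed

text \<open>
  The maximal level of a nearest neighbour path grows only at records, by one each time.
\<close>

lemma level_le_records:
  fixes X :: "nat \<Rightarrow> int \<times> int"
  assumes X0: "X 0 = 0" and step: "\<forall>n. \<exists>i\<in>{1..4}. X (Suc n) = X n + unit_vec i"
  shows "j \<le> n \<Longrightarrow> fst (X j) \<le> (\<Sum>k = 1..n. if is_record k X then 1 else 0)"
proof (induction n arbitrary: j)
  case (Suc n)
  let ?c = "\<lambda>n. \<Sum>k = 1..n. if is_record k X then 1 else 0 :: int"
  have c: "?c (Suc n) = ?c n + (if is_record (Suc n) X then 1 else 0)" by simp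
  show ?case
  proof (cases "j \<le> n")
    case True
    from Suc.IH[OF this] show ?thesis unfolding c by (simp add: add_increasing2)
  next
    case False
    then have j: "j = Suc n" using Suc.prems by simp
    obtain i where "X (Suc n) = X n + unit_vec i" using step by blast
    then have le: "fst (X (Suc n)) \<le> fst (X n) + 1" by (auto simp: unit_vec_def)
    show ?thesis
    proof (cases "fst (X (Suc n)) \<le> ?c n")
      case True
      then show ?thesis unfolding c j by (simp add: add_increasing2)
    next
      case False
      have "is_record (Suc n) X"
        unfolding is_record_def
      proof (intro allI impI)
        fix i assume "i < Suc n"
        then have "fst (X i) \<le> ?c n" by (intro Suc.IH) simp
        then show "fst (X i) < fst (X (Suc n))" using False by simp
      qed
      then show ?thesis using Suc.IH[of n] le unfolding c j by simp
    qed
  qed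
qed (simp add: X0)

lemma mean_level_le_records: "mean_level n \<le> (\<Sum>k = 1..n. record_prob k)"
proof -
  interpret prob_space path_law by (rule prob_space_path_law)
  have r: "{X. is_record k X} \<in> sets path_law" for k
    unfolding sets_path_law by (rule sets_prefix_event[OF prefix_det_is_record])
  have "mean_level n \<le> (\<integral>X. (\<Sum>k = 1..n. indicator {X. is_record k X} X) \<partial>path_law)"
    unfolding mean_level_def
  proof (rule integral_mono_AE[OF integrable_level])
    show "integrable path_law (\<lambda>X. \<Sum>k = 1..n. indicat_real {X. is_record k X} X)"
      using r by (intro Bochner_Integration.integrable_sum integrable_real_indicator) (auto simp: emeasure_eq_measure)
    show "AE X in path_law. real_of_int (fst (X n)) \<le> (\<Sum>k = 1..n. indicat_real {X. is_record k X} X)"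
      using AE_nearest_neighbour
    proof eventually_elim
      case (elim X)
      then have "fst (X n) \<le> (\<Sum>k = 1..n. if is_record k X then 1 else 0)" by (intro level_le_records) auto
      then have "real_of_int (fst (X n)) \<le> real_of_int (\<Sum>k = 1..n. if is_record k X then 1 else 0)" by linarith
      also have "\<dots> = (\<Sum>k = 1..n. indicat_real {X. is_record k X} X)"
        unfolding of_int_sum by (intro sum.cong) (auto simp: indicator_def)
      finally show ?case .
    qed
  qed
  also have "\<dots> = (\<Sum>k = 1..n. record_prob k)"
    using r by (subst Bochner_Integration.integral_sum)
      (auto intro!: integrable_real_indicator simp: emeasure_eq_measure record_prob_def)
  finally show ?thesis .
qed

end

text \<open>
  Summation by parts for Abel sums.
\<close>

lemma abel_increments:
  fixes u :: "nat \<Rightarrow> real"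
  assumes u0: "u 0 = 0" and inc: "\<And>n. \<bar>u (Suc n) - u n\<bar> \<le> K" and s: "0 < s" "s < 1"
  shows "summable (\<lambda>n. s ^ n * u n)" "summable (\<lambda>n. s ^ n * (u (Suc n) - u n))"
    "(1 - s) * (\<Sum>n. s ^ n * u n) = s * (\<Sum>n. s ^ n * (u (Suc n) - u n))"
proof -
  have un: "\<bar>u n\<bar> \<le> K * real (Suc n)" for n
  proof -
    have "\<bar>u n\<bar> \<le> K * real n"
    proof (induction n)
      case (Suc n)
      then show ?case using inc[of n] by (simp add: algebra_simps)
    qed (simp add: u0)
    also have "\<dots> \<le> K * real (Suc n)" using inc[of 0] by (intro mult_left_mono) auto
    finally show ?thesis .
  qed
  have "summable (\<lambda>n. K * (real (Suc n) * s ^ n))"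
    using geometric_deriv_sums[of s] s by (intro summable_mult sums_summable) auto
  then show su: "summable (\<lambda>n. s ^ n * u n)"
  proof (rule summable_comparison_test'[of _ 0])
    fix n
    have "s ^ n * \<bar>u n\<bar> \<le> s ^ n * (K * real (Suc n))" using un s by (intro mult_left_mono) auto
    then show "norm (s ^ n * u n) \<le> K * (real (Suc n) * s ^ n)"
      using s by (simp add: abs_mult mult_ac)
  qed
  have "summable (\<lambda>n. K * s ^ n)" using s by (intro summable_mult summable_geometric) auto
  then show sv: "summable (\<lambda>n. s ^ n * (u (Suc n) - u n))"
  proof (rule summable_comparison_test'[of _ 0])
    fix n
    have "s ^ n * \<bar>u (Suc n) - u n\<bar> \<le> s ^ n * K" using inc s by (intro mult_left_mono) auto
    then show "norm (s ^ n * (u (Suc n) - u n)) \<le> K * s ^ n"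
      using s by (simp add: abs_mult mult_ac)
  qed
  have "(\<Sum>n. s ^ n * u n) = (\<Sum>n. s ^ Suc n * u (Suc n))"
    using suminf_split_head[OF su] by (simp add: u0)
  also have "\<dots> = (\<Sum>n. s * (s ^ n * u n + s ^ n * (u (Suc n) - u n)))"
    by (intro suminf_cong) (simp add: algebra_simps)
  also have "\<dots> = s * ((\<Sum>n. s ^ n * u n) + (\<Sum>n. s ^ n * (u (Suc n) - u n)))"
    using suminf_mult[OF summable_add[OF su sv], of s] suminf_add[OF su sv] by simp
  finally show "(1 - s) * (\<Sum>n. s ^ n * u n) = s * (\<Sum>n. s ^ n * (u (Suc n) - u n))"
    by (simp add: algebra_simps)
qed

context kalikow_drift
begin

lemma prob_exit_le:
  obtains l where "0 < l" "\<And>m :: int. 0 < m \<Longrightarrow> measure path_law {X. \<exists>k. fst (X k) \<le> - m} \<le> exp (- l * real_of_int m)"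
proof -
  obtain l where "0 < l" "p * (exp_step l True - 1) + (1 - p) * M * (exp_step l False - 1) < 0"
    using ex_exp_rate by blast
  from exit_left_half_space[OF this] this(1) show ?thesis
    by (intro that[of l]) (auto simp: measure_def enn2real_leI)
qed

lemma sets_exit: "{X. \<exists>k. fst (X k) \<le> (c :: int)} \<in> sets path_space"
proof -
  have "{X. fst (X k) \<le> c} \<in> sets path_space" for k
    by (rule sets_prefix_event[of k], rule prefix_detI) (metis order_refl)
  then have "(\<Union>k. {X. fst (X k) \<le> c}) \<in> sets path_space" by (intro sets.countable_UN') auto
  also have "(\<Union>k. {X. fst (X k) \<le> c}) = {X. \<exists>k. fst (X k) \<le> c}" by auto
  finally show ?thesis .
qed

lemma stay_right_pos: "0 < measure path_law stay_right"
proof -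
  interpret prob_space path_law by (rule prob_space_path_law)
  obtain l where l: "0 < l" "prob {X. \<exists>k. fst (X k) \<le> - 1} \<le> exp (- l * real_of_int 1)"
    using prob_exit_le zero_less_one by metis
  have "prob {X. \<exists>k. fst (X k) \<le> - 1} < 1"
    by (rule le_less_trans[OF l(2)]) (use l(1) in simp)
  moreover have "prob stay_right = prob (space path_law - {X. \<exists>k. fst (X k) \<le> - 1})"
  proof (rule measure_eq_AE)
    show "AE X in path_law. X \<in> stay_right \<longleftrightarrow> X \<in> space path_law - {X. \<exists>k. fst (X k) \<le> - 1}"
      using AE_nearest_neighbour
    proof eventually_elim
      case (elim X)
      have "0 \<le> i \<longleftrightarrow> \<not> i \<le> - 1" for i :: int by auto
      then show ?case using elim by (simp add: stay_right_def)
    qed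
  qed (use sets_stay_right sets_exit[of "- 1"] in \<open>auto simp: sets_path_law UNIV_in_path_space\<close>)
  moreover have "\<dots> = 1 - prob {X. \<exists>k. fst (X k) \<le> - 1}"
    using sets_exit[of "- 1"] by (intro prob_compl) (simp add: sets_path_law)
  ultimately show ?thesis by simp
qed

lemma AE_bounded_below: "AE X in path_law. \<exists>m. \<forall>k. - m < fst (X k)"
proof -
  interpret prob_space path_law by (rule prob_space_path_law)
  obtain l where l: "0 < l" "\<And>m :: int. 0 < m \<Longrightarrow> prob {X. \<exists>k. fst (X k) \<le> - m} \<le> exp (- l * real_of_int m)"
    using prob_exit_le by blast
  let ?N = "\<Inter>m. {X. \<exists>k. fst (X k) \<le> - int (Suc m)}"
  have N: "?N \<in> sets path_law"
    unfolding sets_path_law by (intro sets.countable_INT'') (auto simp: UNIV_in_path_space sets_exit)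
  have "prob ?N \<le> exp (- l * real (Suc m))" for m
  proof -
    have "prob ?N \<le> prob {X. \<exists>k. fst (X k) \<le> - int (Suc m)}"
      by (intro finite_measure_mono) (auto simp: sets_path_law sets_exit)
    also have "\<dots> \<le> exp (- l * real (Suc m))" using l(2)[of "int (Suc m)"] by simp
    finally show ?thesis .
  qed
  moreover have "(\<lambda>m. exp (- l * real (Suc m))) \<longlonglongrightarrow> 0"
  proof -
    have "exp (- l * real (Suc m)) = exp (- l) ^ Suc m" for m
      by (simp only: exp_of_nat_mult[symmetric] mult.commute)
    then show ?thesis using l(1) LIMSEQ_Suc[OF LIMSEQ_realpow_zero[of "exp (- l)"]] by simp
  qed
  ultimately have "prob ?N \<le> 0" by (intro LIMSEQ_le_const[of _ 0]) auto
  then have "prob ?N = 0" using measure_nonneg[of path_law ?N] by linarith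
  then have "AE X in path_law. X \<notin> ?N" using N by (simp add: prob_eq_0)
  then show ?thesis
  proof eventually_elim
    case (elim X)
    then obtain m where "\<forall>k. \<not> fst (X k) \<le> - int (Suc m)" by auto
    then show ?case by (intro exI[of _ "int (Suc m)"]) (simp add: not_le)
  qed
qed

lemma mean_level_inc: "\<bar>mean_level (Suc n) - mean_level n\<bar> \<le> (b 1 - b 3) + ((b 1 - b 3) + (r 3 - r 1))"
proof -
  have t1: "0 \<le> ((b 1 - b 3) + (r 3 - r 1)) * red_prob n" using drift occ_UNIV(3) by simp
  have t2: "((b 1 - b 3) + (r 3 - r 1)) * red_prob n \<le> ((b 1 - b 3) + (r 3 - r 1)) * 1"
    using drift occ_UNIV(4) by (intro mult_left_mono) auto
  have "\<bar>d - t\<bar> \<le> d + k" if "0 \<le> t" "t \<le> k * 1" "0 \<le> d" for d k t :: real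
    using that by auto
  from this[OF t1 t2] show ?thesis unfolding mean_level_Suc by this (use drift(1) in simp)
qed

lemma discounted_records:
  assumes s: "0 < s" "s < 1"
  shows "summable (\<lambda>k. s ^ k * record_prob k)" "s * min_speed / (1 - s) \<le> (\<Sum>k. s ^ k * record_prob k)"
proof -
  interpret prob_space path_law by (rule prob_space_path_law)
  let ?c = "\<lambda>n. \<Sum>k = 1..n. record_prob k"
  have rp: "0 \<le> record_prob k" "record_prob k \<le> 1" for k by (simp_all add: record_prob_def)
  have inc_c: "?c (Suc n) - ?c n = record_prob (Suc n)" for n by simp
  have "\<bar>?c (Suc n) - ?c n\<bar> \<le> 1" for n unfolding inc_c using rp by simp
  note c = abel_increments[of ?c, OF _ this s, simplified inc_c]
  note x = abel_increments[of mean_level, OF mean_level_0 mean_level_inc s]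
  show sm: "summable (\<lambda>k. s ^ k * record_prob k)"
    by (rule summable_comparison_test'[of "\<lambda>k. s ^ k" 0]) (use s rp in \<open>auto simp: mult_left_le\<close>)
  have "s * (min_speed / (1 - s)) \<le> s * (\<Sum>k. s ^ k * (mean_level (Suc k) - mean_level k))"
    using s by (intro mult_left_mono discounted_drift) auto
  also have "\<dots> = (1 - s) * (\<Sum>n. s ^ n * mean_level n)" using x(3) by simp
  also have "\<dots> \<le> (1 - s) * (\<Sum>n. s ^ n * ?c n)"
    using s by (intro mult_left_mono suminf_le x c mean_level_le_records) auto
  also have "\<dots> = s * (\<Sum>k. s ^ k * record_prob (Suc k))" using c(3) by simp
  also have "\<dots> = (\<Sum>k. s ^ Suc k * record_prob (Suc k))"
    using suminf_mult[OF c(2), of s] by (simp add: mult.assoc)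
  also have "\<dots> \<le> (\<Sum>k. s ^ k * record_prob k)"
    using suminf_split_head[OF sm] rp(1)[of 0] by simp
  finally show "s * min_speed / (1 - s) \<le> (\<Sum>k. s ^ k * record_prob k)" by simp
qed

text \<open>
  The generating functions of \<open>record_prob\<close> and \<open>no_regen_prob\<close> have a product of at most
  \<open>1 / (1 - s)\<close>, by \<open>last_regen_le_1\<close>, and the first one is at least \<open>s * min_speed / (1 - s)\<close>.
\<close>

lemma sum_no_regen_le: "(\<Sum>j<J. no_regen_prob j) \<le> 1 / min_speed"
proof -
  interpret prob_space path_law by (rule prob_space_path_law)
  have nn: "0 \<le> no_regen_prob j" "no_regen_prob j \<le> 1" for j by (simp_all add: no_regen_prob_def)
  have rp: "0 \<le> record_prob k" for k by (simp add: record_prob_def)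
  have *: "s * (\<Sum>j<J. s ^ j * no_regen_prob j) \<le> 1 / min_speed" if s: "0 < s" "s < 1" for s
  proof -
    let ?a = "\<lambda>k. s ^ k * record_prob k" and ?f = "\<lambda>j. s ^ j * no_regen_prob j"
    have sf: "summable ?f"
      by (rule summable_comparison_test'[of "\<lambda>k. s ^ k" 0]) (use s nn in \<open>auto simp: mult_left_le\<close>)
    have sa: "summable ?a" by (rule discounted_records[OF s])
    have norm: "summable (\<lambda>k. norm (?a k))" "summable (\<lambda>k. norm (?f k))"
      using sa sf s rp nn by (simp_all add: abs_mult)
    have "(\<Sum>k. ?a k) * (\<Sum>j. ?f j) = (\<Sum>n. \<Sum>k\<le>n. ?a k * ?f (n - k))"
      by (rule Cauchy_product[OF norm])
    also have "\<dots> \<le> (\<Sum>n. s ^ n)"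
    proof (rule suminf_le)
      fix n
      have "(\<Sum>k\<le>n. ?a k * ?f (n - k)) = s ^ n * (\<Sum>k\<le>n. record_prob k * no_regen_prob (n - k))"
        unfolding sum_distrib_left
      proof (intro sum.cong refl)
        fix k assume "k \<in> {..n}"
        then have "s ^ n = s ^ k * s ^ (n - k)" by (simp add: power_add[symmetric])
        then show "?a k * ?f (n - k) = s ^ n * (record_prob k * no_regen_prob (n - k))"
          by (simp only: mult_ac)
      qed
      also have "\<dots> \<le> s ^ n * 1" using s by (intro mult_left_mono last_regen_le_1) auto
      finally show "(\<Sum>k\<le>n. ?a k * ?f (n - k)) \<le> s ^ n" by simp
    qed (use summable_Cauchy_product[OF norm] s in auto)
    also have "\<dots> = 1 / (1 - s)" using s by (simp add: suminf_geometric)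
    finally have prod: "(\<Sum>k. ?a k) * (\<Sum>j. ?f j) \<le> 1 / (1 - s)" .
    have f0: "0 \<le> (\<Sum>j. ?f j)" using s nn by (intro suminf_nonneg sf) auto
    have "(s * min_speed / (1 - s)) * (\<Sum>j. ?f j) \<le> (\<Sum>k. ?a k) * (\<Sum>j. ?f j)"
      by (intro mult_right_mono discounted_records s f0)
    with prod have "(s * min_speed) * (\<Sum>j. ?f j) / (1 - s) \<le> 1 / (1 - s)" by simp
    then have "(s * min_speed) * (\<Sum>j. ?f j) \<le> 1" using s by (simp add: divide_le_cancel)
    then have "s * (\<Sum>j. ?f j) \<le> 1 / min_speed"
      using min_speed_pos by (simp add: pos_le_divide_eq mult_ac)
    moreover have "s * (\<Sum>j<J. ?f j) \<le> s * (\<Sum>j. ?f j)"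
      using s nn by (intro mult_left_mono sum_le_suminf sf) auto
    ultimately show ?thesis by linarith
  qed
  have "((\<lambda>s. s * (\<Sum>j<J. s ^ j * no_regen_prob j)) \<longlongrightarrow> 1 * (\<Sum>j<J. 1 ^ j * no_regen_prob j)) (at_left 1)"
    by (intro tendsto_intros)
  moreover have "\<forall>\<^sub>F s in at_left (1::real). s * (\<Sum>j<J. s ^ j * no_regen_prob j) \<le> 1 / min_speed"
    using eventually_at_left_real[of 0 "1::real"] by (auto elim!: eventually_mono intro!: *)
  ultimately have "1 * (\<Sum>j<J. 1 ^ j * no_regen_prob j) \<le> 1 / min_speed"
    by (rule tendsto_upperbound) simp
  then show ?thesis by simp
qed

end

section \<open>The regeneration structure\<close>

text \<open>
  The first regeneration time not before \<open>m\<close>. The value is irrelevant if there is none, an event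
  that turns out to be null given \<open>stay_right\<close>.
\<close>

definition regen_time :: "nat \<Rightarrow> (nat \<Rightarrow> int \<times> int) \<Rightarrow> nat" where
  "regen_time m X = (LEAST n. m \<le> n \<and> regen n X)"

text \<open>
  The path restarted at that time.
\<close>

definition restart :: "nat \<Rightarrow> (nat \<Rightarrow> int \<times> int) \<Rightarrow> nat \<Rightarrow> int \<times> int" where
  "restart m X = shift (regen_time m X) X"

text \<open>
  A path from the origin with infinitely many regeneration times, the first of which is time \<open>0\<close>.
\<close>

definition regenerates :: "(nat \<Rightarrow> int \<times> int) \<Rightarrow> bool" where
  "regenerates X \<longleftrightarrow> X 0 = 0 \<and> X \<in> stay_right \<and> (\<forall>k. \<exists>n\<ge>1. regen n ((restart 1 ^^ k) X))"

text \<open>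
  The regeneration times, numbered from \<open>epoch 0 X = 0\<close>.
\<close>

definition epoch :: "nat \<Rightarrow> (nat \<Rightarrow> int \<times> int) \<Rightarrow> nat" where
  "epoch k X = (\<Sum>i<k. regen_time 1 ((restart 1 ^^ i) X))"

lemma regen_time_props:
  assumes "\<exists>n\<ge>m. regen n X"
  shows "m \<le> regen_time m X" "regen (regen_time m X) X"
  unfolding regen_time_def using LeastI_ex[of "\<lambda>n. m \<le> n \<and> regen n X"] assms by auto

lemma not_regen_before: "m \<le> n \<Longrightarrow> n < regen_time m X \<Longrightarrow> \<not> regen n X"
  unfolding regen_time_def using not_less_Least by blast

lemma measurable_regen_time: "regen_time m \<in> path_space \<rightarrow>\<^sub>M count_space UNIV"
proof -
  have "Measurable.pred path_space (\<lambda>X. m \<le> n \<and> regen n X)" for n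
  proof -
    have "{X. m \<le> n \<and> regen n X} = (if m \<le> n then {X. regen n X} else {})" by auto
    then show ?thesis using sets_regen[of n] by (simp add: pred_def space_PiM)
  qed
  then show ?thesis unfolding regen_time_def[abs_def] by (rule measurable_Least)
qed

lemma measurable_restart: "restart m \<in> path_space \<rightarrow>\<^sub>M path_space"
  unfolding restart_def[abs_def]
  by (rule measurable_compose_countable[OF measurable_shift measurable_regen_time])

lemma sets_restart_vimage: "B \<in> sets path_space \<Longrightarrow> restart m -` B \<in> sets path_space"
  using measurable_sets[OF measurable_restart, of B m] by (simp add: space_PiM)

lemma epoch_Suc: "epoch (Suc k) X = epoch k X + regen_time 1 ((restart 1 ^^ k) X)"
  by (simp add: epoch_def)

lemma epoch_props:
  assumes "regenerates X"
  shows "(restart 1 ^^ k) X = shift (epoch k X) X \<and> regen (epoch k X) X"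
proof (induction k)
  case 0
  then show ?case using assms by (simp add: regenerates_def epoch_def shift_0 regen_0)
next
  case (Suc k)
  let ?Y = "(restart 1 ^^ k) X"
  have Y: "?Y = shift (epoch k X) X" "regen (epoch k X) X" using Suc by auto
  have "\<exists>n\<ge>1. regen n ?Y" using assms by (simp add: regenerates_def)
  from regen_time_props(2)[OF this] have "regen (epoch k X + regen_time 1 ?Y) X"
    using regen_shift[OF Y(2)] Y(1) by simp
  moreover have "(restart 1 ^^ Suc k) X = shift (epoch k X + regen_time 1 ?Y) X"
  proof -
    have "shift t ?Y = shift (epoch k X + t) X" for t
      unfolding Y(1) by (rule shift_shift)
    moreover have "(restart 1 ^^ Suc k) X = restart 1 ?Y" by simp
    ultimately show ?thesis by (simp only: restart_def[of 1 ?Y])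
  qed
  ultimately show ?case by (simp add: epoch_Suc)
qed

lemma epoch_less: "regenerates X \<Longrightarrow> epoch k X < epoch (Suc k) X"
  using regen_time_props(1)[of 1 "(restart 1 ^^ k) X"] by (simp add: epoch_Suc regenerates_def)

lemma epoch_mono: "regenerates X \<Longrightarrow> strict_mono (\<lambda>k. epoch k X)"
  by (intro strict_monoI_Suc epoch_less)

text \<open>With \<open>epoch_props\<close>, the regeneration times are exactly the times \<open>epoch k X\<close>.\<close>

lemma regen_imp_epoch:
  assumes X: "regenerates X" and n: "regen n X"
  shows "\<exists>k. n = epoch k X"
proof -
  have mono: "strict_mono (\<lambda>k. epoch k X)" by (rule epoch_mono[OF X])
  define k where "k = Max {k. epoch k X \<le> n}"
  have fin: "finite {k. epoch k X \<le> n}"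
    by (rule finite_subset[of _ "{..n}"]) (use strict_mono_imp_increasing[OF mono] order_trans in auto)
  have "0 \<in> {k. epoch k X \<le> n}" by (simp add: epoch_def)
  then have "k \<in> {k. epoch k X \<le> n}" unfolding k_def using fin by (intro Max_in) auto
  then have le: "epoch k X \<le> n" by simp
  have less: "n < epoch (Suc k) X"
  proof (rule ccontr)
    assume "\<not> n < epoch (Suc k) X"
    then have "Suc k \<le> k" unfolding k_def by (intro Max_ge fin) (simp add: k_def[symmetric])
    then show False by simp
  qed
  have "\<not> 1 \<le> n - epoch k X"
  proof
    assume 1: "1 \<le> n - epoch k X"
    have "n - epoch k X < regen_time 1 ((restart 1 ^^ k) X)" using less le by (simp add: epoch_Suc)
    then have "\<not> regen (n - epoch k X) ((restart 1 ^^ k) X)" using 1 by (rule not_regen_before[rotated])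
    then show False using epoch_props[OF X, of k] n le regen_shift[of "epoch k X" X "n - epoch k X"] by simp
  qed
  then show ?thesis using le by (intro exI[of _ k]) simp
qed

text \<open>
  The part of the event that \<open>X\<close> stays to the right, satisfies \<open>E\<close> and has its first regeneration
  time from \<open>m\<close> on at time \<open>n\<close> which is decided by the path up to time \<open>n\<close>. The other part is
  that the path never falls below its level at time \<open>n\<close>; then an earlier record fails to be a
  regeneration time only if the path returns below it before time \<open>n\<close>.
\<close>

definition first_regen :: "nat \<Rightarrow> ((nat \<Rightarrow> int \<times> int) \<Rightarrow> bool) \<Rightarrow> nat \<Rightarrow> (nat \<Rightarrow> int \<times> int) \<Rightarrow> bool" where
  "first_regen m E n X \<longleftrightarrow> E X \<and> (\<forall>k\<le>n. fst (X 0) \<le> fst (X k)) \<and> is_record n X \<and>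
     (\<forall>j\<in>{m..<n}. is_record j X \<longrightarrow> (\<exists>i. j < i \<and> i < n \<and> fst (X i) < fst (X j)))"

lemma first_regen_iff:
  assumes "m \<le> n"
  shows "first_regen m E n X \<and> shift n X \<in> stay_right \<longleftrightarrow>
    X \<in> stay_right \<and> E X \<and> regen n X \<and> regen_time m X = n"
proof
  assume *: "first_regen m E n X \<and> shift n X \<in> stay_right"
  have fut: "fst (X n) \<le> fst (X k)" if "n \<le> k" for k using * that by (simp add: shift_stay_right)
  have n: "regen n X" using * by (simp add: regen_iff first_regen_def)
  have "fst (X 0) \<le> fst (X k)" for k
  proof (cases "k \<le> n")
    case True
    then show ?thesis using * by (simp add: first_regen_def)
  next
    case False
    have "fst (X 0) \<le> fst (X n)" using * by (simp add: first_regen_def)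
    also have "\<dots> \<le> fst (X k)" using False by (intro fut) simp
    finally show ?thesis .
  qed
  moreover have "\<not> regen j X" if "m \<le> j" "j < n" for j
  proof
    assume j: "regen j X"
    then have "is_record j X" by (simp add: regen_def)
    moreover have "j \<in> {m..<n}" using that by simp
    ultimately obtain i where i: "j < i" "fst (X i) < fst (X j)"
      using * unfolding first_regen_def by blast
    have "fst (X j) \<le> fst (X i)" using j i(1) by (simp add: regen_def)
    then show False using i(2) by simp
  qed
  then have "regen_time m X = n"
    unfolding regen_time_def using n assms by (intro Least_equality) (auto simp: not_less[symmetric])
  ultimately show "X \<in> stay_right \<and> E X \<and> regen n X \<and> regen_time m X = n"
    using * n by (simp add: stay_right_def first_regen_def)
next
  assume *: "X \<in> stay_right \<and> E X \<and> regen n X \<and> regen_time m X = n"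
  have "\<exists>i. j < i \<and> i < n \<and> fst (X i) < fst (X j)" if j: "m \<le> j" "j < n" "is_record j X" for j
  proof -
    have "\<not> regen j X" using * j by (intro not_regen_before[of m]) auto
    then obtain i where i: "j \<le> i" "fst (X i) < fst (X j)" using j(3) by (auto simp: regen_def not_le)
    have "i < n"
    proof (rule ccontr)
      assume "\<not> i < n"
      then have "fst (X n) \<le> fst (X i)" using * by (simp add: regen_def)
      moreover have "fst (X j) < fst (X n)" using * j by (simp add: regen_def is_record_def)
      ultimately show False using i by simp
    qed
    moreover have "j \<noteq> i" using i by auto
    ultimately show ?thesis using i by (intro exI[of _ i]) simp
  qed
  then show "first_regen m E n X \<and> shift n X \<in> stay_right"
    using * by (auto simp: first_regen_def regen_iff stay_right_def)
qed

lemma prefix_det_first_regen: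
  assumes E: "prefix_det m E" and mn: "m \<le> n"
  shows "prefix_det n (first_regen m E n)"
proof (rule prefix_detI)
  fix X Y :: "nat \<Rightarrow> int \<times> int" assume eq: "\<And>k. k \<le> n \<Longrightarrow> X k = Y k" and X: "first_regen m E n X"
  have E': "E X = E Y" using mn by (intro prefix_detD[OF E] eq) simp
  have rec: "is_record j X = is_record j Y" if "j \<le> n" for j
    using that by (auto simp: is_record_def eq)
  show "first_regen m E n Y"
    using X E' by (simp add: first_regen_def eq rec cong: conj_cong)
qed

context two_vertex
begin

text \<open>
  The constant \<open>c\<close> does not depend on \<open>B\<close>: the path after the first regeneration time from \<open>m\<close> on is
  distributed as the walk conditioned on \<open>stay_right\<close>, up to a factor depending on \<open>E\<close>.
\<close>

lemma regeneration_split: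
  assumes E: "prefix_det m E"
    and ex: "AE X in path_law. X \<in> stay_right \<longrightarrow> (\<exists>n\<ge>m. regen n X)"
  shows "\<exists>c. \<forall>B\<in>sets path_space. emeasure path_law (stay_right \<inter> {X. E X} \<inter> restart m -` B) =
    c * emeasure path_law (stay_right \<inter> B)"
proof (intro exI ballI)
  fix B assume B: "B \<in> sets path_space"
  let ?F = "\<lambda>i. {X. first_regen m E (m + i) X}"
  let ?S = "\<lambda>i. ?F i \<inter> shift (m + i) -` (stay_right \<inter> B)"
  have det: "prefix_det (m + i) (first_regen m E (m + i))" for i
    by (rule prefix_det_first_regen[OF E]) simp
  have S: "?S i \<in> sets path_law" for i
    unfolding sets_path_law by (intro sets.Int sets_prefix_event[OF det] sets_shift_vimage sets_stay_right B)
  have S_iff: "X \<in> ?S i \<longleftrightarrow> X \<in> stay_right \<and> E X \<and> regen (m + i) X \<and> regen_time m X = m + i \<and> restart m X \<in> B" for X i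
    using first_regen_iff[of m "m + i" E X] by (auto simp: restart_def)
  have L: "stay_right \<inter> {X. E X} \<inter> restart m -` B \<in> sets path_law"
    unfolding sets_path_law
    by (intro sets.Int sets_stay_right sets_prefix_event[OF E] sets_restart_vimage[OF B])
  have S_range: "range ?S \<subseteq> sets path_law" by (rule image_subsetI) (rule S)
  have "emeasure path_law (stay_right \<inter> {X. E X} \<inter> restart m -` B) = emeasure path_law (\<Union>i. ?S i)"
  proof (rule emeasure_eq_AE)
    show "AE X in path_law. X \<in> stay_right \<inter> {X. E X} \<inter> restart m -` B \<longleftrightarrow> X \<in> (\<Union>i. ?S i)"
      using ex
    proof eventually_elim
      case (elim X)
      show ?case
      proof
        assume *: "X \<in> stay_right \<inter> {X. E X} \<inter> restart m -` B"
        then have "\<exists>n\<ge>m. regen n X" using elim by blast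
        note rt = regen_time_props[OF this]
        then have "X \<in> ?S (regen_time m X - m)" using * unfolding S_iff by auto
        then show "X \<in> (\<Union>i. ?S i)" by blast
      next
        assume "X \<in> (\<Union>i. ?S i)"
        then obtain i where "X \<in> ?S i" by blast
        then show "X \<in> stay_right \<inter> {X. E X} \<inter> restart m -` B" unfolding S_iff by simp
      qed
    qed
  qed (rule L, rule sets.countable_UN[OF S_range])
  also have "\<dots> = (\<Sum>i. emeasure path_law (?S i))"
  proof (rule suminf_emeasure[symmetric])
    show "disjoint_family ?S"
      unfolding disjoint_family_on_def
    proof (intro ballI impI)
      fix i j :: nat assume "i \<noteq> j"
      then show "?S i \<inter> ?S j = {}"
        unfolding disjoint_iff S_iff by (metis add_left_cancel)
    qed
  qed (rule S_range)
  also have "\<dots> = (\<Sum>i. emeasure path_law (?F i) * emeasure path_law (stay_right \<inter> B))"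
    by (intro suminf_cong renewal[OF det _ B]) (simp add: first_regen_def)
  also have "\<dots> = (\<Sum>i. emeasure path_law (?F i)) * emeasure path_law (stay_right \<inter> B)"
    by (rule ennreal_suminf_multc)
  finally show "emeasure path_law (stay_right \<inter> {X. E X} \<inter> restart m -` B) =
      (\<Sum>i. emeasure path_law (?F i)) * emeasure path_law (stay_right \<inter> B)" .
qed

end

context kalikow_drift
begin

text \<open>
  The annealed law of the path conditioned on never falling below its starting level.
\<close>

definition regen_law :: "(nat \<Rightarrow> int \<times> int) measure" where
  "regen_law = uniform_measure path_law stay_right"

lemma sets_regen_law: "sets regen_law = sets path_space"
  by (simp add: regen_law_def sets_path_law)

lemma space_regen_law [simp]: "space regen_law = UNIV"
  by (simp add: regen_law_def)

lemma prob_space_regen_law: "prob_space regen_law"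
proof -
  interpret prob_space path_law by (rule prob_space_path_law)
  show ?thesis
    unfolding regen_law_def using stay_right_pos
    by (intro prob_space_uniform_measure) (auto simp: emeasure_eq_measure)
qed

lemma measure_regen_law:
  assumes B: "B \<in> sets path_space"
  shows "measure regen_law B = measure path_law (stay_right \<inter> B) / measure path_law stay_right"
proof -
  interpret prob_space path_law by (rule prob_space_path_law)
  show ?thesis
    unfolding regen_law_def using stay_right_pos sets_stay_right B
    by (intro measure_uniform_measure) (auto simp: emeasure_eq_measure sets_path_law)
qed

lemma AE_regen_law: "(AE X in regen_law. P X) \<longleftrightarrow> (AE X in path_law. X \<in> stay_right \<longrightarrow> P X)"
proof -
  interpret prob_space path_law by (rule prob_space_path_law)
  show ?thesis
    unfolding regen_law_def using stay_right_pos sets_stay_right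
    by (intro AE_uniform_measure) (auto simp: emeasure_eq_measure sets_path_law)
qed

lemma AE_regen_law_nn:
  "AE X in regen_law. X \<in> stay_right \<and> X 0 = 0 \<and> (\<forall>n. \<exists>i\<in>{1..4}. X (Suc n) = X n + unit_vec i)"
  unfolding AE_regen_law using AE_nearest_neighbour by eventually_elim blast

text \<open>
  The probabilities \<open>no_regen_prob j\<close> are summable, hence not bounded away from \<open>0\<close>.
\<close>

lemma AE_ex_regen: "AE X in regen_law. \<exists>n\<ge>1. regen n X"
proof -
  interpret prob_space path_law by (rule prob_space_path_law)
  let ?N = "stay_right \<inter> {X. \<forall>n\<ge>1. \<not> regen n X}"
  have eq: "{X. \<forall>n\<ge>1. \<not> regen n X} = (\<Inter>j. {X. \<forall>i\<in>{1..j}. \<not> regen i X})" by force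
  have "{X. \<forall>n\<ge>1. \<not> regen n X} \<in> sets path_space"
    unfolding eq by (intro sets.countable_INT'' UNIV_in_path_space sets_no_regen countableI_type)
  then have N: "?N \<in> sets path_law" unfolding sets_path_law by (rule sets.Int[OF sets_stay_right])
  have le: "prob ?N \<le> no_regen_prob j" for j
    unfolding no_regen_prob_def
  proof (rule finite_measure_mono)
    show "?N \<subseteq> stay_right \<inter> {X. \<forall>i\<in>{1..j}. \<not> regen i X}" by auto
    show "stay_right \<inter> {X. \<forall>i\<in>{1..j}. \<not> regen i X} \<in> sets path_law"
      unfolding sets_path_law by (intro sets.Int sets_stay_right sets_no_regen)
  qed
  have J: "real J * prob ?N \<le> 1 / min_speed" for J
  proof -
    have "real J * prob ?N = (\<Sum>j<J. prob ?N)" by simp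
    also have "\<dots> \<le> (\<Sum>j<J. no_regen_prob j)" by (intro sum_mono le)
    also have "\<dots> \<le> 1 / min_speed" by (rule sum_no_regen_le)
    finally show ?thesis .
  qed
  have "prob ?N = 0"
  proof (rule ccontr)
    assume "prob ?N \<noteq> 0"
    then have pos: "0 < prob ?N" using measure_nonneg[of path_law ?N] by linarith
    then obtain J :: nat where "1 / min_speed < real J * prob ?N"
      using reals_Archimedean3[OF pos] by blast
    then show False using J[of J] by simp
  qed
  then have "AE X in path_law. X \<notin> ?N" by (rule prob_eq_0[OF N, THEN iffD1])
  then show ?thesis unfolding AE_regen_law by eventually_elim blast
qed

text \<open>
  Under \<open>regen_law\<close>, the path after the first regeneration time from \<open>m\<close> on is independent of the
  path up to time \<open>m\<close> and again has law \<open>regen_law\<close>.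
\<close>

lemma restart_prefix:
  assumes E: "prefix_det m E" and B: "B \<in> sets path_space"
    and ex: "AE X in regen_law. \<exists>n\<ge>m. regen n X"
  shows "measure regen_law ({X. E X} \<inter> restart m -` B) = measure regen_law {X. E X} * measure regen_law B"
proof -
  let ?q = "measure path_law stay_right"
  have q: "?q \<noteq> 0" using stay_right_pos by simp
  have V: "restart m -` B \<in> sets path_space"
    by (rule sets_restart_vimage[OF B])
  obtain c where c: "\<And>B. B \<in> sets path_space \<Longrightarrow>
      emeasure path_law (stay_right \<inter> {X. E X} \<inter> restart m -` B) = c * emeasure path_law (stay_right \<inter> B)"
    using regeneration_split[OF E ex[unfolded AE_regen_law]] by blast
  have real: "measure path_law (stay_right \<inter> {X. E X} \<inter> restart m -` B) =
      enn2real c * measure path_law (stay_right \<inter> B)" if "B \<in> sets path_space" for B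
    using c[OF that] by (simp add: measure_def enn2real_mult)
  have all: "measure path_law (stay_right \<inter> {X. E X}) = enn2real c * ?q"
    using real[OF UNIV_in_path_space] by simp
  have "measure regen_law ({X. E X} \<inter> restart m -` B) = enn2real c * measure path_law (stay_right \<inter> B) / ?q"
    using measure_regen_law[OF sets.Int[OF sets_prefix_event[OF E] V]] real[OF B] by (simp add: Int_assoc)
  also have "\<dots> = (enn2real c * ?q / ?q) * (measure path_law (stay_right \<inter> B) / ?q)"
    using q by simp
  also have "\<dots> = measure regen_law {X. E X} * measure regen_law B"
    unfolding all[symmetric] by (simp add: measure_regen_law B sets_prefix_event[OF E])
  finally show ?thesis .
qed

lemma restart_invariant: "distr regen_law regen_law (restart 1) = regen_law"
proof (rule measure_eqI)
  interpret prob_space regen_law by (rule prob_space_regen_law)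
  have m: "restart 1 \<in> regen_law \<rightarrow>\<^sub>M regen_law"
    using measurable_restart by (simp cong: measurable_cong_sets add: sets_regen_law)
  fix B assume "B \<in> sets (distr regen_law regen_law (restart 1))"
  then have B: "B \<in> sets path_space" "B \<in> sets regen_law" by (simp_all add: sets_regen_law)
  have "emeasure (distr regen_law regen_law (restart 1)) B = emeasure regen_law (restart 1 -` B)"
    using emeasure_distr[OF m B(2)] by simp
  also have "\<dots> = emeasure regen_law B"
    using restart_prefix[of 1 "\<lambda>_. True" B] B(1) AE_ex_regen prob_space
    by (simp add: prefix_det_def emeasure_eq_measure)
  finally show "emeasure (distr regen_law regen_law (restart 1)) B = emeasure regen_law B" .
qed simp

lemma AE_regenerates: "AE X in regen_law. regenerates X"
proof -
  have m: "restart 1 \<in> regen_law \<rightarrow>\<^sub>M regen_law"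
    using measurable_restart by (simp cong: measurable_cong_sets add: sets_regen_law)
  have "AE X in regen_law. \<exists>n\<ge>1. regen n ((restart 1 ^^ k) X)" for k
  proof (induction k)
    case 0
    then show ?case using AE_ex_regen by simp
  next
    case (Suc k)
    have "AE X in distr regen_law regen_law (restart 1). \<exists>n\<ge>1. regen n ((restart 1 ^^ k) X)"
      unfolding restart_invariant by (rule Suc)
    from AE_distrD[OF m this] show ?case by (simp only: funpow_Suc_right comp_apply)
  qed
  then have "AE X in regen_law. \<forall>k. \<exists>n\<ge>1. regen n ((restart 1 ^^ k) X)"
    unfolding AE_all_countable by blast
  then show ?thesis
    using AE_regen_law_nn
  proof eventually_elim
    case (elim X)
    then show ?case unfolding regenerates_def by blast
  qed
qed

lemma AE_ex_regen_ge: "AE X in regen_law. \<exists>n\<ge>m. regen n X"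
  using AE_regenerates
proof eventually_elim
  case (elim X)
  then show ?case
    using epoch_props[of X m] strict_mono_imp_increasing[OF epoch_mono[of X], of m] by blast
qed

text \<open>
  Events invariant under restarting at the next regeneration are independent of every prefix event,
  hence of themselves.
\<close>

lemma restart_zero_one:
  assumes A: "A \<in> sets path_space" and inv: "\<And>X. restart 1 X \<in> A \<longleftrightarrow> X \<in> A"
  shows "measure regen_law A = 0 \<or> measure regen_law A = 1"
proof -
  interpret prob_space regen_law by (rule prob_space_regen_law)
  have iter: "(restart 1 ^^ k) X \<in> A \<longleftrightarrow> X \<in> A" for k X
  proof (induction k)
    case (Suc k)
    then show ?case using inv[of "(restart 1 ^^ k) X"] by simp
  qed simp
  have prefix: "prob ({X. E X} \<inter> A) = prob {X. E X} * prob A" if E: "prefix_det m E" for m E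
  proof -
    have "prob ({X. E X} \<inter> A) = prob ({X. E X} \<inter> restart m -` A)"
    proof (rule measure_eq_AE)
      show "AE X in regen_law. X \<in> {X. E X} \<inter> A \<longleftrightarrow> X \<in> {X. E X} \<inter> restart m -` A"
        using AE_regenerates AE_ex_regen_ge[of m]
      proof eventually_elim
        case (elim X)
        obtain k where "regen_time m X = epoch k X"
          using regen_imp_epoch[OF elim(1) regen_time_props(2)[OF elim(2)]] by blast
        then have "restart m X = (restart 1 ^^ k) X"
          using epoch_props[OF elim(1), of k] by (simp add: restart_def)
        then show ?case using iter by simp
      qed
      show "{X. E X} \<inter> A \<in> sets regen_law" "{X. E X} \<inter> restart m -` A \<in> sets regen_law"
        unfolding sets_regen_law by (intro sets.Int sets_prefix_event[OF E] A sets_restart_vimage[OF A])+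
    qed
    then show ?thesis using restart_prefix[OF E A AE_ex_regen_ge] by simp
  qed
  have "density regen_law (indicator A) = density regen_law (\<lambda>_. ennreal (prob A))"
  proof (rule path_measure_eqI)
    have 1: "emeasure (density regen_law (indicator A)) B = ennreal (prob (A \<inter> B))"
      if "B \<in> sets path_space" for B
      unfolding emeasure_eq_measure[symmetric]
      by (rule emeasure_restricted) (simp_all only: sets_regen_law that A)
    have 2: "emeasure (density regen_law (\<lambda>_. ennreal (prob A))) B = ennreal (prob A * prob B)"
      if "B \<in> sets path_space" for B
      using emeasure_density_const[of B regen_law "ennreal (prob A)"] that
      by (simp add: sets_regen_law emeasure_eq_measure ennreal_mult)
    show "finite_measure (density regen_law (indicator A))"
      by (rule finite_measureI) (use 1[OF UNIV_in_path_space] in simp)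
    fix n x
    have "prefix_det n (\<lambda>X. X \<in> cyl n x)"
      by (rule prefix_detI) (simp add: cyl_def)
    from prefix[OF this] show "emeasure (density regen_law (indicator A)) (cyl n x) =
        emeasure (density regen_law (\<lambda>_. ennreal (prob A))) (cyl n x)"
      unfolding 1[OF sets_cyl] 2[OF sets_cyl] by (simp add: mult.commute Int_commute)
  qed (simp_all add: sets_regen_law)
  then have "emeasure (density regen_law (indicator A)) A = emeasure (density regen_law (\<lambda>_. ennreal (prob A))) A"
    by simp
  moreover have "A \<in> sets regen_law" using A by (simp only: sets_regen_law)
  ultimately have "ennreal (prob A) = ennreal (prob A * prob A)"
    using emeasure_restricted[of A regen_law A] emeasure_density_const[of A regen_law "ennreal (prob A)"]
    by (simp add: emeasure_eq_measure ennreal_mult)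
  then have "prob A = prob A * prob A" by simp
  then show ?thesis by auto
qed

sublocale regeneration: ergodic_map regen_law "restart 1"
proof -
  interpret prob_space regen_law by (rule prob_space_regen_law)
  show "ergodic_map regen_law (restart 1)"
  proof
    show "restart 1 \<in> regen_law \<rightarrow>\<^sub>M regen_law"
      using measurable_restart by (simp cong: measurable_cong_sets add: sets_regen_law)
    show "distr regen_law regen_law (restart 1) = regen_law" by (rule restart_invariant)
    show "prob A = 0 \<or> prob A = 1"
      if "A \<in> sets regen_law" "\<And>x. x \<in> space regen_law \<Longrightarrow> restart 1 x \<in> A \<longleftrightarrow> x \<in> A" for A
      using that by (intro restart_zero_one) (auto simp: sets_regen_law)
  qed
qed

end

section \<open>The law of large numbers\<close>

text \<open>
  If \<open>t\<close> has linear growth, a sequence that stays above \<open>x (t k)\<close> after time \<open>t k\<close> and below it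
  before has the speed observed along \<open>t\<close>.
\<close>

lemma tendsto_speed_interpolate:
  fixes x :: "nat \<Rightarrow> real" and t :: "nat \<Rightarrow> nat"
  assumes mono: "strict_mono t" and t0: "t 0 = 0"
    and ge: "\<And>k n. t k \<le> n \<Longrightarrow> x (t k) \<le> x n" and le: "\<And>k n. n \<le> t k \<Longrightarrow> x n \<le> x (t k)"
    and t: "(\<lambda>k. real (t k) / real k) \<longlonglongrightarrow> \<mu>" and \<mu>: "0 < \<mu>"
    and x: "(\<lambda>k. x (t k) / real k) \<longlonglongrightarrow> \<nu>"
  shows "(\<lambda>n. x n / real n) \<longlonglongrightarrow> \<nu> / \<mu>"
proof -
  have "\<exists>k. t k \<le> n \<and> n < t (Suc k)" for n
  proof -
    have "\<exists>k. n < t (Suc k)"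
      using strict_mono_imp_increasing[OF mono, of "Suc n"] by (intro exI[of _ n]) simp
    then have L: "n < t (Suc (LEAST k. n < t (Suc k)))" by (rule LeastI_ex)
    moreover have "t (LEAST k. n < t (Suc k)) \<le> n"
    proof (cases "LEAST k. n < t (Suc k)")
      case (Suc j)
      then have "\<not> n < t (Suc j)" using not_less_Least[of j "\<lambda>k. n < t (Suc k)"] by simp
      then show ?thesis using Suc by simp
    qed (simp add: t0)
    ultimately show ?thesis by blast
  qed
  then obtain N where N: "\<And>n. t (N n) \<le> n" "\<And>n. n < t (Suc (N n))" by metis
  have N_lim: "filterlim N at_top sequentially"
    unfolding filterlim_at_top
  proof
    fix K
    have "K \<le> N n" if "t K \<le> n" for n
    proof (rule ccontr)
      assume "\<not> K \<le> N n"
      then have "t (Suc (N n)) \<le> t K" using strict_mono_less_eq[OF mono] by simp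
      then show False using N(2)[of n] that by simp
    qed
    then show "\<forall>\<^sub>F n in sequentially. K \<le> N n" unfolding eventually_sequentially by blast
  qed
  have ratio: "(\<lambda>k. real (Suc k) / real k) \<longlonglongrightarrow> 1"
  proof -
    have "(\<lambda>k. 1 + 1 / real k) \<longlonglongrightarrow> 1 + 0" by (intro tendsto_intros lim_const_over_n)
    moreover have "\<forall>\<^sub>F k in sequentially. 1 + 1 / real k = real (Suc k) / real k"
      using eventually_gt_at_top[of 0] by eventually_elim (simp add: field_simps)
    ultimately show ?thesis by (simp add: Lim_transform_eventually)
  qed
  have shifted: "(\<lambda>k. f (Suc k) / real k) \<longlonglongrightarrow> c" if "(\<lambda>k. f k / real k) \<longlonglongrightarrow> c" for f c
  proof -
    have "(\<lambda>k. f (Suc k) / real (Suc k) * (real (Suc k) / real k)) \<longlonglongrightarrow> c * 1"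
      by (intro tendsto_mult LIMSEQ_Suc[OF that] ratio)
    then show ?thesis by simp
  qed
  have n_lim: "(\<lambda>n. real n / real (N n)) \<longlonglongrightarrow> \<mu>"
  proof (rule tendsto_sandwich)
    show "(\<lambda>n. real (t (N n)) / real (N n)) \<longlonglongrightarrow> \<mu>" by (rule filterlim_compose[OF t N_lim])
    show "(\<lambda>n. real (t (Suc (N n))) / real (N n)) \<longlonglongrightarrow> \<mu>"
      by (rule filterlim_compose[OF shifted[OF t] N_lim])
    show "\<forall>\<^sub>F n in sequentially. real (t (N n)) / real (N n) \<le> real n / real (N n)"
      using N(1) by (intro always_eventually allI divide_right_mono) auto
    show "\<forall>\<^sub>F n in sequentially. real n / real (N n) \<le> real (t (Suc (N n))) / real (N n)"
      using N(2) by (intro always_eventually allI divide_right_mono) (auto intro: less_imp_le)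
  qed
  have x_lim: "(\<lambda>n. x n / real (N n)) \<longlonglongrightarrow> \<nu>"
  proof (rule tendsto_sandwich)
    show "(\<lambda>n. x (t (N n)) / real (N n)) \<longlonglongrightarrow> \<nu>" by (rule filterlim_compose[OF x N_lim])
    show "(\<lambda>n. x (t (Suc (N n))) / real (N n)) \<longlonglongrightarrow> \<nu>"
      by (rule filterlim_compose[OF shifted[OF x] N_lim])
    show "\<forall>\<^sub>F n in sequentially. x (t (N n)) / real (N n) \<le> x n / real (N n)"
      using N(1) by (intro always_eventually allI divide_right_mono ge) auto
    show "\<forall>\<^sub>F n in sequentially. x n / real (N n) \<le> x (t (Suc (N n))) / real (N n)"
      using N(2) by (intro always_eventually allI divide_right_mono le) (auto intro: less_imp_le)
  qed
  have "(\<lambda>n. (x n / real (N n)) / (real n / real (N n))) \<longlonglongrightarrow> \<nu> / \<mu>"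
    using \<mu> by (intro tendsto_divide x_lim n_lim) simp
  moreover have "\<forall>\<^sub>F n in sequentially. (x n / real (N n)) / (real n / real (N n)) = x n / real n"
    using N_lim[unfolded filterlim_at_top, rule_format, of 1] eventually_gt_at_top[of 0]
    by eventually_elim (simp add: field_simps)
  ultimately show ?thesis by (rule Lim_transform_eventually)
qed

text \<open>An Abelian argument: a lower bound on the discounted drift bounds the speed from below.\<close>

lemma discounted_drift_le_speed:
  fixes u :: "nat \<Rightarrow> real"
  assumes u0: "u 0 = 0" and inc: "\<And>n. \<bar>u (Suc n) - u n\<bar> \<le> K"
    and lim: "(\<lambda>n. u n / real n) \<longlonglongrightarrow> v"
    and disc: "\<And>s. 0 < s \<Longrightarrow> s < 1 \<Longrightarrow> d / (1 - s) \<le> (\<Sum>n. s ^ n * (u (Suc n) - u n))"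
  shows "d \<le> v"
proof (rule field_le_epsilon)
  fix e :: real assume e: "0 < e"
  define c where "c = v + e"
  have "\<forall>\<^sub>F n in sequentially. u n / real n < c" using lim e by (intro order_tendstoD) (auto simp: c_def)
  then have "\<forall>\<^sub>F n in sequentially. u n \<le> c * real n"
    using eventually_gt_at_top[of 0] by eventually_elim (simp add: field_simps)
  then obtain N where N: "\<And>n. N \<le> n \<Longrightarrow> u n \<le> c * real n" unfolding eventually_sequentially by blast
  define L where "L = (\<Sum>n<N. \<bar>u n - c * real n\<bar>)"
  have L: "u n \<le> c * real n + L" for n
  proof (cases "n < N")
    case True
    then have "\<bar>u n - c * real n\<bar> \<le> L" unfolding L_def by (intro member_le_sum) auto
    then show ?thesis by linarith
  next
    case False
    moreover have "0 \<le> L" unfolding L_def by (intro sum_nonneg) simp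
    ultimately show ?thesis using N[of n] by simp
  qed
  have main: "s * d \<le> s * c + (1 - s) * L" if s: "0 < s" "s < 1" for s
  proof -
    note su = abel_increments[OF u0 inc s]
    have sn: "summable (\<lambda>n. s ^ n * real n)" "(1 - s) * (\<Sum>n. s ^ n * real n) = s * (1 / (1 - s))"
      using abel_increments[of real 1 s] s by (simp_all add: suminf_geometric)
    have sL: "summable (\<lambda>n. s ^ n * L)" "(\<Sum>n. s ^ n * L) = L / (1 - s)"
      using suminf_mult2[of "\<lambda>n. s ^ n" L] s by (simp_all add: suminf_geometric summable_mult2)
    have "s * (d / (1 - s)) \<le> s * (\<Sum>n. s ^ n * (u (Suc n) - u n))"
      using s by (intro mult_left_mono disc) auto
    also have "\<dots> = (1 - s) * (\<Sum>n. s ^ n * u n)" using su(3) by simp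
    also have "\<dots> \<le> (1 - s) * (\<Sum>n. c * (s ^ n * real n) + s ^ n * L)"
    proof (intro mult_left_mono suminf_le su(1) summable_add summable_mult sn sL)
      fix n
      have "s ^ n * u n \<le> s ^ n * (c * real n + L)" using s by (intro mult_left_mono L) auto
      then show "s ^ n * u n \<le> c * (s ^ n * real n) + s ^ n * L" by (simp add: algebra_simps)
    qed (use s in simp)
    also have "(\<Sum>n. c * (s ^ n * real n) + s ^ n * L) = c * (\<Sum>n. s ^ n * real n) + L / (1 - s)"
      using suminf_add[OF summable_mult[OF sn(1), of c] sL(1)] suminf_mult[OF sn(1), of c] sL(2) by simp
    also have "(1 - s) * \<dots> = c * ((1 - s) * (\<Sum>n. s ^ n * real n)) + (1 - s) * (L / (1 - s))"
      by (simp only: distrib_left mult.left_commute)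
    also have "(1 - s) * (L / (1 - s)) = L" using s by simp
    also have "c * ((1 - s) * (\<Sum>n. s ^ n * real n)) = c * (s * (1 / (1 - s)))" by (simp only: sn(2))
    finally have "s * d / (1 - s) \<le> (s * c + (1 - s) * L) / (1 - s)"
      using s by (simp add: add_divide_distrib mult.commute)
    then show ?thesis using s by (simp add: divide_le_cancel)
  qed
  have "((\<lambda>s. s * d - (s * c + (1 - s) * L)) \<longlongrightarrow> 1 * d - (1 * c + (1 - 1) * L)) (at_left 1)"
    by (intro tendsto_intros)
  moreover have "\<forall>\<^sub>F s in at_left (1::real). s * d - (s * c + (1 - s) * L) \<le> 0"
    using eventually_at_left_real[of 0 "1::real"] by (auto elim!: eventually_mono dest!: main)
  ultimately have "1 * d - (1 * c + (1 - 1) * L) \<le> 0"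
    by (rule tendsto_upperbound) simp
  then show "d \<le> v + e" by (simp add: c_def)
qed

context kalikow_drift
begin

text \<open>
  The number of levels gained up to the first regeneration time after \<open>0\<close>.
\<close>

definition regen_level :: "(nat \<Rightarrow> int \<times> int) \<Rightarrow> real" where
  "regen_level X = real_of_int (fst (X (regen_time 1 X)) - fst (X 0))"

lemma measurable_real_regen_time: "(\<lambda>X. real (regen_time 1 X)) \<in> borel_measurable regen_law"
  using measurable_compose[OF measurable_regen_time[of 1], of real borel]
  by (simp cong: measurable_cong_sets add: sets_regen_law)

text \<open>
  The mean is the sum of the tail probabilities, which are bounded by multiples of \<open>no_regen_prob\<close>.
\<close>

lemma integrable_regen_time: "integrable regen_law (\<lambda>X. real (regen_time 1 X))"
proof (rule integrableI_nonneg)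
  interpret prob_space path_law by (rule prob_space_path_law)
  let ?q = "measure path_law stay_right"
  have S: "{X. t < regen_time 1 X} \<in> sets path_space" for t
    using measurable_sets[OF measurable_regen_time[of 1], of "{t<..}"] by (simp add: space_PiM vimage_def)
  have le: "emeasure regen_law {X. t < regen_time 1 X} \<le> ennreal (no_regen_prob t / ?q)" for t
  proof -
    have "measure path_law (stay_right \<inter> {X. t < regen_time 1 X}) \<le> no_regen_prob t"
      unfolding no_regen_prob_def
    proof (rule finite_measure_mono)
      show "stay_right \<inter> {X. t < regen_time 1 X} \<subseteq> stay_right \<inter> {X. \<forall>i\<in>{1..t}. \<not> regen i X}"
      proof safe
        fix X i assume "t < regen_time 1 X" "i \<in> {1..t}" "regen i X"
        then show False using not_regen_before[of 1 i X] by simp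
      qed
      show "stay_right \<inter> {X. \<forall>i\<in>{1..t}. \<not> regen i X} \<in> sets path_law"
        unfolding sets_path_law by (intro sets.Int sets_stay_right sets_no_regen)
    qed
    then have "measure regen_law {X. t < regen_time 1 X} \<le> no_regen_prob t / ?q"
      unfolding measure_regen_law[OF S] by (rule divide_right_mono) simp
    then show ?thesis
      unfolding regeneration.emeasure_eq_measure by (rule ennreal_leI)
  qed
  have "(\<integral>\<^sup>+X. ennreal (real (regen_time 1 X)) \<partial>regen_law) = (\<Sum>t. emeasure regen_law {X. t < regen_time 1 X})"
  proof -
    have "regen_time 1 \<in> regen_law \<rightarrow>\<^sub>M count_space UNIV"
      using measurable_regen_time[of 1] measurable_cong_sets[OF sets_regen_law refl] by blast
    from nn_integral_nat_function[OF this] show ?thesis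
      by (simp add: ennreal_of_nat_eq_real_of_nat)
  qed
  also have "\<dots> \<le> ennreal (1 / min_speed / ?q)"
    unfolding suminf_eq_SUP
  proof (rule SUP_least)
    fix J
    have "(\<Sum>t<J. emeasure regen_law {X. t < regen_time 1 X}) \<le> (\<Sum>t<J. ennreal (no_regen_prob t / ?q))"
      by (intro sum_mono le)
    also have "\<dots> = ennreal (\<Sum>t<J. no_regen_prob t / ?q)"
      by (rule sum_ennreal) (simp add: no_regen_prob_def)
    also have "\<dots> \<le> ennreal (1 / min_speed / ?q)"
      unfolding sum_divide_distrib[symmetric]
      by (intro ennreal_leI divide_right_mono sum_no_regen_le) simp
    finally show "(\<Sum>t<J. emeasure regen_law {X. t < regen_time 1 X}) \<le> ennreal (1 / min_speed / ?q)" .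
  qed
  also have "\<dots> < \<infinity>" by simp
  finally show "(\<integral>\<^sup>+X. ennreal (real (regen_time 1 X)) \<partial>regen_law) < \<infinity>" .
qed (rule measurable_real_regen_time, simp)

lemma measurable_regen_level: "regen_level \<in> borel_measurable regen_law"
proof -
  have "(\<lambda>X. real_of_int (fst (X n) - fst (X 0))) \<in> borel_measurable path_space" for n
  proof (rule measurable_prefix_fun[of n, OF _ _ refl])
    fix X Y :: "nat \<Rightarrow> int \<times> int" assume eq: "\<And>j. j \<le> n \<Longrightarrow> X j = Y j"
    show "real_of_int (fst (X n) - fst (X 0)) = real_of_int (fst (Y n) - fst (Y 0))"
      using eq[of n] eq[of 0] by simp
  qed simp
  then have "(\<lambda>X. real_of_int (fst (X (regen_time 1 X)) - fst (X 0))) \<in> borel_measurable path_space"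
    by (rule measurable_compose_countable[OF _ measurable_regen_time])
  then show ?thesis
    by (simp cong: measurable_cong_sets add: sets_regen_law regen_level_def[abs_def])
qed

lemma integrable_regen_level: "integrable regen_law regen_level"
proof (rule Bochner_Integration.integrable_bound[OF integrable_regen_time measurable_regen_level])
  show "AE X in regen_law. norm (regen_level X) \<le> norm (real (regen_time 1 X))"
    using AE_regen_law_nn
  proof eventually_elim
    case (elim X)
    then have "\<bar>fst (X (0 + regen_time 1 X)) - fst (X 0)\<bar> \<le> int (regen_time 1 X)"
      by (intro level_diff_le) blast
    then show ?case by (simp add: regen_level_def)
  qed
qed

lemma birkhoff_regen_time:
  "regeneration.birkhoff_sum (\<lambda>X. real (regen_time 1 X)) k X = real (epoch k X)"
  unfolding regeneration.birkhoff_sum_def epoch_def by (rule of_nat_sum[symmetric])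

lemma birkhoff_regen_level:
  assumes X: "regenerates X"
  shows "regeneration.birkhoff_sum regen_level k X = real_of_int (fst (X (epoch k X)))"
proof (induction k)
  case 0
  then show ?case using X unfolding regeneration.birkhoff_sum_def by (simp add: epoch_def regenerates_def)
next
  case (Suc k)
  have "regen_level ((restart 1 ^^ k) X) =
      real_of_int (fst (X (epoch (Suc k) X))) - real_of_int (fst (X (epoch k X)))"
  proof -
    let ?t = "regen_time 1 ((restart 1 ^^ k) X)"
    have eq: "(restart 1 ^^ k) X = shift (epoch k X) X" using epoch_props[OF X] by blast
    have "(restart 1 ^^ k) X ?t = X (epoch (Suc k) X) - X (epoch k X)"
      unfolding epoch_Suc by (simp only: fun_cong[OF eq] shift_def)
    moreover have "(restart 1 ^^ k) X 0 = 0" unfolding eq by (simp add: shift_def)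
    ultimately show ?thesis unfolding regen_level_def by simp
  qed
  then show ?case using Suc unfolding regeneration.birkhoff_sum_def by simp
qed

text \<open>
  The mean gain between regenerations divided by the mean time between them.
\<close>

definition speed :: real where
  "speed = (\<integral>X. regen_level X \<partial>regen_law) / (\<integral>X. real (regen_time 1 X) \<partial>regen_law)"

lemma mean_regen_time_pos: "0 < (\<integral>X. real (regen_time 1 X) \<partial>regen_law)"
proof -
  have "(\<integral>X. 1 \<partial>regen_law) \<le> (\<integral>X. real (regen_time 1 X) \<partial>regen_law)"
  proof (rule integral_mono_AE[OF _ integrable_regen_time])
    show "AE X in regen_law. 1 \<le> real (regen_time 1 X)"
      using AE_ex_regen
    proof eventually_elim
      case (elim X)
      from regen_time_props(1)[OF this] show ?case by simp
    qed
  qed simp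
  then show ?thesis using regeneration.prob_space by simp
qed

lemma AE_regen_law_speed:
  "AE X in regen_law. (\<lambda>n. real_of_int (fst (X n)) / real n) \<longlonglongrightarrow> speed"
  using regeneration.birkhoff_ergodic[OF integrable_regen_time]
    regeneration.birkhoff_ergodic[OF integrable_regen_level] AE_regenerates
proof eventually_elim
  case (elim X)
  show ?case
    unfolding speed_def
  proof (rule tendsto_speed_interpolate[where t = "\<lambda>k. epoch k X"])
    show "strict_mono (\<lambda>k. epoch k X)" by (rule epoch_mono[OF elim(3)])
    show "epoch 0 X = 0" by (simp add: epoch_def)
    have reg: "regen (epoch k X) X" for k using epoch_props[OF elim(3)] by blast
    show "real_of_int (fst (X (epoch k X))) \<le> real_of_int (fst (X n))" if "epoch k X \<le> n" for k n
      using reg[of k] that by (simp add: regen_def)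
    show "real_of_int (fst (X n)) \<le> real_of_int (fst (X (epoch k X)))" if "n \<le> epoch k X" for k n
      using reg[of k] that by (cases "n = epoch k X") (auto simp: regen_def is_record_def intro: less_imp_le)
    show "(\<lambda>k. real (epoch k X) / real k) \<longlonglongrightarrow> (\<integral>X. real (regen_time 1 X) \<partial>regen_law)"
      using elim(1) by (simp only: birkhoff_regen_time)
    show "(\<lambda>k. real_of_int (fst (X (epoch k X))) / real k) \<longlonglongrightarrow> (\<integral>X. regen_level X \<partial>regen_law)"
      using elim(2) by (simp only: birkhoff_regen_level[OF elim(3)])
  qed (rule mean_regen_time_pos)
qed

lemma tendsto_speed_shift:
  fixes X :: "nat \<Rightarrow> int \<times> int"
  assumes "(\<lambda>n. real_of_int (fst (shift m X n)) / real n) \<longlonglongrightarrow> v"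
  shows "(\<lambda>n. real_of_int (fst (X n)) / real n) \<longlonglongrightarrow> v"
proof -
  let ?a = "real_of_int (fst (X m))"
  have "(\<lambda>n. (real_of_int (fst (shift m X n)) / real n + ?a / real n) * (real n / real (n + m))) \<longlonglongrightarrow> (v + 0) * 1"
  proof (intro tendsto_mult tendsto_add assms lim_const_over_n)
    have "(\<lambda>n. 1 - real m / real (n + m)) \<longlonglongrightarrow> 1 - 0"
      by (intro tendsto_diff tendsto_const LIMSEQ_ignore_initial_segment[OF lim_const_over_n])
    moreover have "\<forall>\<^sub>F n in sequentially. 1 - real m / real (n + m) = real n / real (n + m)"
      using eventually_gt_at_top[of 0] by eventually_elim (simp add: field_simps)
    ultimately show "(\<lambda>n. real n / real (n + m)) \<longlonglongrightarrow> 1" by (simp add: Lim_transform_eventually)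
  qed
  moreover have "\<forall>\<^sub>F n in sequentially.
      (real_of_int (fst (shift m X n)) / real n + ?a / real n) * (real n / real (n + m)) =
      real_of_int (fst (X (n + m))) / real (n + m)"
    using eventually_gt_at_top[of 0]
    by eventually_elim (simp add: shift_def add_divide_distrib[symmetric] add.commute)
  ultimately have "(\<lambda>n. real_of_int (fst (X (n + m))) / real (n + m)) \<longlonglongrightarrow> v"
    by (simp add: Lim_transform_eventually)
  then show ?thesis by (rule LIMSEQ_offset)
qed

text \<open>
  Restarted at any fixed time, the walk almost surely has the speed \<open>speed\<close> or later falls below
  its level at that time. As its levels are bounded below, the second alternative cannot hold at
  all times.
\<close>

lemma AE_speed: "AE X in path_law. (\<lambda>n. real_of_int (fst (X n)) / real n) \<longlonglongrightarrow> speed"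
proof -
  let ?G = "\<lambda>X. (\<lambda>n. real_of_int (fst (X n)) / real n) \<longlonglongrightarrow> speed"
  have "AE X in path_law. X \<in> stay_right \<longrightarrow> ?G X"
    using AE_regen_law_speed unfolding AE_regen_law .
  then obtain N where N: "{X. \<not> (X \<in> stay_right \<longrightarrow> ?G X)} \<subseteq> N" "emeasure path_law N = 0" "N \<in> sets path_space"
    by (rule AE_E) (simp add: sets_path_law)
  have "AE X in path_law. shift m X \<notin> N" for m
  proof -
    have "shift m -` N \<in> null_sets path_law"
      using null_shift[OF N(3,2)] sets_shift_vimage[OF N(3)] by (simp add: null_sets_def sets_path_law)
    from AE_not_in[OF this] show ?thesis by simp
  qed
  then have "AE X in path_law. \<forall>m. shift m X \<notin> N" unfolding AE_all_countable by blast
  then show ?thesis using AE_bounded_below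
  proof eventually_elim
    case (elim X)
    show "?G X"
    proof (rule ccontr)
      assume not: "\<not> ?G X"
      have lower: "\<exists>k. fst (X k) < fst (X m)" for m
      proof -
        have "\<not> ?G (shift m X)" using not tendsto_speed_shift by blast
        then have "shift m X \<notin> stay_right" using elim(1) N(1) by blast
        then show ?thesis by (auto simp: shift_stay_right not_le)
      qed
      have "\<exists>k. fst (X k) \<le> fst (X 0) - int c" for c
      proof (induction c)
        case (Suc c)
        then obtain k where "fst (X k) \<le> fst (X 0) - int c" by blast
        moreover obtain j where "fst (X j) < fst (X k)" using lower by blast
        ultimately show ?case by (intro exI[of _ j]) simp
      qed auto
      moreover obtain a where "\<forall>k. - a < fst (X k)" using elim(2) by blast
      ultimately show False
      proof -
        assume "\<And>c. \<exists>k. fst (X k) \<le> fst (X 0) - int c" and a: "\<forall>k. - a < fst (X k)"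
        then obtain k where "fst (X k) \<le> fst (X 0) - int (nat (fst (X 0) + a))" by blast
        moreover have "- a < fst (X k)" "- a < fst (X 0)" using a by auto
        ultimately show False by simp
      qed
    qed
  qed
qed

lemma mean_speed: "(\<lambda>n. mean_level n / real n) \<longlonglongrightarrow> speed"
proof -
  interpret prob_space path_law by (rule prob_space_path_law)
  have "(\<lambda>n. \<integral>X. real_of_int (fst (X n)) / real n \<partial>path_law) \<longlonglongrightarrow> (\<integral>X. speed \<partial>path_law)"
  proof (rule integral_dominated_convergence[where w = "\<lambda>_. 1"])
    show "AE X in path_law. (\<lambda>n. real_of_int (fst (X n)) / real n) \<longlonglongrightarrow> speed" by (rule AE_speed)
    show "AE X in path_law. norm (real_of_int (fst (X n)) / real n) \<le> 1" for n
      using AE_nearest_neighbour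
    proof eventually_elim
      case (elim X)
      then have "\<bar>fst (X (0 + n)) - fst (X 0)\<bar> \<le> int n" by (intro level_diff_le) blast
      then have "\<bar>real_of_int (fst (X n))\<bar> \<le> real n" using elim by simp
      then show ?case by (cases "n = 0") simp_all
    qed
  qed (auto intro!: borel_measurable_divide measurable_level)
  then show ?thesis using prob_space by (simp add: mean_level_def)
qed

lemma min_speed_le: "min_speed \<le> speed"
  by (rule discounted_drift_le_speed[OF mean_level_0 mean_level_inc mean_speed discounted_drift(2)])

lemma red_prob_ge: "(1 - p) * record_prob k \<le> red_prob k"
proof -
  interpret prob_space path_law by (rule prob_space_path_law)
  have "ennreal ((1 - p) * record_prob k) = ennreal (1 - p) * emeasure path_law {X. is_record k X}"
    using p by (simp add: record_prob_def emeasure_eq_measure ennreal_mult)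
  also have "\<dots> \<le> ennreal (1 - p) * emeasure path_law {X. \<forall>j<k. X j \<noteq> X k}"
  proof (intro mult_left_mono emeasure_mono)
    show "{X. is_record k X} \<subseteq> {X. \<forall>j<k. X j \<noteq> X k}" unfolding is_record_def by force
    show "{X. \<forall>j<k. X j \<noteq> X k} \<in> sets path_law"
      unfolding sets_path_law
      by (rule sets_prefix_event[of k], rule prefix_detI) (metis less_imp_le order_refl)
  qed simp
  also have "\<dots> \<le> ennreal (red_prob k)" using first_visit_red[of k] by (simp only: occ_UNIV(1))
  finally show ?thesis using occ_UNIV(3) by simp
qed

text \<open>
  Red sites are seen at least \<open>1 - p\<close> times as often as records, on average, and there are at
  least as many records as levels gained; each red site seen costs drift.
\<close>

lemma speed_le: "speed \<le> (b 1 - b 3) / (1 + (1 - p) * ((b 1 - b 3) + (r 3 - r 1)))"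
proof -
  let ?d = "b 1 - b 3" and ?D = "(b 1 - b 3) + (r 3 - r 1)"
  have D: "0 < ?D" using drift by simp
  have mean: "mean_level n = real n * ?d - ?D * (\<Sum>k<n. red_prob k)" for n
  proof (induction n)
    case (Suc n)
    then show ?case using mean_level_Suc[of n] by (simp add: algebra_simps)
  qed (simp add: mean_level_0)
  have le: "mean_level n \<le> (real n * ?d + ?D * (1 - p)) / (1 + (1 - p) * ?D)" for n
  proof -
    have "mean_level n - 1 \<le> (\<Sum>k<n. record_prob k)"
    proof -
      have rp: "0 \<le> record_prob k" "record_prob k \<le> 1" for k
        using prob_space.prob_le_1[OF prob_space_path_law] by (simp_all add: record_prob_def)
      have "mean_level n \<le> (\<Sum>k = 1..n. record_prob k)" by (rule mean_level_le_records)
      also have "\<dots> \<le> (\<Sum>k<Suc n. record_prob k)"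
        using rp by (intro sum_mono2) auto
      also have "\<dots> \<le> (\<Sum>k<n. record_prob k) + 1" using rp[of n] by simp
      finally show ?thesis by simp
    qed
    then have "(1 - p) * (mean_level n - 1) \<le> (1 - p) * (\<Sum>k<n. record_prob k)"
      using p by (intro mult_left_mono) auto
    also have "\<dots> \<le> (\<Sum>k<n. red_prob k)"
      unfolding sum_distrib_left by (intro sum_mono red_prob_ge)
    finally have "?D * ((1 - p) * (mean_level n - 1)) \<le> ?D * (\<Sum>k<n. red_prob k)"
      using D by (intro mult_left_mono) auto
    then have "mean_level n + ?D * ((1 - p) * (mean_level n - 1)) \<le> real n * ?d"
      using mean[of n] by linarith
    then have "mean_level n * (1 + (1 - p) * ?D) \<le> real n * ?d + ?D * (1 - p)"
      by (simp add: algebra_simps)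
    moreover have "0 < 1 + (1 - p) * ?D" using p D by (intro add_pos_nonneg) auto
    ultimately show ?thesis by (simp only: pos_le_divide_eq)
  qed
  let ?c = "1 + (1 - p) * ?D"
  have "(\<lambda>n. ?d / ?c + (?D * (1 - p) / ?c) / real n) \<longlonglongrightarrow> ?d / ?c + 0"
    by (intro tendsto_add tendsto_const lim_const_over_n)
  moreover have "\<forall>\<^sub>F n in sequentially. mean_level n / real n \<le> ?d / ?c + (?D * (1 - p) / ?c) / real n"
    using eventually_gt_at_top[of 0]
  proof eventually_elim
    case (elim n)
    have "mean_level n / real n \<le> ((real n * ?d + ?D * (1 - p)) / ?c) / real n"
      by (intro divide_right_mono le) simp
    also have "\<dots> = (real n * ?d / ?c) / real n + (?D * (1 - p) / ?c) / real n"
      by (simp only: add_divide_distrib)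
    also have "(real n * ?d / ?c) / real n = ?d / ?c" using elim by simp
    finally show ?case .
  qed
  ultimately have "speed \<le> ?d / ?c + 0"
    by (intro tendsto_le[OF sequentially_bot _ mean_speed]) auto
  then show ?thesis by simp
qed

end

theorem theorem1:
  fixes p M :: real and b r :: "nat \<Rightarrow> real"
  assumes p: "0 < p" "p < 1"
    and b: "\<And>i. i \<in> {1..4} \<Longrightarrow> 0 < b i" "(\<Sum>i = 1..4. b i) = 1"
    and r: "\<And>i. i \<in> {1..4} \<Longrightarrow> 0 < r i" "(\<Sum>i = 1..4. r i) = 1"
    and drift: "b 1 > b 3" "r 3 > r 1"
    and M: "M = Max ((\<lambda>i. b i / r i) ` {1..4})"
    and ratio: "p * (b 1 - b 3) / ((1 - p) * (r 3 - r 1)) > M"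
  shows "(AE (\<omega>, X) in annealed_law p b r.
            filterlim (\<lambda>n. real_of_int (fst (X n))) at_top sequentially) \<and>
         (AE (\<omega>, X) in annealed_law p b r. \<exists>v.
            (\<lambda>n. real_of_int (fst (X n)) / real n) \<longlonglongrightarrow> v \<and>
            0 < v \<and>
            (p * (b 1 - b 3) - (1 - p) * M * (r 3 - r 1)) / (p + (1 - p) * M) \<le> v \<and>
            v \<le> (b 1 - b 3) / (1 + (1 - p) * ((b 1 - b 3) + (r 3 - r 1))))"
proof -
  have ratio_le: "b i \<le> M * r i" if "i \<in> {1..4}" for i
  proof -
    have "b i / r i \<le> M" unfolding M using that by (intro Max_ge) auto
    then show ?thesis using r(1)[OF that] by (simp add: pos_divide_le_eq)
  qed
  have "0 < (1 - p) * (r 3 - r 1)" using p drift by simp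
  then have strong: "(1 - p) * M * (r 3 - r 1) < p * (b 1 - b 3)"
    using ratio by (simp only: pos_less_divide_eq) (simp only: mult_ac)
  interpret kalikow_drift p b r M
    by unfold_locales (use p b r ratio_le drift strong in auto)
  have pos: "0 < speed" using min_speed_pos min_speed_le by linarith
  have "AE X in path_law. filterlim (\<lambda>n. real_of_int (fst (X n))) at_top sequentially"
    using AE_speed
  proof eventually_elim
    case (elim X)
    have "filterlim (\<lambda>n. real_of_int (fst (X n)) / real n * real n) at_top sequentially"
      by (rule filterlim_tendsto_pos_mult_at_top[OF elim pos filterlim_real_sequentially])
    moreover have "\<forall>\<^sub>F n in sequentially. real_of_int (fst (X n)) / real n * real n = real_of_int (fst (X n))"
      using eventually_gt_at_top[of 0] by eventually_elim simp
    ultimately show ?case by (simp cong: filterlim_cong)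
  qed
  moreover have "AE X in path_law. \<exists>v. (\<lambda>n. real_of_int (fst (X n)) / real n) \<longlonglongrightarrow> v \<and> 0 < v \<and>
      (p * (b 1 - b 3) - (1 - p) * M * (r 3 - r 1)) / (p + (1 - p) * M) \<le> v \<and>
      v \<le> (b 1 - b 3) / (1 + (1 - p) * ((b 1 - b 3) + (r 3 - r 1)))"
    using AE_speed
    by eventually_elim (use pos min_speed_le[unfolded min_speed_def] speed_le in blast)
  ultimately show ?thesis by (intro conjI AE_annealed_law)
qed

end
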